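(* Let $\Omega\subset\mathbb R^d$ ($d\ge1$) be a connected bounded open set, let $M>0$, and let $a_k\in L^1(\Omega\times\Omega)$ be non-negative with $\|a_k\|_{L^1(\Omega\times\Omega)}\le M$ for all $k$. Let $F_k(u)=\int_{\Omega\times\Omega}|u(x)-u(y)|^2a_k(x,y)\,dx\,dy+\int_\Omega|\nabla u|^2\,dx$ for $u\in H^1_0(\Omega)$, and assume $F_k$ $\Gamma$-converges in the weak topology of $H^1_0(\Omega)$ to $F$. Then there exist positive Radon measures $\mu$ on $\Omega\times\Omega$ and $\nu$ on $\Omega$ such that (a) for every $u\in C^\infty_c(\Omega)$, $$F(u)=\int_{\Omega\times\Omega}|u(x)-u(y)|^2\,d\mu(x,y)+\int_\Omega|u(x)|^2\,d\nu(x)+\int_\Omega|\nabla u(x)|^2\,dx;$$ (b) $\mu$ is symmetric, i.e. $\mu(A\times B)=\mu(B\times A)$ for all Borel sets $A,B\subset\Omega$; (c) $\mu((\Omega\times\Omega)\cap\Delta)=0$, where $\Delta=\{(x,x):x\in\mathbb R^d\}$.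
   Context: $\Gamma$-convergence in the weak topology of $H^1_0(\Omega)$ is understood in the usual sequential sense (liminf inequality along weakly converging sequences and existence of weakly converging recovery sequences). *)

theory Defs
  imports "HOL-Analysis.Analysis"
begin

fun partials :: "('a::euclidean_space \<Rightarrow> real) \<Rightarrow> 'a list \<Rightarrow> ('a \<Rightarrow> real)" where
  "partials f [] = f"
| "partials f (b # bs) = (\<lambda>x. frechet_derivative (partials f bs) (at x) b)"

definition smooth :: "('a::euclidean_space \<Rightarrow> real) \<Rightarrow> bool" where
  "smooth f \<longleftrightarrow> (\<forall>bs. set bs \<subseteq> Basis \<longrightarrow> (\<forall>x. partials f bs differentiable (at x)))"

definition test_fn :: "'a::euclidean_space set \<Rightarrow> ('a \<Rightarrow> real) \<Rightarrow> bool" where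
  "test_fn \<Omega> \<phi> \<longleftrightarrow> smooth \<phi> \<and> compact (closure {x. \<phi> x \<noteq> 0}) \<and> closure {x. \<phi> x \<noteq> 0} \<subseteq> \<Omega>"

definition grad :: "('a::euclidean_space \<Rightarrow> real) \<Rightarrow> 'a \<Rightarrow> 'a" where
  "grad f x = (\<Sum>b\<in>Basis. frechet_derivative f (at x) b *\<^sub>R b)"

text \<open>H10_pair Omega u g: u (a Borel representative) is an H^1 limit of test functions
  on \<Omega>, with g the limit of their gradients, i.e. g is the weak gradient of u.
  H^1_0 is the closure of the test functions in the H^1 norm.\<close>
definition H10_pair :: "'a::euclidean_space set \<Rightarrow> ('a \<Rightarrow> real) \<Rightarrow> ('a \<Rightarrow> 'a) \<Rightarrow> bool" where
  "H10_pair \<Omega> u g \<longleftrightarrow> u \<in> borel_measurable borel \<and> g \<in> borel_measurable borel \<and>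
     (\<exists>\<phi>::nat \<Rightarrow> 'a \<Rightarrow> real. (\<forall>n. test_fn \<Omega> (\<phi> n)) \<and>
        (\<lambda>n. \<integral>\<^sup>+x\<in>\<Omega>. ennreal ((\<phi> n x - u x)\<^sup>2) \<partial>lborel) \<longlonglongrightarrow> 0 \<and>
        (\<lambda>n. \<integral>\<^sup>+x\<in>\<Omega>. ennreal ((norm (grad (\<phi> n) x - g x))\<^sup>2) \<partial>lborel) \<longlonglongrightarrow> 0)"

definition H10 :: "'a::euclidean_space set \<Rightarrow> ('a \<Rightarrow> real) \<Rightarrow> bool" where
  "H10 \<Omega> u \<longleftrightarrow> (\<exists>g. H10_pair \<Omega> u g)"

text \<open>Weak gradient (determined a.e. on \<Omega>).\<close>
definition wgrad :: "'a::euclidean_space set \<Rightarrow> ('a \<Rightarrow> real) \<Rightarrow> 'a \<Rightarrow> 'a" where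
  "wgrad \<Omega> u = (SOME g. H10_pair \<Omega> u g)"

definition H1_inner :: "'a::euclidean_space set \<Rightarrow> ('a \<Rightarrow> real) \<Rightarrow> ('a \<Rightarrow> real) \<Rightarrow> real" where
  "H1_inner \<Omega> u v = (LINT x:\<Omega>|lborel. u x * v x + inner (wgrad \<Omega> u x) (wgrad \<Omega> v x))"

definition H10_weak_conv :: "'a::euclidean_space set \<Rightarrow> (nat \<Rightarrow> 'a \<Rightarrow> real) \<Rightarrow> ('a \<Rightarrow> real) \<Rightarrow> bool" where
  "H10_weak_conv \<Omega> us u \<longleftrightarrow> (\<forall>n. H10 \<Omega> (us n)) \<and> H10 \<Omega> u \<and>
     (\<forall>v. H10 \<Omega> v \<longrightarrow> (\<lambda>n. H1_inner \<Omega> (us n) v) \<longlonglongrightarrow> H1_inner \<Omega> u v)"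

definition Gamma_conv_weak_H10 ::
  "'a::euclidean_space set \<Rightarrow> (nat \<Rightarrow> ('a \<Rightarrow> real) \<Rightarrow> ennreal) \<Rightarrow> (('a \<Rightarrow> real) \<Rightarrow> ennreal) \<Rightarrow> bool" where
  "Gamma_conv_weak_H10 \<Omega> Fk F \<longleftrightarrow>
     (\<forall>u us. H10_weak_conv \<Omega> us u \<longrightarrow> F u \<le> liminf (\<lambda>k. Fk k (us k))) \<and>
     (\<forall>u. H10 \<Omega> u \<longrightarrow> (\<exists>us. H10_weak_conv \<Omega> us u \<and> limsup (\<lambda>k. Fk k (us k)) \<le> F u))"

definition Fk_fun :: "'a::euclidean_space set \<Rightarrow> ('a \<times> 'a \<Rightarrow> real) \<Rightarrow> ('a \<Rightarrow> real) \<Rightarrow> ennreal" where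
  "Fk_fun \<Omega> a u =
     (\<integral>\<^sup>+z\<in>\<Omega>\<times>\<Omega>. ennreal ((u (fst z) - u (snd z))\<^sup>2 * a z) \<partial>lborel) +
     (\<integral>\<^sup>+x\<in>\<Omega>. ennreal ((norm (wgrad \<Omega> u x))\<^sup>2) \<partial>lborel)"

text \<open>Positive Radon measure on an open set U, extended by zero to the whole space:
  a Borel measure carried by U and finite on compact subsets of U.\<close>
definition radon_on :: "'a::euclidean_space set \<Rightarrow> 'a measure \<Rightarrow> bool" where
  "radon_on U \<mu> \<longleftrightarrow> sets \<mu> = sets borel \<and> emeasure \<mu> (- U) = 0 \<and>
     (\<forall>K. compact K \<and> K \<subseteq> U \<longrightarrow> emeasure \<mu> K < \<infinity>)"

end

theory Submission
  imports Defs "HOL-Probability.Probability"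
begin

text \<open>
  The Gamma-limit \<open>F\<close> is a quadratic form on test functions, because each \<open>F\<^sub>k\<close> satisfies the
  parallelogram law, and it is Markovian: a smooth contraction composed with a recovery sequence converges
  weakly to the composed limit, by Rellich's theorem. Weak lower semicontinuity of the Dirichlet integral
  and the liminf inequality along constant sequences give
  \<open>0 \<le> G u \<le> M (osc u)\<^sup>2\<close> for \<open>G u = F u - \<integral> |\<nabla>u|\<^sup>2\<close>. Contractions close to \<open>s \<mapsto> |s|\<close> and
  \<open>s \<mapsto> min s 1\<close> show for the polar form that \<open>G(u, v) \<le> 0\<close> for non-negative \<open>u\<close>, \<open>v\<close> with
  disjoint supports, and \<open>G(u, v) \<ge> 0\<close> if \<open>u \<ge> 0\<close> and \<open>v \<le> 1\<close> with \<open>v = 1\<close> where \<open>u\<close> does not vanish.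
  Since \<open>G\<close> is continuous for the supremum norm, it can be evaluated on fine partitions of unity, where it
  becomes a sum of squared differences \<open>(u x - u y)\<^sup>2\<close> with non-negative weights of bounded total mass; killing
  is a jump to a fixed point outside the domain. A weak limit of these discrete measures
  represents \<open>G\<close>; its restriction to the domain off the diagonal is the jump measure, and the part that
  charges pairs with exactly one point in the domain is the killing measure.
\<close>

subsection \<open>Smooth functions\<close>

text \<open>Finiteness of \<open>F\<close> and the parallelogram law are established on test
  functions only. The contractions \<open>|s|\<close> and \<open>min s 1\<close> leave that class,
  so they are applied only where the result is a test function again, as in
  \<open>u + v = |u - v|\<close>, and are reached through smooth contractions. The Markov property
  belongs to \<open>F\<close>, not to \<open>G\<close>; it yields signs for the polar form of
  \<open>G\<close> because in both cases the gradients are pointwise orthogonal and the Dirichlet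
  parts cancel. The oscillation bound also excludes a strongly local part: on a grid the diagonal
  entries of \<open>G\<close> add up to at most \<open>4 * M\<close> for every mesh, so neighbouring
  cells, where \<open>u\<close> varies by order \<open>1 / N\<close>, contribute order
  \<open>1 / N^2\<close>. The far entries are then controlled by \<open>G \<ge> 0\<close>, which
  bounds the total mass. The limit measure may charge pairs with a boundary point; test functions
  vanish there, so such pairs count as killing. Compactness is obtained on the real line, by lifting
  the atoms along a space-filling curve.\<close>

abbreviation pdiff :: "'a::euclidean_space \<Rightarrow> ('a \<Rightarrow> real) \<Rightarrow> 'a \<Rightarrow> real" where
  "pdiff b f \<equiv> (\<lambda>x. frechet_derivative f (at x) b)"

text \<open>Iterated derivatives are handled by an invariant: a set of differentiable functions
  closed under partial derivatives contains all of them. Each closure property of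
  \<open>smooth\<close> below comes with its own invariant set.\<close>

lemma smoothI:
  assumes "f \<in> S"
    and diff: "\<And>g x. g \<in> S \<Longrightarrow> g differentiable (at x)"
    and closed: "\<And>g b. g \<in> S \<Longrightarrow> b \<in> Basis \<Longrightarrow> pdiff b g \<in> S"
  shows "smooth f"
proof -
  have "partials f bs \<in> S" if "set bs \<subseteq> Basis" for bs
    using that by (induction bs) (auto simp: assms)
  then show ?thesis
    unfolding smooth_def using diff by blast
qed

lemma smooth_differentiable: "smooth f \<Longrightarrow> f differentiable (at x)"
  unfolding smooth_def by (metis partials.simps(1) empty_subsetI list.set(1))

lemma smooth_has_derivative:
  "smooth f \<Longrightarrow> (f has_derivative frechet_derivative f (at x)) (at x)"
  using smooth_differentiable frechet_derivative_works by blast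

text \<open>The head of the list is the last derivative taken, so the first one sits at the
  end.\<close>

lemma partials_append_single: "partials f (bs @ [b]) = partials (pdiff b f) bs"
  by (induction bs) auto

lemma smooth_pdiff: "smooth f \<Longrightarrow> b \<in> Basis \<Longrightarrow> smooth (pdiff b f)"
  unfolding smooth_def partials_append_single[symmetric] by auto

lemma smooth_continuous_on: "smooth f \<Longrightarrow> continuous_on S f"
  by (simp add: continuous_at_imp_continuous_on differentiable_imp_continuous_within smooth_differentiable)

lemma smooth_isCont: "smooth f \<Longrightarrow> isCont f x"
  by (simp add: differentiable_imp_continuous_within smooth_differentiable)

lemma smooth_borel [measurable_dest]: "smooth f \<Longrightarrow> f \<in> borel_measurable borel"
  by (simp add: borel_measurable_continuous_onI smooth_continuous_on)

lemma pdiff_eqI: "(\<And>x. (f has_derivative f' x) (at x)) \<Longrightarrow> pdiff b f = (\<lambda>x. f' x b)"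
  by (metis frechet_derivative_at)

lemma smooth_const [simp, intro]: "smooth (\<lambda>x::'a::euclidean_space. c)"
proof (rule smoothI[where S="range (\<lambda>c (x::'a). c)"])
  fix g b assume "g \<in> range (\<lambda>c (x::'a). c::real)"
  then obtain c where "g = (\<lambda>x. c)" by auto
  then have "pdiff b g = (\<lambda>x. 0)" by simp
  then show "pdiff b g \<in> range (\<lambda>c (x::'a). c)" by simp
qed auto

lemma smooth_inner_left [simp, intro]: "smooth (\<lambda>x::'a::euclidean_space. x \<bullet> c)"
proof (rule smoothI[where S="insert (\<lambda>x. x \<bullet> c) (Collect smooth)"])
  have "pdiff b (\<lambda>x. x \<bullet> c) = (\<lambda>x. b \<bullet> c)" for b
    by (rule pdiff_eqI) (auto intro!: derivative_eq_intros)
  then show "pdiff b g \<in> insert (\<lambda>x. x \<bullet> c) (Collect smooth)"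
    if "g \<in> insert (\<lambda>x. x \<bullet> c) (Collect smooth)" "b \<in> Basis" for b g
    using that smooth_pdiff by (cases "g = (\<lambda>x. x \<bullet> c)") auto
qed (auto intro: smooth_differentiable)

lemma smooth_ident [simp, intro]: "smooth (\<lambda>s::real. s)"
  using smooth_inner_left[of "1::real"] by simp

lemma smooth_add [intro]:
  assumes "smooth f" "smooth g" shows "smooth (\<lambda>x. f x + g x)"
proof (rule smoothI[where S="{\<lambda>x. f x + g x | f g. smooth f \<and> smooth g}"])
  show "(\<lambda>x. f x + g x) \<in> {\<lambda>x. f x + g x | f g. smooth f \<and> smooth g}" using assms by blast
next
  fix h x assume "h \<in> {\<lambda>x. f x + g x | f g. smooth f \<and> smooth g}"
  then show "h differentiable (at x)" by (auto intro: differentiable_add smooth_differentiable)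
next
  fix h :: "'a \<Rightarrow> real" and b :: 'a
  assume "h \<in> {\<lambda>x. f x + g x | f g. smooth f \<and> smooth g}" "b \<in> Basis"
  then obtain f g where h: "h = (\<lambda>x. f x + g x)" "smooth f" "smooth g" "b \<in> Basis" by auto
  have "pdiff b h = (\<lambda>x. pdiff b f x + pdiff b g x)" unfolding h(1)
    by (rule pdiff_eqI) (intro has_derivative_add smooth_has_derivative h)
  moreover have "smooth (pdiff b f)" "smooth (pdiff b g)" using smooth_pdiff h by auto
  ultimately show "pdiff b h \<in> {\<lambda>x. f x + g x | f g. smooth f \<and> smooth g}"
    unfolding mem_Collect_eq by (intro exI[of _ "pdiff b f"] exI[of _ "pdiff b g"]) simp
qed

text \<open>The Leibniz rule turns a product into a sum of products: products alone are not closed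
  under derivatives, their finite sums are.\<close>

inductive_set prod_span :: "('a::euclidean_space \<Rightarrow> real) set" where
  prod: "smooth f \<Longrightarrow> smooth g \<Longrightarrow> (\<lambda>x. f x * g x) \<in> prod_span"
| add: "f \<in> prod_span \<Longrightarrow> g \<in> prod_span \<Longrightarrow> (\<lambda>x. f x + g x) \<in> prod_span"

lemma smooth_mult [intro]:
  assumes "smooth f" "smooth g" shows "smooth (\<lambda>x. f x * g x)"
proof (rule smoothI[where S=prod_span])
  show "(\<lambda>x. f x * g x) \<in> prod_span" using assms by (rule prod_span.prod)
  show diff: "h differentiable (at x)" if "h \<in> prod_span" for h :: "'a \<Rightarrow> real" and x
    using that by induction (auto intro: differentiable_add differentiable_mult smooth_differentiable)
  show "pdiff b h \<in> prod_span" if "h \<in> prod_span" "b \<in> Basis" for h and b :: 'a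
    using that
  proof induction
    case (prod f g)
    have "pdiff b (\<lambda>x. f x * g x) = (\<lambda>x. f x * pdiff b g x + pdiff b f x * g x)"
      by (rule pdiff_eqI) (intro has_derivative_mult smooth_has_derivative prod)
    then show ?case
      using prod_span.add[OF prod_span.prod[OF prod(1) smooth_pdiff[OF prod(2)]]
          prod_span.prod[OF smooth_pdiff[OF prod(1)] prod(2)]] prod(3) by simp
  next
    case (add f g)
    have "pdiff b (\<lambda>x. f x + g x) = (\<lambda>x. pdiff b f x + pdiff b g x)"
      by (rule pdiff_eqI) (intro has_derivative_add diff[THEN frechet_derivative_works[THEN iffD1]] add)
    then show ?case using prod_span.add[OF add.IH] add.prems by simp
  qed
qed

lemma smooth_minus [intro]: "smooth f \<Longrightarrow> smooth g \<Longrightarrow> smooth (\<lambda>x. f x - g x)"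
  using smooth_add[of f "\<lambda>x. (-1) * g x"] smooth_mult[of "\<lambda>x. -1" g] by auto

lemma smooth_prod [intro]: "(\<And>i. i \<in> I \<Longrightarrow> smooth (f i)) \<Longrightarrow> smooth (\<lambda>x. \<Prod>i\<in>I. f i x)"
  by (induction I rule: infinite_finite_induct) auto

text \<open>Differentiating \<open>T (u x)\<close> gives the derivative of \<open>T\<close> at
  \<open>u x\<close> times a derivative of \<open>u\<close>; the smooth factor \<open>w\<close>
  collects such terms.\<close>

inductive_set comp_span :: "('a::euclidean_space \<Rightarrow> real) \<Rightarrow> ('a \<Rightarrow> real) set" for u where
  comp: "smooth T \<Longrightarrow> smooth w \<Longrightarrow> (\<lambda>x. T (u x) * w x) \<in> comp_span u"
| add: "f \<in> comp_span u \<Longrightarrow> g \<in> comp_span u \<Longrightarrow> (\<lambda>x. f x + g x) \<in> comp_span u"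

lemma smooth_DERIV:
  assumes "smooth T"
  shows "(T has_real_derivative pdiff 1 T s) (at s)"
proof (rule has_derivative_imp_has_field_derivative[OF smooth_has_derivative[OF assms]])
  fix h :: real
  have "linear (frechet_derivative T (at s))"
    using smooth_has_derivative[OF assms] has_derivative_linear by blast
  from linear_scale[OF this, of h 1] show "h * pdiff 1 T s = frechet_derivative T (at s) h"
    by simp
qed

lemma pdiff_real_eqI: "(\<And>s. (T has_real_derivative T' s) (at s)) \<Longrightarrow> pdiff 1 T = T'"
  using pdiff_eqI[of T "\<lambda>s. (*) (T' s)" 1] unfolding has_field_derivative_def by simp

lemma comp_has_derivative:
  assumes "smooth T" "smooth u"
  shows "((\<lambda>x. T (u x)) has_derivative (\<lambda>h. pdiff 1 T (u x) * frechet_derivative u (at x) h)) (at x)"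
  using has_derivative_compose[OF smooth_has_derivative[OF assms(2)],
    of T "\<lambda>h. pdiff 1 T (u x) * h" x] smooth_DERIV[OF assms(1), of "u x"]
  unfolding has_field_derivative_def by simp

lemma smooth_compose:
  fixes u :: "'a::euclidean_space \<Rightarrow> real"
  assumes "smooth T" "smooth u" shows "smooth (\<lambda>x. T (u x))"
proof (rule smoothI[where S="comp_span u"])
  show "(\<lambda>x. T (u x)) \<in> comp_span u"
    using comp_span.comp[OF assms(1) smooth_const[of 1]] by simp
  show diff: "h differentiable (at x)" if "h \<in> comp_span u" for h :: "'a \<Rightarrow> real" and x
    using that
  proof induction
    case (comp T w)
    have "(\<lambda>x. T (u x)) differentiable (at x)"
      using comp_has_derivative[OF comp(1) assms(2)] differentiableI by blast
    then show ?case using comp by (auto intro: differentiable_mult smooth_differentiable)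
  qed (rule differentiable_add)
  show "pdiff b h \<in> comp_span u" if "h \<in> comp_span u" "b \<in> Basis" for h and b :: 'a
    using that
  proof induction
    case (comp T w)
    have "pdiff b (\<lambda>x. T (u x) * w x) =
        (\<lambda>x. T (u x) * pdiff b w x + pdiff 1 T (u x) * pdiff b u x * w x)"
      by (rule pdiff_eqI) (intro has_derivative_mult comp_has_derivative smooth_has_derivative comp assms)
    also have "\<dots> = (\<lambda>x. T (u x) * pdiff b w x + pdiff 1 T (u x) * (pdiff b u x * w x))"
      by (simp add: mult.assoc)
    also have "\<dots> \<in> comp_span u"
      using comp assms by (intro comp_span.intros smooth_mult smooth_pdiff) auto
    finally show ?case .
  next
    case (add f g)
    have "pdiff b (\<lambda>x. f x + g x) = (\<lambda>x. pdiff b f x + pdiff b g x)"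
      by (rule pdiff_eqI) (intro has_derivative_add diff[THEN frechet_derivative_works[THEN iffD1]] add)
    then show ?case using comp_span.add[OF add.IH] add.prems by simp
  qed
qed

text \<open>Every derivative of \<open>1 / g\<close> is a sum of smooth numerators over powers of
  \<open>g\<close>.\<close>

inductive_set inverse_span :: "('a::euclidean_space \<Rightarrow> real) \<Rightarrow> ('a \<Rightarrow> real) set" for g where
  quot: "smooth w \<Longrightarrow> (\<lambda>x. w x * inverse (g x) ^ n) \<in> inverse_span g"
| add: "f \<in> inverse_span g \<Longrightarrow> h \<in> inverse_span g \<Longrightarrow> (\<lambda>x. f x + h x) \<in> inverse_span g"

lemma smooth_inverse:
  fixes g :: "'a::euclidean_space \<Rightarrow> real"
  assumes "smooth g" and nz: "\<And>x. g x \<noteq> 0" shows "smooth (\<lambda>x. inverse (g x))"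
proof (rule smoothI[where S="inverse_span g"])
  show "(\<lambda>x. inverse (g x)) \<in> inverse_span g"
    using inverse_span.quot[OF smooth_const[of 1], of g 1] by simp
  have der: "((\<lambda>x. w x * inverse (g x) ^ n) has_derivative
     (\<lambda>h. frechet_derivative w (at x) h * inverse (g x) ^ n +
        - (real n * w x * frechet_derivative g (at x) h) * inverse (g x) ^ Suc n)) (at x)"
    if "smooth w" for w x n
  proof (cases n)
    case 0
    then show ?thesis using smooth_has_derivative[OF that] by simp
  next
    case (Suc m)
    have gi: "((\<lambda>x. inverse (g x)) has_derivative
        (\<lambda>h. - (inverse (g x) * frechet_derivative g (at x) h * inverse (g x)))) (at x)"
      by (rule Deriv.has_derivative_inverse[OF nz smooth_has_derivative[OF assms(1)]])
    have "((\<lambda>x. w x * inverse (g x) ^ n) has_derivative (\<lambda>h. w x * (real n *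
         - (inverse (g x) * frechet_derivative g (at x) h * inverse (g x)) * inverse (g x) ^ (n - 1)) +
         frechet_derivative w (at x) h * inverse (g x) ^ n)) (at x)"
      by (rule has_derivative_mult[OF smooth_has_derivative[OF that] has_derivative_power[OF gi]])
    then show ?thesis
      by (rule has_derivative_eq_rhs) (simp add: Suc fun_eq_iff algebra_simps)
  qed
  show diff: "h differentiable (at x)" if "h \<in> inverse_span g" for h :: "'a \<Rightarrow> real" and x
    using that
  proof induction
    case (quot w n)
    show ?case using der[OF quot] by (rule differentiableI)
  qed (rule differentiable_add)
  show "pdiff b h \<in> inverse_span g" if "h \<in> inverse_span g" "b \<in> Basis" for h and b :: 'a
    using that
  proof induction
    case (quot w n)
    have "pdiff b (\<lambda>x. w x * inverse (g x) ^ n) =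
        (\<lambda>x. pdiff b w x * inverse (g x) ^ n + - (real n * w x * pdiff b g x) * inverse (g x) ^ Suc n)"
      by (rule pdiff_eqI) (rule der[OF quot(1)])
    also have "\<dots> = (\<lambda>x. pdiff b w x * inverse (g x) ^ n + ((- real n) * (w x * pdiff b g x)) * inverse (g x) ^ Suc n)"
      by (simp add: mult.assoc)
    also have "\<dots> \<in> inverse_span g"
      using quot assms by (intro inverse_span.intros smooth_mult smooth_pdiff smooth_const) auto
    finally show ?case .
  next
    case (add f h)
    have "pdiff b (\<lambda>x. f x + h x) = (\<lambda>x. pdiff b f x + pdiff b h x)"
      by (rule pdiff_eqI) (intro has_derivative_add diff[THEN frechet_derivative_works[THEN iffD1]] add)
    then show ?case using inverse_span.add[OF add.IH] add.prems by simp
  qed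
qed

section \<open>Model functions: a smoothed absolute value and a flat exponential step\<close>

definition soft_abs :: "real \<Rightarrow> real \<Rightarrow> real" where
  "soft_abs e s = sqrt (s\<^sup>2 + e\<^sup>2)"

lemma soft_abs_pos: "e > 0 \<Longrightarrow> 0 < s\<^sup>2 + (e::real)\<^sup>2"
  by (rule add_nonneg_pos) auto

lemma soft_abs_DERIV:
  assumes "e > 0"
  shows "(soft_abs e has_real_derivative s / soft_abs e s) (at s)"
  unfolding soft_abs_def[abs_def] using soft_abs_pos[OF assms, of s]
  by (auto intro!: derivative_eq_intros simp: field_simps)

text \<open>The derivative of \<open>soft_abs e\<close> is \<open>s / (s^2 + e^2)\<close> times
  \<open>soft_abs e\<close> itself, so its multiples by smooth functions form an invariant
  set.\<close>

lemma smooth_soft_abs: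
  assumes "e > 0" shows "smooth (soft_abs e)"
proof (rule smoothI[where S="{\<lambda>s. w s * soft_abs e s | w. smooth w}"])
  show "soft_abs e \<in> {\<lambda>s. w s * soft_abs e s | w. smooth w}"
    using smooth_const[of 1] by force
  have der: "((\<lambda>s. w s * soft_abs e s) has_real_derivative
      (pdiff 1 w s + w s * s * inverse (s * s + e * e)) * soft_abs e s) (at s)"
    if "smooth w" for w s
  proof -
    have sq: "soft_abs e s * soft_abs e s = s * s + e * e" "soft_abs e s > 0"
      using soft_abs_pos[OF assms, of s] by (auto simp: soft_abs_def power2_eq_square)
    have "s / soft_abs e s = s * inverse (s * s + e * e) * soft_abs e s"
      using sq(2) by (simp add: sq(1)[symmetric] divide_inverse)
    then show ?thesis
      by (auto intro!: derivative_eq_intros smooth_DERIV[OF that] soft_abs_DERIV[OF assms]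
          simp: algebra_simps)
  qed
  show "g differentiable (at x)" if "g \<in> {\<lambda>s. w s * soft_abs e s | w. smooth w}" for g x
    using that der real_differentiable_def by blast
  show "pdiff b g \<in> {\<lambda>s. w s * soft_abs e s | w. smooth w}"
    if g: "g \<in> {\<lambda>s. w s * soft_abs e s | w. smooth w}" and "b \<in> Basis" for g b
  proof -
    obtain w where w: "g = (\<lambda>s. w s * soft_abs e s)" "smooth w" using g by auto
    have nz: "s * s + e * e \<noteq> 0" for s
      using assms by auto
    have "pdiff 1 g = (\<lambda>s. (pdiff 1 w s + w s * s * inverse (s * s + e * e)) * soft_abs e s)"
      unfolding w(1) by (rule pdiff_real_eqI) (rule der[OF w(2)])
    moreover have "smooth (\<lambda>s. pdiff 1 w s + w s * s * inverse (s * s + e * e))"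
      using w nz by (intro smooth_add smooth_mult smooth_inverse smooth_pdiff) auto
    ultimately show ?thesis using \<open>b \<in> Basis\<close> by auto
  qed
qed

text \<open>The classical flat function together with its derivatives. With
  \<open>y = 1 / s\<close>, the derivative of \<open>poly p y * exp (- y)\<close> belongs to the
  polynomial \<open>y^2 * (p - pderiv p)\<close>, so the family is closed under
  differentiation.\<close>

definition exp_step :: "real poly \<Rightarrow> real \<Rightarrow> real" where
  "exp_step p s = (if s \<le> 0 then 0 else poly p (1 / s) * exp (- (1 / s)))"

lemma poly_times_exp_minus_tendsto: "((\<lambda>y::real. poly p y * exp (- y)) \<longlongrightarrow> 0) at_top"
proof -
  have "((\<lambda>y. \<Sum>i\<le>degree p. coeff p i * (y ^ i / exp y)) \<longlongrightarrow> (\<Sum>i\<le>degree p. coeff p i * 0)) at_top"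
    by (intro tendsto_sum tendsto_mult tendsto_const tendsto_power_div_exp_0)
  then show ?thesis
    by (simp add: poly_altdef exp_minus sum_distrib_right divide_inverse mult.assoc)
qed

lemma exp_step_DERIV:
  "(exp_step p has_real_derivative exp_step ([:0, 0, 1:] * (p - pderiv p)) s) (at s)"
proof -
  consider "s < 0" | "s > 0" | "s = 0" by linarith
  then show ?thesis
  proof cases
    case 1
    have "((\<lambda>_. 0) has_real_derivative 0) (at s)" by simp
    then have "(exp_step p has_real_derivative 0) (at s)"
      by (rule has_field_derivative_transform_within_open[where S="{..<0}"]) (use 1 in \<open>auto simp: exp_step_def\<close>)
    then show ?thesis using 1 by (simp add: exp_step_def)
  next
    case 2
    have "((\<lambda>s. poly p (1 / s) * exp (- (1 / s))) has_real_derivative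
        exp_step ([:0, 0, 1:] * (p - pderiv p)) s) (at s)"
      using 2 by (auto intro!: derivative_eq_intros DERIV_chain2[OF poly_DERIV]
          simp: exp_step_def field_simps power2_eq_square)
    then show ?thesis
      by (rule has_field_derivative_transform_within_open[where S="{0<..}"]) (use 2 in \<open>auto simp: exp_step_def\<close>)
  next
    case 3
    \<comment> \<open>The difference quotient at \<open>0\<close> from the right is again a
      polynomial times an exponential in \<open>y = 1 / s\<close>; the polynomial
      \<open>y * p\<close> is \<open>pCons 0 p\<close>.\<close>
    have "((\<lambda>s. poly (pCons 0 p) (inverse s) * exp (- inverse s)) \<longlongrightarrow> 0) (at_right (0::real))"
      using filterlim_compose[OF poly_times_exp_minus_tendsto filterlim_inverse_at_top_right] .
    then have "((\<lambda>s. exp_step p s / s) \<longlongrightarrow> 0) (at_right 0)"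
      by (rule Lim_transform_eventually)
        (auto simp: eventually_at_filter exp_step_def field_simps)
    moreover have "((\<lambda>s. exp_step p s / s) \<longlongrightarrow> 0) (at_left 0)"
      by (rule Lim_transform_eventually[OF tendsto_const])
        (auto simp: eventually_at_filter exp_step_def)
    ultimately have "((\<lambda>s. exp_step p s / s) \<longlongrightarrow> 0) (at 0)"
      by (simp add: filterlim_split_at)
    then show ?thesis using 3 by (simp add: DERIV_def exp_step_def)
  qed
qed

lemma smooth_exp_step: "smooth (exp_step p)"
proof (rule smoothI[where S="range exp_step"])
  show "g differentiable (at x)" if "g \<in> range exp_step" for g x
    using that exp_step_DERIV real_differentiable_def by blast
  show "pdiff b g \<in> range exp_step" if "g \<in> range exp_step" "b \<in> Basis" for g b
    using that pdiff_real_eqI[OF exp_step_DERIV] by auto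
qed auto

lemma lborel_shift:
  fixes f :: "'a::euclidean_space \<Rightarrow> 'b::euclidean_space"
  assumes [measurable]: "f \<in> borel_measurable borel"
  shows "(\<integral>x. f (x + t) \<partial>lborel) = (\<integral>x. f x \<partial>lborel)"
    and "integrable lborel (\<lambda>x. f (x + t)) \<longleftrightarrow> integrable lborel f"
proof -
  have "(\<integral>x. f x \<partial>lborel) = (\<integral>x. f x \<partial>distr lborel borel ((+) t))"
    by (simp add: lborel_distr_plus)
  also have "\<dots> = (\<integral>x. f (x + t) \<partial>lborel)"
    by (subst integral_distr) (auto simp: add.commute)
  finally show "(\<integral>x. f (x + t) \<partial>lborel) = (\<integral>x. f x \<partial>lborel)" by simp
  have "integrable lborel f \<longleftrightarrow> integrable (distr lborel borel ((+) t)) f"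
    by (simp add: lborel_distr_plus)
  also have "\<dots> \<longleftrightarrow> integrable lborel (\<lambda>x. f (x + t))"
    by (subst integrable_distr_eq) (auto simp: add.commute)
  finally show "integrable lborel (\<lambda>x. f (x + t)) \<longleftrightarrow> integrable lborel f" by simp
qed

subsection \<open>Square integrable functions\<close>

text \<open>Square integrability on the whole space; functions on the domain enter through extension
  by zero. No quotient by null sets is formed, so \<open>sqn\<close> is the square of a seminorm
  only.\<close>

definition L2 :: "('a::euclidean_space \<Rightarrow> 'b::euclidean_space) \<Rightarrow> bool" where
  "L2 f \<longleftrightarrow> f \<in> borel_measurable borel \<and> integrable lborel (\<lambda>x. (norm (f x))\<^sup>2)"

definition ip :: "('a::euclidean_space \<Rightarrow> 'b::euclidean_space) \<Rightarrow> ('a \<Rightarrow> 'b) \<Rightarrow> real" where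
  "ip f g = (\<integral>x. f x \<bullet> g x \<partial>lborel)"

definition sqn :: "('a::euclidean_space \<Rightarrow> 'b::euclidean_space) \<Rightarrow> real" where
  "sqn f = (\<integral>x. (norm (f x))\<^sup>2 \<partial>lborel)"

lemma L2_measurable [measurable_dest]: "L2 f \<Longrightarrow> f \<in> borel_measurable borel"
  by (simp add: L2_def)

lemma L2_integrable: "L2 f \<Longrightarrow> integrable lborel (\<lambda>x. (norm (f x))\<^sup>2)"
  by (simp add: L2_def)

lemma L2_add:
  assumes "L2 f" "L2 g" shows "L2 (\<lambda>x. f x + g x)"
  unfolding L2_def
proof
  note [measurable] = assms[THEN L2_measurable]
  show "(\<lambda>x. f x + g x) \<in> borel_measurable borel" by simp
  have le: "(norm (f x + g x))\<^sup>2 \<le> 2 * (norm (f x))\<^sup>2 + 2 * (norm (g x))\<^sup>2" for x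
  proof -
    have "(norm (f x + g x))\<^sup>2 \<le> (norm (f x) + norm (g x))\<^sup>2"
      by (intro power_mono norm_triangle_ineq) auto
    also have "\<dots> \<le> 2 * (norm (f x))\<^sup>2 + 2 * (norm (g x))\<^sup>2"
      using sum_squares_bound[of "norm (f x)" "norm (g x)"] by (simp add: power2_sum)
    finally show ?thesis .
  qed
  show "integrable lborel (\<lambda>x. (norm (f x + g x))\<^sup>2)"
    by (rule Bochner_Integration.integrable_bound[where f="\<lambda>x. 2 * (norm (f x))\<^sup>2 + 2 * (norm (g x))\<^sup>2"])
      (use le assms in \<open>auto simp: L2_integrable\<close>)
qed

lemma L2_scaleR:
  assumes "L2 f" shows "L2 (\<lambda>x. c *\<^sub>R f x)"
  using assms by (auto simp: L2_def power_mult_distrib)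

lemma L2_diff: "L2 f \<Longrightarrow> L2 g \<Longrightarrow> L2 (\<lambda>x. f x - g x)"
  using L2_add[of f "\<lambda>x. (-1) *\<^sub>R g x"] L2_scaleR[of g "-1"] by simp

lemma L2_shift: "L2 f \<Longrightarrow> L2 (\<lambda>x. f (x + t))"
  unfolding L2_def using lborel_shift(2)[of "\<lambda>x. (norm (f x))\<^sup>2" t] by auto

lemma L2_bound:
  assumes "L2 g" and [measurable]: "f \<in> borel_measurable borel" and "AE x in lborel. norm (f x) \<le> norm (g x)"
  shows "L2 f"
  unfolding L2_def
proof
  show "integrable lborel (\<lambda>x. (norm (f x))\<^sup>2)"
    by (rule Bochner_Integration.integrable_bound[OF L2_integrable[OF assms(1)]])
      (use assms(3) in \<open>auto elim!: eventually_mono intro: power_mono\<close>)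
qed simp

lemma L2_inner_integrable:
  assumes "L2 f" "L2 g" shows "integrable lborel (\<lambda>x. f x \<bullet> g x)"
proof -
  note [measurable] = assms[THEN L2_measurable]
  have "\<bar>f x \<bullet> g x\<bar> \<le> (norm (f x))\<^sup>2 + (norm (g x))\<^sup>2" for x
  proof -
    have "\<bar>f x \<bullet> g x\<bar> \<le> norm (f x) * norm (g x)" by (rule Cauchy_Schwarz_ineq2)
    also have "\<dots> \<le> (norm (f x))\<^sup>2 + (norm (g x))\<^sup>2"
      using sum_squares_bound[of "norm (f x)" "norm (g x)"]
        mult_nonneg_nonneg[OF norm_ge_zero norm_ge_zero, of "f x" "g x"] by linarith
    finally show ?thesis .
  qed
  then show ?thesis
    by (intro Bochner_Integration.integrable_bound[where
          f="\<lambda>x. (norm (f x))\<^sup>2 + (norm (g x))\<^sup>2" and g="\<lambda>x. f x \<bullet> g x"])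
      (auto intro!: Bochner_Integration.integrable_add L2_integrable assms)
qed

lemma ip_commute: "ip f g = ip g f"
  by (simp add: ip_def inner_commute)

lemma ip_add_left: "L2 f \<Longrightarrow> L2 g \<Longrightarrow> L2 h \<Longrightarrow> ip (\<lambda>x. f x + g x) h = ip f h + ip g h"
  by (simp add: ip_def inner_add_left L2_inner_integrable)

lemma ip_diff_left: "L2 f \<Longrightarrow> L2 g \<Longrightarrow> L2 h \<Longrightarrow> ip (\<lambda>x. f x - g x) h = ip f h - ip g h"
  by (simp add: ip_def inner_diff_left L2_inner_integrable)

lemma ip_add_right: "L2 f \<Longrightarrow> L2 g \<Longrightarrow> L2 h \<Longrightarrow> ip h (\<lambda>x. f x + g x) = ip h f + ip h g"
  by (simp add: ip_def inner_add_right L2_inner_integrable)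

lemma ip_diff_right: "L2 f \<Longrightarrow> L2 g \<Longrightarrow> L2 h \<Longrightarrow> ip h (\<lambda>x. f x - g x) = ip h f - ip h g"
  by (simp add: ip_def inner_diff_right L2_inner_integrable)

lemma ip_scaleR_left: "ip (\<lambda>x. c *\<^sub>R f x) h = c * ip f h"
  by (simp add: ip_def)

lemma ip_scaleR_right: "ip h (\<lambda>x. c *\<^sub>R f x) = c * ip h f"
  by (simp add: ip_def)

lemma sqn_eq_ip: "sqn f = ip f f"
  by (simp add: sqn_def ip_def power2_norm_eq_inner)

lemma sqn_nonneg: "sqn f \<ge> 0"
  by (simp add: sqn_def)

lemma sqn_scaleR: "sqn (\<lambda>x. c *\<^sub>R f x) = c\<^sup>2 * sqn f"
  by (simp add: sqn_eq_ip ip_scaleR_left ip_scaleR_right power2_eq_square)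

lemma sqn_add: "L2 f \<Longrightarrow> L2 g \<Longrightarrow> sqn (\<lambda>x. f x + g x) = sqn f + 2 * ip f g + sqn g"
  by (simp add: sqn_eq_ip ip_add_left ip_add_right L2_add ip_commute[of g f])

lemma sqn_diff: "L2 f \<Longrightarrow> L2 g \<Longrightarrow> sqn (\<lambda>x. f x - g x) = sqn f - 2 * ip f g + sqn g"
  by (simp add: sqn_eq_ip ip_diff_left ip_diff_right L2_diff ip_commute[of g f])

lemma sqn_shift: "L2 f \<Longrightarrow> sqn (\<lambda>x. f (x + t)) = sqn f"
  unfolding sqn_def by (rule lborel_shift(1)[of "\<lambda>x. (norm (f x))\<^sup>2" t]) (auto dest: L2_measurable)

lemma sqn_cong_AE:
  "f \<in> borel_measurable borel \<Longrightarrow> g \<in> borel_measurable borel \<Longrightarrow> AE x in lborel. f x = g x \<Longrightarrow> sqn f = sqn g"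
  unfolding sqn_def by (rule integral_cong_AE) (auto elim: eventually_mono)

lemma ip_cong_AE:
  assumes [measurable]: "f \<in> borel_measurable borel" "g \<in> borel_measurable borel"
      "f' \<in> borel_measurable borel" "g' \<in> borel_measurable borel"
    and "AE x in lborel. f x = f' x" "AE x in lborel. g x = g' x"
  shows "ip f g = ip f' g'"
  unfolding ip_def
proof (rule integral_cong_AE)
  show "AE x in lborel. f x \<bullet> g x = f' x \<bullet> g' x" using assms(5,6) by eventually_elim simp
qed auto

lemma ip_Cauchy_Schwarz:
  assumes "L2 f" "L2 g" shows "(ip f g)\<^sup>2 \<le> sqn f * sqn g"
proof -
  have t: "0 \<le> sqn f - 2 * t * ip f g + t\<^sup>2 * sqn g" for t
    using sqn_nonneg[of "\<lambda>x. f x - t *\<^sub>R g x"]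
    by (simp add: sqn_diff assms L2_scaleR ip_scaleR_right sqn_scaleR)
  show ?thesis
  proof (cases "sqn g = 0")
    case True
    have "ip f g = 0"
    proof (rule ccontr)
      assume "ip f g \<noteq> 0"
      \<comment> \<open>With \<open>sqn g = 0\<close> the right side of \<open>t\<close> is affine
        in the parameter, and this value makes it \<open>-1\<close>.\<close>
      with t[of "(sqn f + 1) / (2 * ip f g)"] True sqn_nonneg[of f] show False by simp
    qed
    then show ?thesis by (simp add: True)
  next
    case False
    then have "sqn g > 0" using sqn_nonneg[of g] by simp
    with t[of "ip f g / sqn g"] show ?thesis by (simp add: field_simps power2_eq_square)
  qed
qed

lemma ip_abs_le: "L2 f \<Longrightarrow> L2 g \<Longrightarrow> \<bar>ip f g\<bar> \<le> sqrt (sqn f) * sqrt (sqn g)"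
  using real_sqrt_le_mono[OF ip_Cauchy_Schwarz] by (simp add: real_sqrt_mult)

lemma sqn_add_le:
  assumes "L2 f" "L2 g" shows "sqn (\<lambda>x. f x + g x) \<le> 2 * sqn f + 2 * sqn g"
  using sqn_nonneg[of "\<lambda>x. f x - g x"] by (simp add: sqn_add sqn_diff assms)

lemma sqn_diff_le:
  assumes "L2 f" "L2 g" shows "sqn (\<lambda>x. f x - g x) \<le> 2 * sqn f + 2 * sqn g"
  using sqn_nonneg[of "\<lambda>x. f x + g x"] by (simp add: sqn_add sqn_diff assms)

lemma ip_null_tendsto:
  assumes f: "\<And>n. L2 (f n)" and g: "L2 g" and lim: "(\<lambda>n. sqn (f n)) \<longlonglongrightarrow> 0"
  shows "(\<lambda>n. ip (f n) g) \<longlonglongrightarrow> 0"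
proof (rule Lim_null_comparison)
  show "\<forall>\<^sub>F n in sequentially. norm (ip (f n) g) \<le> sqrt (sqn (f n)) * sqrt (sqn g)"
    using ip_abs_le[OF f g] by simp
  show "(\<lambda>n. sqrt (sqn (f n)) * sqrt (sqn g)) \<longlonglongrightarrow> 0"
    using tendsto_mult[OF tendsto_real_sqrt[OF lim] tendsto_const] by simp
qed

lemma ip_tendsto:
  assumes f: "\<And>n. L2 (f n)" "L2 F" "(\<lambda>n. sqn (\<lambda>x. f n x - F x)) \<longlonglongrightarrow> 0"
    and g: "\<And>n. L2 (g n)" "L2 G" "(\<lambda>n. sqn (\<lambda>x. g n x - G x)) \<longlonglongrightarrow> 0"
  shows "(\<lambda>n. ip (f n) (g n)) \<longlonglongrightarrow> ip F G"
proof -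
  let ?d = "\<lambda>n x. f n x - F x" and ?e = "\<lambda>n x. g n x - G x"
  have L: "L2 (?d n)" "L2 (?e n)" for n using f g by (auto intro: L2_diff)
  have "(\<lambda>n. ip (?d n) (?e n)) \<longlonglongrightarrow> 0"
  proof (rule Lim_null_comparison)
    show "\<forall>\<^sub>F n in sequentially. norm (ip (?d n) (?e n)) \<le> sqrt (sqn (?d n)) * sqrt (sqn (?e n))"
      using ip_abs_le[OF L] by simp
    show "(\<lambda>n. sqrt (sqn (?d n)) * sqrt (sqn (?e n))) \<longlonglongrightarrow> 0"
      using tendsto_mult[OF tendsto_real_sqrt[OF f(3)] tendsto_real_sqrt[OF g(3)]] by simp
  qed
  from tendsto_add[OF tendsto_add[OF this ip_null_tendsto[OF L(1) g(2) f(3)]]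
      tendsto_add[OF ip_null_tendsto[OF L(2) f(2) g(3)] tendsto_const[of "ip F G"]]]
  have "(\<lambda>n. ip (?d n) (?e n) + ip (?d n) G + (ip (?e n) F + ip F G)) \<longlonglongrightarrow> ip F G" by simp
  then show ?thesis
    by (simp add: ip_diff_left ip_diff_right L f g L2_diff ip_commute[of _ F])
qed

lemma sqn_tendsto:
  assumes "\<And>n. L2 (f n)" "L2 F" "(\<lambda>n. sqn (\<lambda>x. f n x - F x)) \<longlonglongrightarrow> 0"
  shows "(\<lambda>n. sqn (f n)) \<longlonglongrightarrow> sqn F"
  unfolding sqn_eq_ip by (intro ip_tendsto assms)

lemma sqn_eq_0:
  assumes "L2 f" "sqn f = 0" shows "AE x in lborel. f x = 0"
  using assms(2) integral_nonneg_eq_0_iff_AE[OF L2_integrable[OF assms(1)]] by (simp add: sqn_def)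

lemma nn_integral_sqn:
  assumes "L2 f" shows "(\<integral>\<^sup>+x. ennreal ((norm (f x))\<^sup>2) \<partial>lborel) = ennreal (sqn f)"
  unfolding sqn_def by (rule nn_integral_eq_integral) (auto intro: L2_integrable assms)

lemma L2_if_nn_finite:
  assumes [measurable]: "f \<in> borel_measurable borel"
    and "(\<integral>\<^sup>+x. ennreal ((norm (f x))\<^sup>2) \<partial>lborel) < \<infinity>"
  shows "L2 f"
  unfolding L2_def using assms(2) by (auto intro!: integrableI_nonneg)

lemma L2_continuous_compact:
  fixes f :: "'a::euclidean_space \<Rightarrow> 'b::euclidean_space"
  assumes "continuous_on UNIV f" "compact K" "\<And>x. x \<notin> K \<Longrightarrow> f x = 0"
  shows "L2 f"
proof -
  have "integrable lborel (\<lambda>x. indicator K x *\<^sub>R (norm (f x))\<^sup>2)"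
    using assms by (intro borel_integrable_compact continuous_intros) (auto intro: continuous_on_subset)
  moreover have "(\<lambda>x. indicator K x *\<^sub>R (norm (f x))\<^sup>2) = (\<lambda>x. (norm (f x))\<^sup>2)"
    using assms(3) by (auto simp: fun_eq_iff indicator_def)
  ultimately show ?thesis using assms(1) by (auto simp: L2_def borel_measurable_continuous_onI)
qed

subsection \<open>Test functions\<close>

lemma frechet_derivative_zero_off_support:
  assumes "x \<notin> closure {x. f x \<noteq> 0}"
  shows "frechet_derivative f (at x) = (\<lambda>h. 0)"
proof -
  have "((\<lambda>x. 0) has_derivative (\<lambda>h. 0)) (at x)" by simp
  then have "(f has_derivative (\<lambda>h. 0)) (at x)"
    by (rule has_derivative_transform_within_open[where s="- closure {x. f x \<noteq> 0}"])
      (use assms closure_subset[of "{x. f x \<noteq> 0}"] in auto)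
  then show ?thesis by (metis frechet_derivative_at)
qed

lemma grad_zero_off_support: "x \<notin> closure {x. f x \<noteq> 0} \<Longrightarrow> grad f x = 0"
  by (simp add: grad_def frechet_derivative_zero_off_support)

lemma grad_inner_Basis: "b \<in> Basis \<Longrightarrow> grad f x \<bullet> b = frechet_derivative f (at x) b"
  by (simp add: grad_def inner_sum_left inner_Basis if_distrib cong: if_cong)

lemma frechet_derivative_eq_grad:
  assumes "f differentiable (at x)"
  shows "frechet_derivative f (at x) v = grad f x \<bullet> v"
proof -
  have lin: "linear (frechet_derivative f (at x))"
    using assms by (simp add: linear_frechet_derivative)
  have "frechet_derivative f (at x) v = frechet_derivative f (at x) (\<Sum>b\<in>Basis. (v \<bullet> b) *\<^sub>R b)"
    by (simp add: euclidean_representation)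
  also have "\<dots> = (\<Sum>b\<in>Basis. (v \<bullet> b) * frechet_derivative f (at x) b)"
    by (simp add: linear_sum[OF lin] linear_scale[OF lin])
  also have "\<dots> = grad f x \<bullet> v"
    by (subst euclidean_inner) (simp add: grad_inner_Basis mult.commute)
  finally show ?thesis .
qed

lemma grad_eqI:
  assumes "(f has_derivative (\<lambda>h. v \<bullet> h)) (at x)" shows "grad f x = v"
proof -
  have "frechet_derivative f (at x) = (\<lambda>h. v \<bullet> h)" using assms by (metis frechet_derivative_at)
  then show ?thesis by (simp add: grad_def euclidean_representation)
qed

lemma has_derivative_grad:
  "smooth f \<Longrightarrow> (f has_derivative (\<lambda>h. grad f x \<bullet> h)) (at x)"
  by (rule has_derivative_eq_rhs[OF smooth_has_derivative])
    (auto simp: fun_eq_iff frechet_derivative_eq_grad smooth_differentiable)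

lemma grad_add: "smooth f \<Longrightarrow> smooth g \<Longrightarrow> grad (\<lambda>x. f x + g x) x = grad f x + grad g x"
  by (rule grad_eqI) (auto simp: inner_add_left intro!: has_derivative_add has_derivative_grad)

lemma grad_cmult: "smooth f \<Longrightarrow> grad (\<lambda>x. c * f x) x = c *\<^sub>R grad f x"
  by (rule grad_eqI) (auto intro!: has_derivative_mult_right has_derivative_grad)

lemma grad_diff: "smooth f \<Longrightarrow> smooth g \<Longrightarrow> grad (\<lambda>x. f x - g x) x = grad f x - grad g x"
  by (rule grad_eqI) (auto simp: inner_diff_left intro!: has_derivative_diff has_derivative_grad)

lemma grad_compose:
  "smooth T \<Longrightarrow> smooth f \<Longrightarrow> grad (\<lambda>x. T (f x)) x = pdiff 1 T (f x) *\<^sub>R grad f x"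
  using comp_has_derivative[of T f x]
  by (intro grad_eqI) (simp add: frechet_derivative_eq_grad smooth_differentiable)

lemma continuous_on_grad: "smooth f \<Longrightarrow> continuous_on S (grad f)"
  unfolding grad_def[abs_def]
  by (intro continuous_intros smooth_continuous_on smooth_pdiff)

text \<open>Applied at the zeros of non-negative test functions: it makes gradients orthogonal at
  every point, also where two supports touch.\<close>

lemma grad_zero_at_min:
  assumes "smooth f" "\<And>y. f x \<le> f y" shows "grad f x = 0"
proof -
  have "(\<lambda>h. grad f x \<bullet> h) = (\<lambda>h. 0)"
    by (rule has_derivative_local_min[OF has_derivative_grad[OF assms(1)]]) (use assms(2) in auto)
  then have "grad f x \<bullet> grad f x = 0" by metis
  then show ?thesis by simp
qed

lemma grad_zero_at_max:
  assumes "smooth f" "\<And>y. f y \<le> f x" shows "grad f x = 0"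
proof -
  have "grad (\<lambda>x. (-1) * f x) x = 0"
    by (rule grad_zero_at_min) (use assms in \<open>simp_all add: smooth_mult[OF smooth_const, of f "-1", simplified]\<close>)
  then show ?thesis unfolding grad_cmult[OF assms(1)] by simp
qed

lemma test_fnI:
  assumes "smooth f" "compact K" "K \<subseteq> \<Omega>" "\<And>x. x \<notin> K \<Longrightarrow> f x = 0"
  shows "test_fn \<Omega> f"
proof -
  have "closure {x. f x \<noteq> 0} \<subseteq> K"
    using assms by (intro closure_minimal) (auto simp: compact_imp_closed)
  then show ?thesis using assms(1-3) unfolding test_fn_def
    by (meson closed_closure compact_closure bounded_subset compact_imp_bounded compact_eq_bounded_closed order_trans)
qed

lemma test_fnE:
  assumes "test_fn \<Omega> f"
  obtains K where "compact K" "K \<subseteq> \<Omega>" "\<And>x. x \<notin> K \<Longrightarrow> f x = 0" "\<And>x. x \<notin> K \<Longrightarrow> grad f x = 0"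
    "\<And>x b. x \<notin> K \<Longrightarrow> frechet_derivative f (at x) b = 0"
proof
  show "compact (closure {x. f x \<noteq> 0})" "closure {x. f x \<noteq> 0} \<subseteq> \<Omega>"
    using assms by (auto simp: test_fn_def)
  show "f x = 0" if "x \<notin> closure {x. f x \<noteq> 0}" for x
    using that closure_subset[of "{x. f x \<noteq> 0}"] by auto
qed (auto simp: grad_zero_off_support frechet_derivative_zero_off_support)

lemma test_fn_smooth: "test_fn \<Omega> f \<Longrightarrow> smooth f"
  by (simp add: test_fn_def)

lemma test_fn_zero_outside: "test_fn \<Omega> f \<Longrightarrow> x \<notin> \<Omega> \<Longrightarrow> f x = 0 \<and> grad f x = 0"
  by (metis test_fnE subsetD)

lemma test_fn_mult:
  assumes "test_fn \<Omega> f" "smooth g" shows "test_fn \<Omega> (\<lambda>x. g x * f x)"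
proof -
  obtain K where "compact K" "K \<subseteq> \<Omega>" "\<And>x. x \<notin> K \<Longrightarrow> f x = 0" using assms test_fnE by metis
  then show ?thesis using assms by (intro test_fnI[of _ K]) (auto dest: test_fn_smooth)
qed

lemma test_fn_cmult: "test_fn \<Omega> f \<Longrightarrow> test_fn \<Omega> (\<lambda>x. c * f x)"
  by (rule test_fn_mult) auto

lemma test_fn_add:
  assumes "test_fn \<Omega> f" "test_fn \<Omega> g" shows "test_fn \<Omega> (\<lambda>x. f x + g x)"
proof -
  obtain K where "compact K" "K \<subseteq> \<Omega>" "\<And>x. x \<notin> K \<Longrightarrow> f x = 0" using assms(1) test_fnE by metis
  moreover obtain K' where "compact K'" "K' \<subseteq> \<Omega>" "\<And>x. x \<notin> K' \<Longrightarrow> g x = 0" using assms(2) test_fnE by metis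
  ultimately show ?thesis
    using assms by (intro test_fnI[of _ "K \<union> K'"]) (auto dest: test_fn_smooth)
qed

lemma test_fn_diff: "test_fn \<Omega> f \<Longrightarrow> test_fn \<Omega> g \<Longrightarrow> test_fn \<Omega> (\<lambda>x. f x - g x)"
  using test_fn_add[of \<Omega> f "\<lambda>x. (-1) * g x"] test_fn_cmult[of \<Omega> g "-1"] by simp

lemma test_fn_zero: "test_fn \<Omega> (\<lambda>x. 0)"
  by (rule test_fnI[of _ "{}"]) auto

lemma test_fn_sum: "(\<And>i. i \<in> I \<Longrightarrow> test_fn \<Omega> (f i)) \<Longrightarrow> test_fn \<Omega> (\<lambda>x. \<Sum>i\<in>I. f i x)"
  by (induction I rule: infinite_finite_induct) (auto intro: test_fn_zero test_fn_add)

lemma test_fn_compose: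
  assumes "test_fn \<Omega> f" "smooth T" "T 0 = 0" shows "test_fn \<Omega> (\<lambda>x. T (f x))"
proof -
  obtain K where "compact K" "K \<subseteq> \<Omega>" "\<And>x. x \<notin> K \<Longrightarrow> f x = 0" using assms test_fnE by metis
  then show ?thesis using assms by (intro test_fnI[of _ K]) (auto intro: smooth_compose dest: test_fn_smooth)
qed

lemma test_fn_pdiff:
  assumes "test_fn \<Omega> f" "b \<in> Basis" shows "test_fn \<Omega> (pdiff b f)"
proof -
  obtain K where "compact K" "K \<subseteq> \<Omega>" "\<And>x. x \<notin> K \<Longrightarrow> frechet_derivative f (at x) b = 0"
    using assms test_fnE by metis
  then show ?thesis using assms by (intro test_fnI[of _ K]) (auto intro: smooth_pdiff dest: test_fn_smooth)
qed

lemma test_fn_L2: "test_fn \<Omega> f \<Longrightarrow> L2 f"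
  by (metis L2_continuous_compact test_fnE smooth_continuous_on test_fn_smooth)

lemma test_fn_L2_grad: "test_fn \<Omega> f \<Longrightarrow> L2 (grad f)"
  by (metis L2_continuous_compact test_fnE continuous_on_grad test_fn_smooth)

lemma test_fn_integrable:
  assumes "test_fn \<Omega> f" shows "integrable lborel f"
proof -
  obtain K where K: "compact K" "\<And>x. x \<notin> K \<Longrightarrow> f x = 0" using assms test_fnE by metis
  have "integrable lborel (\<lambda>x. indicator K x *\<^sub>R f x)"
    using assms K by (intro borel_integrable_compact smooth_continuous_on) (auto dest: test_fn_smooth)
  moreover have "(\<lambda>x. indicator K x *\<^sub>R f x) = f" using K(2) by (auto simp: fun_eq_iff indicator_def)
  ultimately show ?thesis by simp
qed

lemma test_fn_Lipschitz:
  assumes "test_fn \<Omega> f"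
  obtains L where "L \<ge> 0" "\<And>x y. \<bar>f x - f y\<bar> \<le> L * norm (x - y)"
proof -
  obtain K where K: "compact K" "\<And>x. x \<notin> K \<Longrightarrow> grad f x = 0" using assms test_fnE by metis
  have "compact (grad f ` K)"
    using K assms by (intro compact_continuous_image continuous_on_grad) (auto dest: test_fn_smooth)
  then obtain L where L: "\<And>x. x \<in> K \<Longrightarrow> norm (grad f x) \<le> L" "L > 0"
    by (metis bounded_pos compact_imp_bounded imageI)
  have "norm (grad f x) \<le> L" for x using L K by (cases "x \<in> K") auto
  then have on: "onorm (\<lambda>h. grad f x \<bullet> h) \<le> L" for x
    by (intro onorm_le order_trans[OF Cauchy_Schwarz_ineq2[unfolded real_norm_def[symmetric]]]
        mult_right_mono) auto
  have "\<bar>f x - f y\<bar> \<le> L * norm (x - y)" for x y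
    using differentiable_bound[OF convex_UNIV has_derivative_grad[OF test_fn_smooth[OF assms], THEN has_derivative_at_withinI] on, of x y]
    by simp
  then show thesis using that[of L] L(2) by auto
qed

text \<open>Both limits are dominated convergence: the Lipschitz bound controls the quotients, and
  since the increments are at most \<open>norm t\<close> they all vanish outside one ball. The first
  limit serves integration by parts, the second the translation estimate.\<close>

lemma difference_quotient:
  fixes t :: "'a::euclidean_space"
  assumes f: "test_fn \<Omega> f"
  defines "q \<equiv> \<lambda>n x. real (Suc n) * (f (x + (1 / real (Suc n)) *\<^sub>R t) - f x)"
  shows "(\<lambda>n. \<integral>x. q n x \<partial>lborel) \<longlonglongrightarrow> (\<integral>x. grad f x \<bullet> t \<partial>lborel)" (is ?A)
    and "(\<lambda>n. sqn (q n)) \<longlonglongrightarrow> sqn (\<lambda>x. grad f x \<bullet> t)" (is ?B)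
proof -
  obtain K where K: "compact K" "\<And>x. x \<notin> K \<Longrightarrow> f x = 0" using f test_fnE by metis
  then obtain R where R: "\<And>x. x \<in> K \<Longrightarrow> norm x \<le> R"
    by (metis bounded_iff compact_imp_bounded)
  obtain L where L: "L \<ge> 0" "\<And>x y. \<bar>f x - f y\<bar> \<le> L * norm (x - y)" using f test_fn_Lipschitz by metis
  define C where "C = cball (0::'a) (R + norm t)"
  have [measurable]: "f \<in> borel_measurable borel" using f by (simp add: test_fn_smooth smooth_borel)
  have [measurable]: "grad f \<in> borel_measurable borel"
    using f by (simp add: test_fn_smooth continuous_on_grad borel_measurable_continuous_onI)
  have [measurable]: "q n \<in> borel_measurable borel" for n unfolding q_def by measurable
  have [measurable]: "C \<in> sets borel" unfolding C_def by simp
  have bound: "\<bar>q n x\<bar> \<le> (L * norm t) * indicator C x" for n x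
  proof (cases "x \<in> C")
    case True
    have "\<bar>q n x\<bar> = real (Suc n) * \<bar>f (x + (1 / real (Suc n)) *\<^sub>R t) - f x\<bar>"
      by (simp only: q_def abs_mult abs_of_nat)
    also have "\<dots> \<le> real (Suc n) * (L * norm ((1 / real (Suc n)) *\<^sub>R t))"
      using L(2)[of "x + (1 / real (Suc n)) *\<^sub>R t" x] by (intro mult_left_mono) auto
    also have "\<dots> = L * norm t" by (simp add: field_simps)
    finally show ?thesis using True by simp
  next
    case False
    then have x: "norm x > R + norm t" by (simp add: C_def)
    have "norm ((1 / real (Suc n)) *\<^sub>R t) \<le> norm t"
      by (simp add: field_simps mult_left_le_one_le)
    then have "norm (x + (1 / real (Suc n)) *\<^sub>R t) > R"
      using x norm_diff_ineq[of x "(1 / real (Suc n)) *\<^sub>R t"] by linarith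
    moreover have "norm x > R" using x norm_ge_zero[of t] by linarith
    ultimately have "x + (1 / real (Suc n)) *\<^sub>R t \<notin> K" "x \<notin> K" using R leD by blast+
    then have "q n x = 0" unfolding q_def using K(2) by simp
    then show ?thesis using False by simp
  qed
  have lim: "(\<lambda>n. q n x) \<longlonglongrightarrow> grad f x \<bullet> t" for x
  proof -
    have "((\<lambda>s. x + s *\<^sub>R t) has_derivative (\<lambda>s. s *\<^sub>R t)) (at 0)"
      by (auto intro!: derivative_eq_intros)
    from has_derivative_compose[OF this, of f "\<lambda>h. grad f x \<bullet> h"]
    have "((\<lambda>s. f (x + s *\<^sub>R t)) has_derivative (\<lambda>s. s * (grad f x \<bullet> t))) (at 0)"
      using has_derivative_grad[OF test_fn_smooth[OF f], of x] by simp
    then have "((\<lambda>s. f (x + s *\<^sub>R t)) has_real_derivative grad f x \<bullet> t) (at 0)"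
      by (rule has_derivative_imp_has_field_derivative) simp
    then have "((\<lambda>h. (f (x + h *\<^sub>R t) - f x) / h) \<longlongrightarrow> grad f x \<bullet> t) (at 0)"
      by (simp add: DERIV_def)
    moreover have "filterlim (\<lambda>n. 1 / real (Suc n)) (at 0) sequentially"
      unfolding filterlim_at
      using LIMSEQ_inverse_real_of_nat by (auto simp: inverse_eq_divide)
    ultimately have "(\<lambda>n. (f (x + (1 / real (Suc n)) *\<^sub>R t) - f x) / (1 / real (Suc n))) \<longlonglongrightarrow> grad f x \<bullet> t"
      by (rule filterlim_compose)
    then show ?thesis by (simp add: q_def mult.commute)
  qed
  have intC: "integrable lborel (\<lambda>x. c * indicator C x :: real)" for c
    unfolding C_def using emeasure_bounded_finite[OF bounded_cball, of "0::'a" "R + norm t"]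
    by (intro integrable_mult_right integrable_real_indicator) auto
  show ?A
    by (rule integral_dominated_convergence[where w="\<lambda>x. (L * norm t) * indicator C x"])
      (use bound lim intC in auto)
  have bound2: "(q n x)\<^sup>2 \<le> (L * norm t)\<^sup>2 * indicator C x" for n x
    using power_mono[OF bound[of n x] abs_ge_zero, of 2] by (auto simp: indicator_def split: if_splits)
  show ?B unfolding sqn_def
    by (rule integral_dominated_convergence[where w="\<lambda>x. (L * norm t)\<^sup>2 * indicator C x"])
      (use bound2 intC in \<open>auto intro!: tendsto_intros lim\<close>)
qed

text \<open>Lebesgue measure is translation invariant, so every difference quotient has integral
  zero.\<close>

lemma integral_pdiff:
  assumes f: "test_fn \<Omega> f" and b: "b \<in> Basis"
  shows "(\<integral>x. pdiff b f x \<partial>lborel) = 0"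
proof -
  have [measurable]: "f \<in> borel_measurable borel" using f by (simp add: test_fn_smooth smooth_borel)
  have "(\<integral>x. f (x + s) - f x \<partial>lborel) = 0" for s
    using lborel_shift[of f s] test_fn_integrable[OF f] by simp
  then have "(\<lambda>n. 0) \<longlonglongrightarrow> (\<integral>x. grad f x \<bullet> b \<partial>lborel)"
    using difference_quotient(1)[OF f, of b] by simp
  then have "(\<integral>x. grad f x \<bullet> b \<partial>lborel) = 0" using LIMSEQ_unique tendsto_const by blast
  then show ?thesis by (simp add: grad_inner_Basis b)
qed

text \<open>Split \<open>t\<close> into \<open>n + 1\<close> equal steps. Cauchy-Schwarz for the
  telescoping sum costs a factor \<open>n + 1\<close>, and translation invariance makes all summands
  equal, so the left side is at most the squared norm of the difference quotient; then
  \<open>n\<close> tends to infinity.\<close>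

lemma translation_estimate_test:
  assumes f: "test_fn \<Omega> f"
  shows "sqn (\<lambda>x. f (x + t) - f x) \<le> (norm t)\<^sup>2 * sqn (grad f)"
proof -
  note L = test_fn_L2[OF f]
  have le: "sqn (\<lambda>x. f (x + t) - f x) \<le> sqn (\<lambda>x. real (Suc n) * (f (x + (1 / real (Suc n)) *\<^sub>R t) - f x))" for n
  proof -
    let ?N = "Suc n"
    let ?s = "(1 / real ?N) *\<^sub>R t"
    let ?d = "\<lambda>x. f (x + ?s) - f x"
    have Ld: "L2 ?d" using L by (intro L2_diff L2_shift)
    have tel: "f (x + t) - f x = (\<Sum>i<?N. ?d (x + real i *\<^sub>R ?s))" for x
    proof -
      have "(\<Sum>i<m. ?d (x + real i *\<^sub>R ?s)) = f (x + real m *\<^sub>R ?s) - f x" for m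
        by (induction m) (auto simp: algebra_simps add_divide_distrib)
      from this[of ?N] show ?thesis by simp
    qed
    have "(f (x + t) - f x)\<^sup>2 \<le> real ?N * (\<Sum>i<?N. (?d (x + real i *\<^sub>R ?s))\<^sup>2)" for x
      unfolding tel using sum_squared_le_sum_of_squares[of "\<lambda>i. ?d (x + real i *\<^sub>R ?s)" "{..<?N}"] by (simp add: mult.commute)
    then have "sqn (\<lambda>x. f (x + t) - f x) \<le> (\<integral>x. real ?N * (\<Sum>i<?N. (norm (?d (x + real i *\<^sub>R ?s)))\<^sup>2) \<partial>lborel)"
      unfolding sqn_def using L2_integrable[OF L2_diff[OF L2_shift[OF L] L]]
        L2_integrable[OF L2_shift[OF Ld]]
      by (intro integral_mono integrable_mult_right Bochner_Integration.integrable_sum) auto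
    also have "\<dots> = real ?N * (\<Sum>i<?N. sqn (\<lambda>x. ?d (x + real i *\<^sub>R ?s)))"
      unfolding sqn_def using L2_integrable[OF L2_shift[OF Ld]] by (simp del: sum.lessThan_Suc)
    also have "\<dots> = real ?N * (real ?N * sqn ?d)"
      using sqn_shift[OF Ld] by simp
    also have "\<dots> = sqn (\<lambda>x. real ?N *\<^sub>R ?d x)"
      by (simp only: sqn_scaleR power2_eq_square mult.assoc)
    finally show ?thesis by simp
  qed
  have "sqn (\<lambda>x. f (x + t) - f x) \<le> sqn (\<lambda>x. grad f x \<bullet> t)"
    by (rule LIMSEQ_le_const[OF difference_quotient(2)[OF f]]) (use le in auto)
  also have "\<dots> \<le> (\<integral>x. (norm t)\<^sup>2 * (norm (grad f x))\<^sup>2 \<partial>lborel)"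
    unfolding sqn_def
  proof (rule integral_mono)
    note Lg = test_fn_L2_grad[OF f]
    show "integrable lborel (\<lambda>x. (norm t)\<^sup>2 * (norm (grad f x))\<^sup>2)"
      using Lg by (intro integrable_mult_right L2_integrable)
    show le: "(norm (grad f x \<bullet> t))\<^sup>2 \<le> (norm t)\<^sup>2 * (norm (grad f x))\<^sup>2" for x
      using power_mono[OF Cauchy_Schwarz_ineq2[of "grad f x" t] abs_ge_zero, of 2]
      by (simp add: power_mult_distrib mult.commute)
    show "integrable lborel (\<lambda>x. (norm (grad f x \<bullet> t))\<^sup>2)"
      by (rule Bochner_Integration.integrable_bound[OF \<open>integrable lborel (\<lambda>x. (norm t)\<^sup>2 * (norm (grad f x))\<^sup>2)\<close>])
        (use Lg le in \<open>auto dest!: L2_measurable\<close>)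
  qed
  also have "\<dots> = (norm t)\<^sup>2 * sqn (grad f)" by (simp add: sqn_def)
  finally show ?thesis .
qed

text \<open>\<open>h\<close> is minus the Laplacian of \<open>g\<close>. It does not depend on
  \<open>f\<close>, so the right side passes to limits under mere \<open>L2\<close> convergence of
  \<open>f\<close>.\<close>

lemma Green_test:
  assumes g: "test_fn \<Omega> g"
  obtains h where "test_fn \<Omega> h" "\<And>f. test_fn \<Omega> f \<Longrightarrow> ip (grad f) (grad g) = ip f h"
proof
  let ?h = "\<lambda>x. (-1) * (\<Sum>b\<in>Basis. pdiff b (pdiff b g) x)"
  show "test_fn \<Omega> ?h"
    by (intro test_fn_cmult test_fn_sum test_fn_pdiff g)
  fix f assume f: "test_fn \<Omega> f"
  have eq: "(\<integral>x. pdiff b f x * pdiff b g x \<partial>lborel) = - (\<integral>x. f x * pdiff b (pdiff b g) x \<partial>lborel)"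
    if b: "b \<in> Basis" for b
  proof -
    have t: "test_fn \<Omega> (\<lambda>x. f x * pdiff b g x)"
      using test_fn_mult[OF test_fn_pdiff[OF g b] test_fn_smooth[OF f]] .
    have "pdiff b (\<lambda>x. f x * pdiff b g x) = (\<lambda>x. f x * pdiff b (pdiff b g) x + pdiff b f x * pdiff b g x)"
      by (rule pdiff_eqI)
        (intro has_derivative_mult smooth_has_derivative smooth_pdiff test_fn_smooth[OF f] test_fn_smooth[OF g] b)
    moreover have "integrable lborel (\<lambda>x. f x * pdiff b (pdiff b g) x)"
      "integrable lborel (\<lambda>x. pdiff b f x * pdiff b g x)"
      using L2_inner_integrable[OF test_fn_L2[OF f] test_fn_L2[OF test_fn_pdiff[OF test_fn_pdiff[OF g b] b]]]
        L2_inner_integrable[OF test_fn_L2[OF test_fn_pdiff[OF f b]] test_fn_L2[OF test_fn_pdiff[OF g b]]] by auto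
    ultimately show ?thesis using integral_pdiff[OF t b] by simp
  qed
  have "ip (grad f) (grad g) = (\<integral>x. (\<Sum>b\<in>Basis. pdiff b f x * pdiff b g x) \<partial>lborel)"
    unfolding ip_def by (subst euclidean_inner) (simp add: grad_inner_Basis)
  also have "\<dots> = (\<Sum>b\<in>Basis. \<integral>x. pdiff b f x * pdiff b g x \<partial>lborel)"
    using L2_inner_integrable[OF test_fn_L2[OF test_fn_pdiff[OF f]] test_fn_L2[OF test_fn_pdiff[OF g]]]
    by (intro Bochner_Integration.integral_sum) auto
  also have "\<dots> = (\<Sum>b\<in>Basis. - (\<integral>x. f x * pdiff b (pdiff b g) x \<partial>lborel))"
    using eq by simp
  also have "\<dots> = - (\<integral>x. (\<Sum>b\<in>Basis. f x * pdiff b (pdiff b g) x) \<partial>lborel)"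
    using L2_inner_integrable[OF test_fn_L2[OF f] test_fn_L2[OF test_fn_pdiff[OF test_fn_pdiff[OF g]]]]
    by (subst Bochner_Integration.integral_sum) (auto simp: sum_negf)
  also have "\<dots> = ip f ?h"
    unfolding ip_def by (simp add: sum_distrib_left sum_negf)
  finally show "ip (grad f) (grad g) = ip f ?h" .
qed

subsection \<open>The space \<open>H10\<close>\<close>

text \<open>Extension by zero turns integrals over the domain into integrals over the whole space,
  where translations act. Test functions and their gradients are unchanged by it.\<close>

definition ext0 :: "'a set \<Rightarrow> ('a \<Rightarrow> 'b::real_vector) \<Rightarrow> 'a \<Rightarrow> 'b" where
  "ext0 \<Omega> f x = (if x \<in> \<Omega> then f x else 0)"

lemma ext0_measurable:
  fixes f :: "'a::euclidean_space \<Rightarrow> 'b::euclidean_space"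
  assumes "open \<Omega>" "f \<in> borel_measurable borel"
  shows "ext0 \<Omega> f \<in> borel_measurable borel"
proof -
  have [measurable]: "\<Omega> \<in> sets borel" using assms(1) by simp
  note [measurable] = assms(2)
  show ?thesis unfolding ext0_def[abs_def] by measurable
qed

lemma nn_integral_ext0_diff:
  fixes \<psi> w :: "'a::euclidean_space \<Rightarrow> 'b::euclidean_space"
  assumes "\<And>x. x \<notin> \<Omega> \<Longrightarrow> \<psi> x = 0"
  shows "(\<integral>\<^sup>+x\<in>\<Omega>. ennreal ((norm (\<psi> x - w x))\<^sup>2) \<partial>lborel) =
    (\<integral>\<^sup>+x. ennreal ((norm (\<psi> x - ext0 \<Omega> w x))\<^sup>2) \<partial>lborel)"
  by (intro nn_integral_cong) (auto simp: ext0_def assms)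

text \<open>Translates the integrals in the definition of \<open>H10_pair\<close> into
  \<open>sqn\<close>. The limit is square integrable because some member of the sequence is at
  finite distance from it.\<close>

lemma ext0_limit_iff:
  fixes \<psi> :: "nat \<Rightarrow> 'a::euclidean_space \<Rightarrow> 'b::euclidean_space"
  assumes "open \<Omega>" and \<psi>: "\<And>n. L2 (\<psi> n)" and z: "\<And>n x. x \<notin> \<Omega> \<Longrightarrow> \<psi> n x = 0"
    and w: "w \<in> borel_measurable borel"
  shows "(\<lambda>n. \<integral>\<^sup>+x\<in>\<Omega>. ennreal ((norm (\<psi> n x - w x))\<^sup>2) \<partial>lborel) \<longlonglongrightarrow> 0 \<longleftrightarrow>
    L2 (ext0 \<Omega> w) \<and> (\<lambda>n. sqn (\<lambda>x. \<psi> n x - ext0 \<Omega> w x)) \<longlonglongrightarrow> 0" (is "?l \<longleftrightarrow> _ \<and> ?r")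
proof -
  have [measurable]: "ext0 \<Omega> w \<in> borel_measurable borel" "\<And>n. \<psi> n \<in> borel_measurable borel"
    using ext0_measurable[OF assms(1) w] L2_measurable[OF \<psi>] by auto
  have iff: "?l \<longleftrightarrow> ?r" if "L2 (ext0 \<Omega> w)"
  proof -
    have "(\<integral>\<^sup>+x\<in>\<Omega>. ennreal ((norm (\<psi> n x - w x))\<^sup>2) \<partial>lborel) =
        ennreal (sqn (\<lambda>x. \<psi> n x - ext0 \<Omega> w x))" for n
      using nn_integral_ext0_diff[where \<Omega>=\<Omega> and \<psi>="\<psi> n" and w=w, OF z]
        nn_integral_sqn[OF L2_diff[OF \<psi> that]] by simp
    then show ?thesis
      using tendsto_ennreal_iff[of "\<lambda>n. sqn (\<lambda>x. \<psi> n x - ext0 \<Omega> w x)" sequentially 0]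
      by (simp add: sqn_nonneg)
  qed
  moreover have "L2 (ext0 \<Omega> w)" if l: ?l
  proof -
    have "eventually (\<lambda>n. (\<integral>\<^sup>+x\<in>\<Omega>. ennreal ((norm (\<psi> n x - w x))\<^sup>2) \<partial>lborel) < 1) sequentially"
      using order_tendstoD(2)[OF l, of 1] by simp
    then obtain n where "(\<integral>\<^sup>+x\<in>\<Omega>. ennreal ((norm (\<psi> n x - w x))\<^sup>2) \<partial>lborel) < 1"
      by (auto simp: eventually_sequentially)
    then have "(\<integral>\<^sup>+x. ennreal ((norm (\<psi> n x - ext0 \<Omega> w x))\<^sup>2) \<partial>lborel) < 1"
      using nn_integral_ext0_diff[where \<Omega>=\<Omega> and \<psi>="\<psi> n" and w=w, OF z] by simp
    then have "(\<integral>\<^sup>+x. ennreal ((norm (\<psi> n x - ext0 \<Omega> w x))\<^sup>2) \<partial>lborel) < \<infinity>"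
      using order.strict_trans ennreal_one_less_top by force
    then have "L2 (\<lambda>x. \<psi> n x - ext0 \<Omega> w x)"
      by (intro L2_if_nn_finite) auto
    from L2_diff[OF \<psi> this, of n] show ?thesis by simp
  qed
  ultimately show ?thesis by blast
qed

locale bounded_domain =
  fixes \<Omega> :: "'a::euclidean_space set"
  assumes open_dom: "open \<Omega>" and bounded_dom: "bounded \<Omega>"
begin

lemma H10_pair_iff:
  "H10_pair \<Omega> u g \<longleftrightarrow> u \<in> borel_measurable borel \<and> g \<in> borel_measurable borel \<and>
     L2 (ext0 \<Omega> u) \<and> L2 (ext0 \<Omega> g) \<and> (\<exists>\<phi>. (\<forall>n. test_fn \<Omega> (\<phi> n)) \<and>
        (\<lambda>n. sqn (\<lambda>x. \<phi> n x - ext0 \<Omega> u x)) \<longlonglongrightarrow> 0 \<and>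
        (\<lambda>n. sqn (\<lambda>x. grad (\<phi> n) x - ext0 \<Omega> g x)) \<longlonglongrightarrow> 0)"
proof -
  have "((\<lambda>n. \<integral>\<^sup>+x\<in>\<Omega>. ennreal ((\<phi> n x - u x)\<^sup>2) \<partial>lborel) \<longlonglongrightarrow> 0 \<and>
        (\<lambda>n. \<integral>\<^sup>+x\<in>\<Omega>. ennreal ((norm (grad (\<phi> n) x - g x))\<^sup>2) \<partial>lborel) \<longlonglongrightarrow> 0) \<longleftrightarrow>
      (L2 (ext0 \<Omega> u) \<and> (\<lambda>n. sqn (\<lambda>x. \<phi> n x - ext0 \<Omega> u x)) \<longlonglongrightarrow> 0) \<and>
      (L2 (ext0 \<Omega> g) \<and> (\<lambda>n. sqn (\<lambda>x. grad (\<phi> n) x - ext0 \<Omega> g x)) \<longlonglongrightarrow> 0)"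
    if "u \<in> borel_measurable borel" "g \<in> borel_measurable borel" "\<And>n. test_fn \<Omega> (\<phi> n)" for \<phi>
    using ext0_limit_iff[OF open_dom test_fn_L2[OF that(3)] _ that(1)]
      ext0_limit_iff[OF open_dom test_fn_L2_grad[OF that(3)] _ that(2)] test_fn_zero_outside[OF that(3)]
    by simp
  then show ?thesis unfolding H10_pair_def by blast
qed

lemma H10_pair_lincomb:
  assumes "H10_pair \<Omega> u g" "H10_pair \<Omega> v h"
  shows "H10_pair \<Omega> (\<lambda>x. c * u x + d * v x) (\<lambda>x. c *\<^sub>R g x + d *\<^sub>R h x)"
proof -
  obtain \<phi> \<psi> where u: "\<And>n. test_fn \<Omega> (\<phi> n)" "(\<lambda>n. sqn (\<lambda>x. \<phi> n x - ext0 \<Omega> u x)) \<longlonglongrightarrow> 0"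
      "(\<lambda>n. sqn (\<lambda>x. grad (\<phi> n) x - ext0 \<Omega> g x)) \<longlonglongrightarrow> 0"
    and v: "\<And>n. test_fn \<Omega> (\<psi> n)" "(\<lambda>n. sqn (\<lambda>x. \<psi> n x - ext0 \<Omega> v x)) \<longlonglongrightarrow> 0"
      "(\<lambda>n. sqn (\<lambda>x. grad (\<psi> n) x - ext0 \<Omega> h x)) \<longlonglongrightarrow> 0"
    using assms unfolding H10_pair_iff by blast
  have meas[measurable]: "u \<in> borel_measurable borel" "g \<in> borel_measurable borel"
      "v \<in> borel_measurable borel" "h \<in> borel_measurable borel"
    and L: "L2 (ext0 \<Omega> u)" "L2 (ext0 \<Omega> g)" "L2 (ext0 \<Omega> v)" "L2 (ext0 \<Omega> h)"
    using assms unfolding H10_pair_iff by auto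
  have lim: "(\<lambda>n. sqn (\<lambda>x. (c *\<^sub>R f n x + d *\<^sub>R k n x) - (c *\<^sub>R F x + d *\<^sub>R K x))) \<longlonglongrightarrow> 0"
    if "\<And>n. L2 (f n)" "L2 F" "(\<lambda>n. sqn (\<lambda>x. f n x - F x)) \<longlonglongrightarrow> 0"
      "\<And>n. L2 (k n)" "L2 K" "(\<lambda>n. sqn (\<lambda>x. k n x - K x)) \<longlonglongrightarrow> 0"
    for f k :: "nat \<Rightarrow> 'a \<Rightarrow> 'b::euclidean_space" and F K
  proof (rule Lim_null_comparison[OF eventuallyI])
    fix n
    have "sqn (\<lambda>x. c *\<^sub>R (f n x - F x) + d *\<^sub>R (k n x - K x)) \<le>
        2 * sqn (\<lambda>x. c *\<^sub>R (f n x - F x)) + 2 * sqn (\<lambda>x. d *\<^sub>R (k n x - K x))"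
      by (intro sqn_add_le L2_scaleR L2_diff that)
    also have "(\<lambda>x. c *\<^sub>R (f n x - F x) + d *\<^sub>R (k n x - K x)) =
        (\<lambda>x. (c *\<^sub>R f n x + d *\<^sub>R k n x) - (c *\<^sub>R F x + d *\<^sub>R K x))"
      by (auto simp: algebra_simps)
    finally show "norm (sqn (\<lambda>x. (c *\<^sub>R f n x + d *\<^sub>R k n x) - (c *\<^sub>R F x + d *\<^sub>R K x))) \<le>
        2 * (c\<^sup>2 * sqn (\<lambda>x. f n x - F x)) + 2 * (d\<^sup>2 * sqn (\<lambda>x. k n x - K x))"
      by (simp add: sqn_scaleR sqn_nonneg)
    show "(\<lambda>n. 2 * (c\<^sup>2 * sqn (\<lambda>x. f n x - F x)) + 2 * (d\<^sup>2 * sqn (\<lambda>x. k n x - K x))) \<longlonglongrightarrow> 0"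
      using that by (auto intro!: tendsto_eq_intros)
  qed
  have cutl: "ext0 \<Omega> (\<lambda>x. c *\<^sub>R f x + d *\<^sub>R k x) = (\<lambda>x. c *\<^sub>R ext0 \<Omega> f x + d *\<^sub>R ext0 \<Omega> k x)"
    for f k :: "'a \<Rightarrow> 'b::euclidean_space" by (auto simp: ext0_def)
  have gr: "grad (\<lambda>x. c *\<^sub>R \<phi> n x + d *\<^sub>R \<psi> n x) x = c *\<^sub>R grad (\<phi> n) x + d *\<^sub>R grad (\<psi> n) x" for n x
    using test_fn_smooth[OF u(1)] test_fn_smooth[OF v(1)]
    by (simp add: grad_add grad_cmult smooth_mult[OF smooth_const])
  have extr: "ext0 \<Omega> (\<lambda>x. c * u x + d * v x) = (\<lambda>x. c *\<^sub>R ext0 \<Omega> u x + d *\<^sub>R ext0 \<Omega> v x)"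
    using cutl[of u v] by simp
  have "test_fn \<Omega> (\<lambda>x. c *\<^sub>R \<phi> n x + d *\<^sub>R \<psi> n x)" for n
    using test_fn_add[OF test_fn_cmult[OF u(1)] test_fn_cmult[OF v(1)]] by simp
  moreover have "(\<lambda>x. c * u x + d * v x) \<in> borel_measurable borel"
    "(\<lambda>x. c *\<^sub>R g x + d *\<^sub>R h x) \<in> borel_measurable borel" by auto
  ultimately show ?thesis unfolding H10_pair_iff extr cutl
    using lim[OF test_fn_L2[OF u(1)] L(1) u(2) test_fn_L2[OF v(1)] L(3) v(2)]
      lim[OF test_fn_L2_grad[OF u(1)] L(2) u(3) test_fn_L2_grad[OF v(1)] L(4) v(3)]
      L2_add[OF L2_scaleR[OF L(1)] L2_scaleR[OF L(3)]] L2_add[OF L2_scaleR[OF L(2)] L2_scaleR[OF L(4)]]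
    unfolding gr[symmetric]
    by (intro conjI exI[of _ "\<lambda>n x. c *\<^sub>R \<phi> n x + d *\<^sub>R \<psi> n x"] allI)
qed

lemma H10_pair_test:
  assumes "test_fn \<Omega> f" shows "H10_pair \<Omega> f (grad f)"
proof -
  have c: "ext0 \<Omega> f = f" "ext0 \<Omega> (grad f) = grad f"
    using test_fn_zero_outside[OF assms] by (auto simp: ext0_def fun_eq_iff)
  show ?thesis unfolding H10_pair_iff c
    using assms test_fn_L2[OF assms] test_fn_L2_grad[OF assms]
    by (intro conjI exI[of _ "\<lambda>n. f"]) (auto dest: L2_measurable simp: sqn_def)
qed

text \<open>Density carries \<open>Green_test\<close> over to weak gradients. Since \<open>h\<close>
  depends on \<open>\<psi>\<close> alone, the pairing of a weak gradient with a test gradient sees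
  only the values of \<open>u\<close>; uniqueness of weak gradients and weak convergence of
  gradients both rest on this.\<close>

lemma Green:
  assumes "test_fn \<Omega> \<psi>"
  obtains h where "L2 h" "\<And>u g. H10_pair \<Omega> u g \<Longrightarrow> ip (ext0 \<Omega> g) (grad \<psi>) = ip (ext0 \<Omega> u) h"
proof -
  obtain h where h: "test_fn \<Omega> h" "\<And>f. test_fn \<Omega> f \<Longrightarrow> ip (grad f) (grad \<psi>) = ip f h"
    using Green_test[OF assms] by metis
  have "ip (ext0 \<Omega> g) (grad \<psi>) = ip (ext0 \<Omega> u) h" if "H10_pair \<Omega> u g" for u g
  proof -
    obtain \<phi> where \<phi>: "\<And>n. test_fn \<Omega> (\<phi> n)" "(\<lambda>n. sqn (\<lambda>x. \<phi> n x - ext0 \<Omega> u x)) \<longlonglongrightarrow> 0"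
        "(\<lambda>n. sqn (\<lambda>x. grad (\<phi> n) x - ext0 \<Omega> g x)) \<longlonglongrightarrow> 0" "L2 (ext0 \<Omega> u)" "L2 (ext0 \<Omega> g)"
      using \<open>H10_pair \<Omega> u g\<close> unfolding H10_pair_iff by blast
    have c: "(\<lambda>n. sqn (\<lambda>x. f x - f x)) \<longlonglongrightarrow> 0" for f :: "'a \<Rightarrow> 'b::euclidean_space" by (simp add: sqn_def)
    have "(\<lambda>n. ip (grad (\<phi> n)) (grad \<psi>)) \<longlonglongrightarrow> ip (ext0 \<Omega> g) (grad \<psi>)"
      by (rule ip_tendsto[OF test_fn_L2_grad[OF \<phi>(1)] \<phi>(5,3) test_fn_L2_grad[OF assms] test_fn_L2_grad[OF assms] c])
    moreover have "(\<lambda>n. ip (\<phi> n) h) \<longlonglongrightarrow> ip (ext0 \<Omega> u) h"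
      by (rule ip_tendsto[OF test_fn_L2[OF \<phi>(1)] \<phi>(4,2) test_fn_L2[OF h(1)] test_fn_L2[OF h(1)] c])
    ultimately show ?thesis using h(2)[OF \<phi>(1)] LIMSEQ_unique by simp
  qed
  then show thesis using that test_fn_L2[OF h(1)] by blast
qed

text \<open>The difference \<open>k\<close> is a weak gradient of \<open>0\<close>, so by
  \<open>Green\<close> it is orthogonal to all test gradients; it is also a limit of test gradients,
  hence orthogonal to itself.\<close>

lemma weak_gradient_unique:
  assumes "H10_pair \<Omega> u g" "H10_pair \<Omega> u h"
  shows "AE x in lborel. ext0 \<Omega> g x = ext0 \<Omega> h x"
proof -
  define k where "k = (\<lambda>x. 1 *\<^sub>R g x + (-1) *\<^sub>R h x)"
  have "H10_pair \<Omega> (\<lambda>x. 1 * u x + (-1) * u x) k"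
    unfolding k_def by (rule H10_pair_lincomb[OF assms])
  then have k0: "H10_pair \<Omega> (\<lambda>x. 0) k" by simp
  then obtain \<phi> where \<phi>: "\<And>n. test_fn \<Omega> (\<phi> n)" "(\<lambda>n. sqn (\<lambda>x. grad (\<phi> n) x - ext0 \<Omega> k x)) \<longlonglongrightarrow> 0"
    and k: "L2 (ext0 \<Omega> k)" unfolding H10_pair_iff by blast
  have "ip (ext0 \<Omega> k) (grad (\<phi> n)) = 0" for n
  proof -
    obtain h' where "\<And>u g. H10_pair \<Omega> u g \<Longrightarrow> ip (ext0 \<Omega> g) (grad (\<phi> n)) = ip (ext0 \<Omega> u) h'"
      using Green[OF \<phi>(1)] by blast
    from this[OF k0] show ?thesis by (simp add: ip_def ext0_def)
  qed
  moreover have "(\<lambda>n. ip (ext0 \<Omega> k) (grad (\<phi> n))) \<longlonglongrightarrow> ip (ext0 \<Omega> k) (ext0 \<Omega> k)"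
    by (rule ip_tendsto[OF k k _ test_fn_L2_grad[OF \<phi>(1)] k \<phi>(2)]) (simp add: sqn_def)
  ultimately have "sqn (ext0 \<Omega> k) = 0" using LIMSEQ_unique tendsto_const by (simp add: sqn_eq_ip) blast
  from sqn_eq_0[OF k this] show ?thesis
    by (rule eventually_mono) (auto simp: ext0_def k_def split: if_splits)
qed

lemma contraction_abs_le:
  assumes "smooth T" "\<And>s. \<bar>pdiff 1 T s\<bar> \<le> 1"
  shows "\<bar>T s - T t\<bar> \<le> \<bar>s - t\<bar>"
  using field_differentiable_bound[OF convex_UNIV, of T "pdiff 1 T" 1 s t] smooth_DERIV[OF assms(1)] assms(2)
  by simp

text \<open>The approximants are \<open>T (\<phi> n x)\<close>. The derivative of \<open>T\<close>
  is bounded and continuous, so its values converge pointwise once a subsequence of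
  \<open>\<phi>\<close> converges almost everywhere.\<close>

lemma H10_pair_compose:
  assumes u: "H10_pair \<Omega> u g" and T: "smooth T" "T 0 = 0" "\<And>s. \<bar>pdiff 1 T s\<bar> \<le> 1"
  shows "H10_pair \<Omega> (\<lambda>x. T (u x)) (\<lambda>x. pdiff 1 T (u x) *\<^sub>R g x)"
proof -
  obtain \<phi> where \<phi>: "\<And>n. test_fn \<Omega> (\<phi> n)" "(\<lambda>n. sqn (\<lambda>x. \<phi> n x - ext0 \<Omega> u x)) \<longlonglongrightarrow> 0"
      "(\<lambda>n. sqn (\<lambda>x. grad (\<phi> n) x - ext0 \<Omega> g x)) \<longlonglongrightarrow> 0" and L: "L2 (ext0 \<Omega> u)" "L2 (ext0 \<Omega> g)"
    and [measurable]: "u \<in> borel_measurable borel" "g \<in> borel_measurable borel"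
    using u unfolding H10_pair_iff by blast
  have [measurable]: "T \<in> borel_measurable borel" "pdiff 1 T \<in> borel_measurable borel"
    using T smooth_pdiff[OF T(1), of 1] by (auto intro: smooth_borel)
  have [measurable]: "ext0 \<Omega> u \<in> borel_measurable borel" "ext0 \<Omega> g \<in> borel_measurable borel"
    "\<And>n. \<phi> n \<in> borel_measurable borel" "\<And>n. grad (\<phi> n) \<in> borel_measurable borel"
    using L test_fn_L2[OF \<phi>(1)] test_fn_L2_grad[OF \<phi>(1)] by (auto dest: L2_measurable)
  have lip: "\<bar>T s - T t\<bar> \<le> \<bar>s - t\<bar>" for s t using contraction_abs_le[OF T(1,3)] .
  have cutT: "ext0 \<Omega> (\<lambda>x. T (u x)) = (\<lambda>x. T (ext0 \<Omega> u x))" using T(2) by (auto simp: ext0_def)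
  have cutg: "ext0 \<Omega> (\<lambda>x. pdiff 1 T (u x) *\<^sub>R g x) = (\<lambda>x. pdiff 1 T (ext0 \<Omega> u x) *\<^sub>R ext0 \<Omega> g x)"
    by (auto simp: ext0_def)
  have LT: "L2 (\<lambda>x. T (ext0 \<Omega> u x))"
    by (rule L2_bound[OF L(1)]) (use lip[of _ 0] T(2) in auto)
  have Lg: "L2 (\<lambda>x. pdiff 1 T (ext0 \<Omega> u x) *\<^sub>R ext0 \<Omega> g x)"
    by (rule L2_bound[OF L(2)]) (use T(3) in \<open>auto intro!: AE_I2 mult_left_le_one_le\<close>)
  have "(\<lambda>n. \<integral>x. norm ((norm (\<phi> n x - ext0 \<Omega> u x))\<^sup>2) \<partial>lborel) \<longlonglongrightarrow> 0"
    using \<phi>(2) by (simp add: sqn_def)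
  from tendsto_L1_AE_subseq[OF _ this] obtain r where r: "strict_mono r"
    and AE: "AE x in lborel. (\<lambda>n. (norm (\<phi> (r n) x - ext0 \<Omega> u x))\<^sup>2) \<longlonglongrightarrow> 0"
    using L2_integrable[OF L2_diff[OF test_fn_L2[OF \<phi>(1)] L(1)]] by blast
  have AE2: "AE x in lborel. (\<lambda>n. pdiff 1 T (\<phi> (r n) x)) \<longlonglongrightarrow> pdiff 1 T (ext0 \<Omega> u x)"
    using AE
  proof (rule eventually_mono)
    fix x assume "(\<lambda>n. (norm (\<phi> (r n) x - ext0 \<Omega> u x))\<^sup>2) \<longlonglongrightarrow> 0"
    from tendsto_real_sqrt[OF this] have "(\<lambda>n. \<phi> (r n) x - ext0 \<Omega> u x) \<longlonglongrightarrow> 0"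
      by (simp add: tendsto_rabs_zero_iff)
    then have "(\<lambda>n. \<phi> (r n) x) \<longlonglongrightarrow> ext0 \<Omega> u x" by (simp add: LIM_zero_iff)
    then show "(\<lambda>n. pdiff 1 T (\<phi> (r n) x)) \<longlonglongrightarrow> pdiff 1 T (ext0 \<Omega> u x)"
      using smooth_isCont[OF smooth_pdiff[OF T(1), of 1]] by (auto intro: isCont_tendsto_compose)
  qed
  have lim1: "(\<lambda>n. sqn (\<lambda>x. T (\<phi> (r n) x) - T (ext0 \<Omega> u x))) \<longlonglongrightarrow> 0"
  proof (rule Lim_null_comparison[OF eventuallyI])
    fix n
    show "norm (sqn (\<lambda>x. T (\<phi> (r n) x) - T (ext0 \<Omega> u x))) \<le> sqn (\<lambda>x. \<phi> (r n) x - ext0 \<Omega> u x)"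
      unfolding sqn_def
    proof (simp, rule integral_mono)
      have "L2 (\<lambda>x. T (\<phi> (r n) x) - T (ext0 \<Omega> u x))"
        by (rule L2_bound[OF L2_diff[OF test_fn_L2[OF \<phi>(1)] L(1)], of _ "r n"]) (use lip in auto)
      from L2_integrable[OF this] show "integrable lborel (\<lambda>x. (T (\<phi> (r n) x) - T (ext0 \<Omega> u x))\<^sup>2)" by simp
      from L2_integrable[OF L2_diff[OF test_fn_L2[OF \<phi>(1)] L(1)]]
      show "integrable lborel (\<lambda>x. (\<phi> (r n) x - ext0 \<Omega> u x)\<^sup>2)" by simp
      show "(T (\<phi> (r n) x) - T (ext0 \<Omega> u x))\<^sup>2 \<le> (\<phi> (r n) x - ext0 \<Omega> u x)\<^sup>2" for x
        using lip by (simp add: abs_le_square_iff)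
    qed
    show "(\<lambda>n. sqn (\<lambda>x. \<phi> (r n) x - ext0 \<Omega> u x)) \<longlonglongrightarrow> 0"
      using LIMSEQ_subseq_LIMSEQ[OF \<phi>(2) r] by (simp add: o_def)
  qed
  \<comment> \<open>The gradient error is split in two: \<open>?a\<close> is the error of the
    gradients with a factor bounded by \<open>1\<close>, \<open>?b\<close> the error of the factor
    against a fixed gradient, which is left to dominated convergence.\<close>
  let ?a = "\<lambda>n x. pdiff 1 T (\<phi> (r n) x) *\<^sub>R (grad (\<phi> (r n)) x - ext0 \<Omega> g x)"
  let ?b = "\<lambda>n x. (pdiff 1 T (\<phi> (r n) x) - pdiff 1 T (ext0 \<Omega> u x)) *\<^sub>R ext0 \<Omega> g x"
  have La: "L2 (?a n)" for n
    by (rule L2_bound[OF L2_diff[OF test_fn_L2_grad[OF \<phi>(1)] L(2)], of _ "r n"])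
      (use T(3) in \<open>auto intro!: AE_I2 mult_left_le_one_le\<close>)
  have b2: "\<bar>pdiff 1 T s - pdiff 1 T t\<bar> \<le> 2" for s t using T(3)[of s] T(3)[of t] by linarith
  have Lb: "L2 (?b n)" for n
    by (rule L2_bound[OF L2_scaleR[OF L(2), of 2]]) (use b2 in \<open>auto intro!: AE_I2 mult_right_mono\<close>)
  have lima: "(\<lambda>n. sqn (?a n)) \<longlonglongrightarrow> 0"
  proof (rule Lim_null_comparison[OF eventuallyI])
    fix n
    have "sqn (?a n) \<le> sqn (\<lambda>x. grad (\<phi> (r n)) x - ext0 \<Omega> g x)"
      unfolding sqn_def
      by (intro integral_mono L2_integrable La L2_diff test_fn_L2_grad[OF \<phi>(1)] L power_mono)
        (use T(3) in \<open>auto intro!: AE_I2 mult_left_le_one_le\<close>)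
    then show "norm (sqn (?a n)) \<le> sqn (\<lambda>x. grad (\<phi> (r n)) x - ext0 \<Omega> g x)" by (simp add: sqn_nonneg)
    show "(\<lambda>n. sqn (\<lambda>x. grad (\<phi> (r n)) x - ext0 \<Omega> g x)) \<longlonglongrightarrow> 0"
      using LIMSEQ_subseq_LIMSEQ[OF \<phi>(3) r] by (simp add: o_def)
  qed
  have limb: "(\<lambda>n. sqn (?b n)) \<longlonglongrightarrow> 0"
  proof -
    have "(\<lambda>n. sqn (?b n)) \<longlonglongrightarrow> (\<integral>x. 0 \<partial>(lborel::'a measure))" unfolding sqn_def
    proof (rule integral_dominated_convergence[where w="\<lambda>x. 4 * (norm (ext0 \<Omega> g x))\<^sup>2"])
      show "integrable lborel (\<lambda>x. 4 * (norm (ext0 \<Omega> g x))\<^sup>2)"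
        using L2_integrable[OF L(2)] by simp
      show "AE x in lborel. (\<lambda>n. (norm (?b n x))\<^sup>2) \<longlonglongrightarrow> 0"
        using AE2
      proof (rule eventually_mono)
        fix x assume "(\<lambda>n. pdiff 1 T (\<phi> (r n) x)) \<longlonglongrightarrow> pdiff 1 T (ext0 \<Omega> u x)"
        then have "(\<lambda>n. (norm (?b n x))\<^sup>2) \<longlonglongrightarrow>
           (norm ((pdiff 1 T (ext0 \<Omega> u x) - pdiff 1 T (ext0 \<Omega> u x)) *\<^sub>R ext0 \<Omega> g x))\<^sup>2"
          by (intro tendsto_intros)
        then show "(\<lambda>n. (norm (?b n x))\<^sup>2) \<longlonglongrightarrow> 0" by simp
      qed
      fix n
      show "AE x in lborel. norm ((norm (?b n x))\<^sup>2) \<le> 4 * (norm (ext0 \<Omega> g x))\<^sup>2"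
      proof (rule AE_I2)
        fix x
        have "(pdiff 1 T (\<phi> (r n) x) - pdiff 1 T (ext0 \<Omega> u x))\<^sup>2 \<le> 2\<^sup>2"
          using b2[of "\<phi> (r n) x" "ext0 \<Omega> u x"]
            abs_le_square_iff[of "pdiff 1 T (\<phi> (r n) x) - pdiff 1 T (ext0 \<Omega> u x)" 2] by simp
        then show "norm ((norm (?b n x))\<^sup>2) \<le> 4 * (norm (ext0 \<Omega> g x))\<^sup>2"
          by (simp add: power_mult_distrib mult_right_mono)
      qed
    qed auto
    then show ?thesis by simp
  qed
  have lim2: "(\<lambda>n. sqn (\<lambda>x. pdiff 1 T (\<phi> (r n) x) *\<^sub>R grad (\<phi> (r n)) x -
      pdiff 1 T (ext0 \<Omega> u x) *\<^sub>R ext0 \<Omega> g x)) \<longlonglongrightarrow> 0"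
  proof (rule Lim_null_comparison[OF eventuallyI])
    fix n
    show "norm (sqn (\<lambda>x. pdiff 1 T (\<phi> (r n) x) *\<^sub>R grad (\<phi> (r n)) x -
      pdiff 1 T (ext0 \<Omega> u x) *\<^sub>R ext0 \<Omega> g x)) \<le> 2 * sqn (?a n) + 2 * sqn (?b n)"
      using sqn_add_le[OF La Lb, of n n] by (simp add: sqn_nonneg algebra_simps)
    show "(\<lambda>n. 2 * sqn (?a n) + 2 * sqn (?b n)) \<longlonglongrightarrow> 0"
      using lima limb by (auto intro!: tendsto_eq_intros)
  qed
  have test: "test_fn \<Omega> (\<lambda>x. T (\<phi> (r n) x))" for n
    by (rule test_fn_compose[OF \<phi>(1) T(1,2)])
  have gr: "grad (\<lambda>x. T (\<phi> (r n) x)) x = pdiff 1 T (\<phi> (r n) x) *\<^sub>R grad (\<phi> (r n)) x" for n x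
    by (rule grad_compose[OF T(1) test_fn_smooth[OF \<phi>(1)]])
  have "(\<lambda>x. T (u x)) \<in> borel_measurable borel" "(\<lambda>x. pdiff 1 T (u x) *\<^sub>R g x) \<in> borel_measurable borel"
    by measurable
  with lim1 lim2[folded gr] LT Lg test show ?thesis unfolding H10_pair_iff cutT cutg
    by (intro conjI exI[of _ "\<lambda>n x. T (\<phi> (r n) x)"] allI)
qed

end

section \<open>Gram sums and asymptotically orthogonal sequences\<close>

lemma L2_zero: "L2 (\<lambda>x. 0)"
  by (simp add: L2_def)

lemma L2_sum: "(\<And>i. i \<in> S \<Longrightarrow> L2 (f i)) \<Longrightarrow> L2 (\<lambda>x. \<Sum>i\<in>S. f i x)"
  by (induction S rule: infinite_finite_induct) (auto intro: L2_add L2_zero)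

lemma ip_sum_left:
  "(\<And>i. i \<in> S \<Longrightarrow> L2 (f i)) \<Longrightarrow> L2 g \<Longrightarrow> ip (\<lambda>x. \<Sum>i\<in>S. f i x) g = (\<Sum>i\<in>S. ip (f i) g)"
  unfolding ip_def inner_sum_left
  by (rule Bochner_Integration.integral_sum) (auto intro: L2_inner_integrable)

lemma sqn_sum:
  assumes "\<And>i. i \<in> S \<Longrightarrow> L2 (f i)"
  shows "sqn (\<lambda>x. \<Sum>i\<in>S. f i x) = (\<Sum>i\<in>S. \<Sum>j\<in>S. ip (f i) (f j))"
proof -
  have "ip (f i) (\<lambda>x. \<Sum>j\<in>S. f j x) = (\<Sum>j\<in>S. ip (f i) (f j))" if "i \<in> S" for i
    using ip_sum_left[of S f "f i"] assms that by (simp add: ip_commute[of "f i"])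
  then show ?thesis by (simp add: sqn_eq_ip ip_sum_left assms L2_sum)
qed

text \<open>Here \<open>g\<close> is the Gram matrix of a sequence and \<open>l\<close> the values of a bounded functional on it: long
  averages of a sparse subsequence have small norm. This replaces the Riesz representation theorem.\<close>

lemma asymptotically_orthogonal_tendsto:
  fixes g :: "nat \<Rightarrow> nat \<Rightarrow> real" and l :: "nat \<Rightarrow> real"
  assumes sym: "\<And>i j. g i j = g j i" and diag: "\<And>i. g i i \<le> B"
    and orth: "\<And>j. (\<lambda>i. g i j) \<longlonglongrightarrow> 0"
    and bound: "\<And>S. finite S \<Longrightarrow> (\<Sum>i\<in>S. l i)\<^sup>2 \<le> C * (\<Sum>i\<in>S. \<Sum>j\<in>S. g i j)" and "C \<ge> 0"
  shows "l \<longlonglongrightarrow> 0"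
proof (rule ccontr)
  assume "\<not> l \<longlonglongrightarrow> 0"
  then obtain d where d: "d > 0" "\<not> (\<forall>\<^sub>F n in sequentially. \<bar>l n\<bar> < d)"
    unfolding tendsto_iff by auto
  then have "infinite {n. \<bar>l n\<bar> \<ge> d}"
    by (simp add: eventually_cofinite not_less flip: cofinite_eq_sequentially)
  moreover have "{n. \<bar>l n\<bar> \<ge> d} \<subseteq> {n. l n \<ge> d} \<union> {n. - l n \<ge> d}" by auto
  ultimately have "infinite {n. l n \<ge> d} \<or> infinite {n. - l n \<ge> d}"
    by (meson finite_Un finite_subset)
  then have "\<exists>s. infinite {n. s * l n \<ge> d} \<and> s\<^sup>2 = 1"
    using exI[of "\<lambda>s. infinite {n. s * l n \<ge> d} \<and> s\<^sup>2 = 1" "1::real"]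
      exI[of "\<lambda>s. infinite {n. s * l n \<ge> d} \<and> s\<^sup>2 = 1" "-1::real"] by auto
  then obtain s where s: "infinite {n. s * l n \<ge> d}" "s\<^sup>2 = 1" by blast
  let ?P = "{n. s * l n \<ge> d}"
  \<comment> \<open>Greedy choice: a late index is almost orthogonal to the finitely many chosen
    ones, so it raises the Gram sum by at most \<open>|B| + 1\<close>. The sum grows linearly in
    \<open>N\<close>, not quadratically.\<close>
  have ex: "\<exists>S. finite S \<and> S \<subseteq> ?P \<and> card S = N \<and> (\<Sum>i\<in>S. \<Sum>j\<in>S. g i j) \<le> real N * (\<bar>B\<bar> + 1)" for N
  proof (induction N)
    case 0
    show ?case by (rule exI[of _ "{}"]) simp
  next
    case (Suc N)
    then obtain S where S: "finite S" "S \<subseteq> ?P" "card S = N"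
      "(\<Sum>i\<in>S. \<Sum>j\<in>S. g i j) \<le> real N * (\<bar>B\<bar> + 1)" by blast
    have "(\<lambda>i. 2 * (\<Sum>j\<in>S. g i j)) \<longlonglongrightarrow> 2 * (\<Sum>j\<in>S. 0)"
      by (intro tendsto_intros orth)
    from order_tendstoD(2)[OF this, of 1] have "\<forall>\<^sub>F i in sequentially. 2 * (\<Sum>j\<in>S. g i j) < 1"
      by simp
    then have "finite {i. \<not> 2 * (\<Sum>j\<in>S. g i j) < 1}"
      by (simp add: eventually_cofinite flip: cofinite_eq_sequentially)
    then have "finite ({i. \<not> 2 * (\<Sum>j\<in>S. g i j) < 1} \<union> S)" using S(1) by simp
    with s(1) obtain k where k: "k \<in> ?P" "2 * (\<Sum>j\<in>S. g k j) < 1" "k \<notin> S"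
      by (smt (verit) UnCI finite_subset mem_Collect_eq subsetI)
    have sw: "(\<Sum>j\<in>S. g j k) = (\<Sum>j\<in>S. g k j)" by (intro sum.cong refl) (rule sym)
    have "(\<Sum>i\<in>insert k S. \<Sum>j\<in>insert k S. g i j) =
        g k k + 2 * (\<Sum>j\<in>S. g k j) + (\<Sum>i\<in>S. \<Sum>j\<in>S. g i j)"
      using S(1) k(3) sw by (simp add: sum.distrib)
    also have "\<dots> \<le> \<bar>B\<bar> + 1 + real N * (\<bar>B\<bar> + 1)" using diag[of k] k(2) S(4) by linarith
    finally show ?case using S k
      by (intro exI[of _ "insert k S"]) (auto simp: algebra_simps)
  qed
  \<comment> \<open>The squared sum of the values grows like \<open>N^2\<close>, the Gram sum like
    \<open>N\<close>; one factor \<open>N\<close> cancels.\<close>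
  have le: "real N * d\<^sup>2 \<le> C * (\<bar>B\<bar> + 1)" if "N > 0" for N
  proof -
    obtain S where S: "finite S" "S \<subseteq> ?P" "card S = N"
      "(\<Sum>i\<in>S. \<Sum>j\<in>S. g i j) \<le> real N * (\<bar>B\<bar> + 1)" using ex by blast
    have "real N * d \<le> (\<Sum>i\<in>S. s * l i)"
      using sum_bounded_below[of S d "\<lambda>i. s * l i"] S by auto
    then have "(real N * d)\<^sup>2 \<le> (s * (\<Sum>i\<in>S. l i))\<^sup>2"
      using d(1) by (intro power_mono) (auto simp: sum_distrib_left)
    also have "\<dots> = (\<Sum>i\<in>S. l i)\<^sup>2" by (simp add: power_mult_distrib s)
    also have "\<dots> \<le> C * (real N * (\<bar>B\<bar> + 1))"
      using bound[OF S(1)] mult_left_mono[OF S(4) \<open>C \<ge> 0\<close>] by linarith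
    finally have "real N * (real N * d\<^sup>2) \<le> real N * (C * (\<bar>B\<bar> + 1))"
      by (simp add: power2_eq_square algebra_simps)
    then show ?thesis using that by simp
  qed
  obtain N :: nat where N: "real N > C * (\<bar>B\<bar> + 1) / d\<^sup>2" using reals_Archimedean2 by blast
  then have "real (Suc N) * d\<^sup>2 > C * (\<bar>B\<bar> + 1)"
    using d(1) by (simp add: field_simps) (smt (verit) zero_less_power2)
  then show False using le[of "Suc N"] by simp
qed

lemma ball_indicator_L2:
  fixes e :: real
  defines "I \<equiv> indicator (ball (0::'a::euclidean_space) e) :: 'a \<Rightarrow> real"
  shows "emeasure lborel (ball (0::'a) e) < \<infinity>" "integrable lborel I" "L2 I"
    "sqn I = measure lborel (ball (0::'a) e)"
proof -
  show fin: "emeasure lborel (ball (0::'a) e) < \<infinity>" by (rule emeasure_bounded_finite) simp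
  show int: "integrable lborel I" unfolding I_def using fin by (intro integrable_real_indicator) auto
  have eq: "(\<lambda>x. (norm (I x))\<^sup>2) = I" by (auto simp: I_def indicator_def fun_eq_iff)
  then show "L2 I" unfolding L2_def using int by simp
  show "sqn I = measure lborel (ball (0::'a) e)" unfolding sqn_def eq by (simp add: I_def)
qed

subsection \<open>Weak convergence in \<open>H10\<close>\<close>

context bounded_domain
begin

text \<open>Both abbreviations extend by zero. \<open>wgrad\<close> is a choice among
  representatives, so identities for \<open>wg\<close> hold almost everywhere only.\<close>

abbreviation val :: "('a \<Rightarrow> real) \<Rightarrow> 'a \<Rightarrow> real" where "val u \<equiv> ext0 \<Omega> u"
abbreviation wg :: "('a \<Rightarrow> real) \<Rightarrow> 'a \<Rightarrow> 'a" where "wg u \<equiv> ext0 \<Omega> (wgrad \<Omega> u)"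

lemma H10_pair_wgrad: "H10 \<Omega> u \<Longrightarrow> H10_pair \<Omega> u (wgrad \<Omega> u)"
  unfolding H10_def wgrad_def using someI_ex[of "H10_pair \<Omega> u"] by simp

lemma H10_L2: assumes "H10 \<Omega> u" shows "L2 (val u)" "L2 (wg u)"
  using H10_pair_wgrad[OF assms] unfolding H10_pair_iff by auto

lemma H10_measurable: assumes "H10 \<Omega> u" shows "u \<in> borel_measurable borel"
  using H10_pair_wgrad[OF assms] unfolding H10_pair_iff by auto

lemma wg_AE: "H10_pair \<Omega> u g \<Longrightarrow> AE x in lborel. wg u x = ext0 \<Omega> g x"
  using weak_gradient_unique H10_pair_wgrad H10_def by blast

lemma H10_lincomb:
  assumes "H10 \<Omega> u" "H10 \<Omega> v"
  shows "H10 \<Omega> (\<lambda>x. c * u x + d * v x)"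
    and "AE x in lborel. wg (\<lambda>x. c * u x + d * v x) x = c *\<^sub>R wg u x + d *\<^sub>R wg v x"
proof -
  have p: "H10_pair \<Omega> (\<lambda>x. c * u x + d * v x) (\<lambda>x. c *\<^sub>R wgrad \<Omega> u x + d *\<^sub>R wgrad \<Omega> v x)"
    using assms by (intro H10_pair_lincomb H10_pair_wgrad)
  then show "H10 \<Omega> (\<lambda>x. c * u x + d * v x)" unfolding H10_def by blast
  show "AE x in lborel. wg (\<lambda>x. c * u x + d * v x) x = c *\<^sub>R wg u x + d *\<^sub>R wg v x"
    using wg_AE[OF p] by (rule eventually_mono) (auto simp: ext0_def)
qed

lemma H10_test:
  assumes "test_fn \<Omega> f"
  shows "H10 \<Omega> f" "val f = f" "AE x in lborel. wg f x = grad f x"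
proof -
  show "H10 \<Omega> f" using H10_pair_test[OF assms] H10_def by blast
  show "val f = f" using test_fn_zero_outside[OF assms] by (auto simp: ext0_def)
  have "ext0 \<Omega> (grad f) = grad f" using test_fn_zero_outside[OF assms] by (auto simp: ext0_def)
  then show "AE x in lborel. wg f x = grad f x" using wg_AE[OF H10_pair_test[OF assms]] by simp
qed

lemma H1_inner_eq:
  assumes "H10 \<Omega> u" "H10 \<Omega> v"
  shows "H1_inner \<Omega> u v = ip (val u) (val v) + ip (wg u) (wg v)"
proof -
  have "H1_inner \<Omega> u v = (\<integral>x. val u x \<bullet> val v x + wg u x \<bullet> wg v x \<partial>lborel)"
    unfolding H1_inner_def set_lebesgue_integral_def
    by (intro Bochner_Integration.integral_cong) (auto simp: ext0_def)
  also have "\<dots> = ip (val u) (val v) + ip (wg u) (wg v)"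
    unfolding ip_def using assms by (intro Bochner_Integration.integral_add L2_inner_integrable H10_L2)
  finally show ?thesis .
qed

lemma H1_inner_lincomb:
  assumes "H10 \<Omega> u" "H10 \<Omega> v" "H10 \<Omega> w"
  shows "H1_inner \<Omega> (\<lambda>x. c * u x + d * v x) w = c * H1_inner \<Omega> u w + d * H1_inner \<Omega> v w"
proof -
  note L = H10_L2[OF assms(1)] H10_L2[OF assms(2)] H10_L2[OF assms(3)]
  note e = H10_lincomb[OF assms(1,2), of c d]
  have "ip (wg (\<lambda>x. c * u x + d * v x)) (wg w) = ip (\<lambda>x. c *\<^sub>R wg u x + d *\<^sub>R wg v x) (wg w)"
    using e(2) L H10_L2(2)[OF e(1)] by (intro ip_cong_AE) (auto dest!: L2_measurable)
  moreover have "val (\<lambda>x. c * u x + d * v x) = (\<lambda>x. c *\<^sub>R val u x + d *\<^sub>R val v x)" by (auto simp: ext0_def)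
  ultimately show ?thesis
    unfolding H1_inner_eq[OF e(1) assms(3)] H1_inner_eq[OF assms(1,3)] H1_inner_eq[OF assms(2,3)]
    using L by (simp only: ip_add_left L2_scaleR ip_scaleR_left) (simp add: algebra_simps)
qed

lemma H1_inner_diff:
  assumes "H10 \<Omega> u" "H10 \<Omega> v" "H10 \<Omega> w"
  shows "H1_inner \<Omega> (\<lambda>x. 1 * u x + (-1) * v x) w = H1_inner \<Omega> u w - H1_inner \<Omega> v w"
  unfolding H1_inner_lincomb[OF assms] by simp

text \<open>Both sides are continuous along the approximating test functions.\<close>

lemma translation_estimate:
  assumes "H10 \<Omega> u"
  shows "sqn (\<lambda>x. val u (x + t) - val u x) \<le> (norm t)\<^sup>2 * sqn (wg u)"
proof -
  obtain \<phi> where \<phi>: "\<And>n. test_fn \<Omega> (\<phi> n)" "(\<lambda>n. sqn (\<lambda>x. \<phi> n x - val u x)) \<longlonglongrightarrow> 0"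
      "(\<lambda>n. sqn (\<lambda>x. grad (\<phi> n) x - wg u x)) \<longlonglongrightarrow> 0"
    using H10_pair_wgrad[OF assms] unfolding H10_pair_iff by blast
  note L = H10_L2[OF assms]
  note Lp = test_fn_L2[OF \<phi>(1)]
  have "(\<lambda>n. sqn (\<lambda>x. \<phi> n (x + t) - \<phi> n x)) \<longlonglongrightarrow> sqn (\<lambda>x. val u (x + t) - val u x)"
  proof (rule sqn_tendsto)
    show "L2 (\<lambda>x. \<phi> n (x + t) - \<phi> n x)" "L2 (\<lambda>x. val u (x + t) - val u x)" for n
      using L2_diff[OF L2_shift[OF Lp] Lp] L2_diff[OF L2_shift[OF L(1)] L(1)] by auto
    let ?d = "\<lambda>n x. \<phi> n x - val u x"
    have Ld: "L2 (?d n)" for n using L Lp by (intro L2_diff)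
    show "(\<lambda>n. sqn (\<lambda>x. (\<phi> n (x + t) - \<phi> n x) - (val u (x + t) - val u x))) \<longlonglongrightarrow> 0"
    proof (rule Lim_null_comparison[OF eventuallyI])
      fix n
      have "sqn (\<lambda>x. ?d n (x + t) - ?d n x) \<le> 2 * sqn (\<lambda>x. ?d n (x + t)) + 2 * sqn (?d n)"
        by (intro sqn_diff_le L2_shift[OF Ld] Ld)
      also have "\<dots> = 4 * sqn (?d n)" using sqn_shift[OF Ld, of n t] by simp
      finally show "norm (sqn (\<lambda>x. (\<phi> n (x + t) - \<phi> n x) - (val u (x + t) - val u x))) \<le> 4 * sqn (?d n)"
        by (simp add: sqn_nonneg algebra_simps)
      show "(\<lambda>n. 4 * sqn (?d n)) \<longlonglongrightarrow> 0" using \<phi>(2) by (auto intro!: tendsto_eq_intros)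
    qed
  qed
  moreover have "(\<lambda>n. (norm t)\<^sup>2 * sqn (grad (\<phi> n))) \<longlonglongrightarrow> (norm t)\<^sup>2 * sqn (wg u)"
    by (intro tendsto_intros sqn_tendsto test_fn_L2_grad[OF \<phi>(1)] L \<phi>)
  ultimately show ?thesis
    by (rule LIMSEQ_le) (use translation_estimate_test[OF \<phi>(1)] in auto)
qed

text \<open>Translate by a vector longer than the diameter: the translated copy has no overlap with
  the domain, so the squared norm of the increment is exactly twice that of \<open>u\<close>, and
  the translation estimate bounds it by the gradient.\<close>

lemma Poincare:
  obtains C where "C \<ge> 0" "\<And>u. H10 \<Omega> u \<Longrightarrow> sqn (val u) \<le> C * sqn (wg u)"
proof -
  obtain R where R: "R > 0" "\<And>x. x \<in> \<Omega> \<Longrightarrow> norm x \<le> R" using bounded_dom bounded_pos by metis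
  obtain b :: 'a where b: "b \<in> Basis" using nonempty_Basis by blast
  define t where "t = (2 * R + 1) *\<^sub>R b"
  have nt: "norm t = 2 * R + 1" using b R by (simp add: t_def)
  have disj: "x + t \<notin> \<Omega> \<or> x \<notin> \<Omega>" for x
    using R(2)[of "x + t"] R(2)[of x] nt norm_triangle_ineq4[of "x + t" x] by auto
  have "sqn (val u) \<le> (norm t)\<^sup>2 * sqn (wg u)" if u: "H10 \<Omega> u" for u
  proof -
    note L = H10_L2(1)[OF u]
    have "ip (\<lambda>x. val u (x + t)) (val u) = 0"
      unfolding ip_def using disj by (intro integral_eq_zero_AE AE_I2) (auto simp: ext0_def)
    then have "2 * sqn (val u) = sqn (\<lambda>x. val u (x + t) - val u x)"
      using sqn_diff[OF L2_shift[OF L] L, of t] sqn_shift[OF L, of t] by simp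
    also have "\<dots> \<le> (norm t)\<^sup>2 * sqn (wg u)" by (rule translation_estimate[OF u])
    finally show ?thesis using sqn_nonneg[of "val u"] by linarith
  qed
  then show thesis using that[of "(norm t)\<^sup>2"] by simp
qed

text \<open>A mollification error that is uniform on bounded sets of \<open>H10\<close>. Here
  \<open>a\<close> is the integral over a ball, not divided by its volume \<open>m\<close>. The
  difference of \<open>m * u\<close> and \<open>a\<close> is an integral of increments of
  \<open>u\<close>, estimated by Cauchy-Schwarz, Fubini and
  \<open>translation_estimate\<close>.\<close>

lemma ball_average_estimate:
  assumes u: "H10 \<Omega> u" and "e > 0"
  defines "m \<equiv> measure lborel (ball (0::'a) e)"
    and "a \<equiv> \<lambda>x. \<integral>y. indicator (ball (0::'a) e) y *\<^sub>R val u (y + x) \<partial>lborel"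
  shows "a \<in> borel_measurable borel" "\<And>x. (a x)\<^sup>2 \<le> m * sqn (val u)"
    "m\<^sup>2 * sqn (val u) \<le> 2 * (\<integral>x. indicator \<Omega> x *\<^sub>R (a x)\<^sup>2 \<partial>lborel) + 2 * m\<^sup>2 * e\<^sup>2 * sqn (wg u)"
proof -
  let ?B = "ball (0::'a) e"
  let ?I = "indicator ?B :: 'a \<Rightarrow> real"
  note L = H10_L2[OF u]
  have [measurable]: "val u \<in> borel_measurable borel" "\<Omega> \<in> sets borel"
    using L open_dom by (auto dest: L2_measurable)
  note fin = ball_indicator_L2(1)[where e=e and 'a='a] and intI = ball_indicator_L2(2)[where e=e and 'a='a]
    and LI = ball_indicator_L2(3)[where e=e and 'a='a] and sI = ball_indicator_L2(4)[where e=e and 'a='a, folded m_def]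
  have [measurable]: "?I \<in> borel_measurable borel" by (rule borel_measurable_indicator) simp
  show [measurable]: "a \<in> borel_measurable borel"
    unfolding a_def by measurable
  have a_ip: "a x = ip ?I (\<lambda>y. val u (y + x))" for x by (simp add: a_def ip_def)
  show a2: "(a x)\<^sup>2 \<le> m * sqn (val u)" for x
    unfolding a_ip using ip_Cauchy_Schwarz[OF LI L2_shift[OF L(1)], of x]
    by (simp add: sI sqn_shift[OF L(1)])
  have m0: "m \<ge> 0" by (simp add: m_def)
  \<comment> \<open>Kept in \<open>ennreal\<close>, so that exchanging the integrals requires
    measurability only.\<close>
  define q where "q x = (\<integral>\<^sup>+y. ennreal ((?I y * (val u (x + y) - val u x))\<^sup>2) \<partial>lborel)" for x
  have pw: "ennreal (m\<^sup>2 * (val u x)\<^sup>2) \<le> ennreal (2 * (indicator \<Omega> x *\<^sub>R (a x)\<^sup>2)) + ennreal (2 * m) * q x" for x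
  proof (cases "x \<in> \<Omega>")
    case True
    let ?d = "\<lambda>y. ?I y * (val u (x + y) - val u x)"
    have Ld: "L2 ?d"
    proof (rule L2_diff[of "\<lambda>y. ?I y * val u (x + y)" "\<lambda>y. val u x *\<^sub>R ?I y", THEN ext[THEN arg_cong[of _ _ L2], THEN iffD1, rotated]])
      show "L2 (\<lambda>y. ?I y * val u (x + y))"
        by (rule L2_bound[OF L2_shift[OF L(1), of x]]) (auto simp: indicator_def add.commute)
      show "L2 (\<lambda>y. val u x *\<^sub>R ?I y)" by (rule L2_scaleR[OF LI])
    qed (simp add: algebra_simps)
    have i1: "integrable lborel (\<lambda>y. ?I y * val u (y + x))"
      using L2_inner_integrable[OF LI L2_shift[OF L(1), of x]] by simp
    have "ip ?I ?d = (\<integral>y. ?I y * val u (y + x) - val u x * ?I y \<partial>lborel)" unfolding ip_def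
      by (intro Bochner_Integration.integral_cong) (auto simp: indicator_def add.commute)
    also have "\<dots> = a x - val u x * m"
      using i1 intI by (simp add: a_def m_def)
    finally have eq: "m * val u x = a x - ip ?I ?d" by simp
    have "m\<^sup>2 * (val u x)\<^sup>2 = (a x - ip ?I ?d)\<^sup>2" by (simp add: eq[symmetric] power_mult_distrib)
    also have "\<dots> \<le> 2 * (a x)\<^sup>2 + 2 * (ip ?I ?d)\<^sup>2"
      using zero_le_power2[of "a x + ip ?I ?d"] by (simp add: power2_eq_square algebra_simps)
    also have "\<dots> \<le> 2 * (a x)\<^sup>2 + 2 * m * sqn ?d"
      using ip_Cauchy_Schwarz[OF LI Ld] by (simp add: sI)
    finally have "ennreal (m\<^sup>2 * (val u x)\<^sup>2) \<le> ennreal (2 * (a x)\<^sup>2 + 2 * m * sqn ?d)"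
      by (rule ennreal_leI)
    also have "\<dots> = ennreal (2 * (a x)\<^sup>2) + ennreal (2 * m) * ennreal (sqn ?d)"
      using m0 sqn_nonneg[of ?d] by (simp add: ennreal_plus ennreal_mult)
    also have "ennreal (sqn ?d) = q x"
      using nn_integral_sqn[OF Ld] by (simp add: q_def)
    finally show ?thesis using True by simp
  next
    case False
    then show ?thesis by (simp add: ext0_def)
  qed
  have intA: "integrable lborel (\<lambda>x. indicator \<Omega> x *\<^sub>R (a x)\<^sup>2)"
  proof (rule Bochner_Integration.integrable_bound[where f="\<lambda>x. (m * sqn (val u)) * indicator \<Omega> x :: real"])
    show "integrable lborel (\<lambda>x. (m * sqn (val u)) * indicator \<Omega> x :: real)"
      using emeasure_bounded_finite[OF bounded_dom]
      by (intro integrable_mult_right integrable_real_indicator) auto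
    show "AE x in lborel. norm (indicator \<Omega> x *\<^sub>R (a x)\<^sup>2) \<le> norm ((m * sqn (val u)) * indicator \<Omega> x)"
      using a2 order_trans[OF a2 abs_ge_self] by (intro AE_I2) (auto simp: indicator_def)
  qed simp
  have nnA: "0 \<le> (\<integral>x. indicator \<Omega> x *\<^sub>R (a x)\<^sup>2 \<partial>lborel)" by (rule integral_nonneg_AE) auto
  have qm[measurable]: "q \<in> borel_measurable borel" unfolding q_def by measurable
  have "(\<integral>\<^sup>+x. q x \<partial>lborel) = (\<integral>\<^sup>+y. (\<integral>\<^sup>+x. ennreal ((?I y * (val u (x + y) - val u x))\<^sup>2) \<partial>lborel) \<partial>lborel)"
    unfolding q_def by (rule lborel_pair.Fubini') measurable
  also have "\<dots> \<le> (\<integral>\<^sup>+y. ennreal (e\<^sup>2 * sqn (wg u)) * indicator ?B y \<partial>lborel)"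
  proof (rule nn_integral_mono)
    fix y :: 'a
    have "(\<integral>\<^sup>+x. ennreal ((val u (x + y) - val u x)\<^sup>2) \<partial>lborel) = ennreal (sqn (\<lambda>x. val u (x + y) - val u x))"
      using nn_integral_sqn[OF L2_diff[OF L2_shift[OF L(1)] L(1)], of y] by simp
    also have "\<dots> \<le> ennreal (e\<^sup>2 * sqn (wg u))" if "y \<in> ?B"
    proof (rule ennreal_leI)
      have "(norm y)\<^sup>2 \<le> e\<^sup>2" using that by (intro power_mono) auto
      then show "sqn (\<lambda>x. val u (x + y) - val u x) \<le> e\<^sup>2 * sqn (wg u)"
        using translation_estimate[OF u, of y] mult_right_mono[OF _ sqn_nonneg[of "wg u"]] by (meson order_trans)
    qed
    finally show "(\<integral>\<^sup>+x. ennreal ((?I y * (val u (x + y) - val u x))\<^sup>2) \<partial>lborel)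
        \<le> ennreal (e\<^sup>2 * sqn (wg u)) * indicator ?B y"
      by (auto simp: indicator_def)
  qed
  also have "\<dots> = ennreal (e\<^sup>2 * sqn (wg u)) * emeasure lborel ?B"
    by (simp add: nn_integral_cmult_indicator)
  also have "\<dots> = ennreal (e\<^sup>2 * sqn (wg u) * m)"
    using fin sqn_nonneg[of "wg u"] by (simp add: m_def emeasure_eq_ennreal_measure ennreal_mult)
  finally have q: "(\<integral>\<^sup>+x. q x \<partial>lborel) \<le> ennreal (e\<^sup>2 * sqn (wg u) * m)" .
  have "ennreal (m\<^sup>2 * sqn (val u)) = ennreal (m\<^sup>2) * (\<integral>\<^sup>+x. ennreal ((norm (val u x))\<^sup>2) \<partial>lborel)"
    using nn_integral_sqn[OF L(1)] sqn_nonneg[of "val u"] by (simp add: ennreal_mult)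
  also have "\<dots> = (\<integral>\<^sup>+x. ennreal (m\<^sup>2 * (val u x)\<^sup>2) \<partial>lborel)"
    by (subst nn_integral_cmult[symmetric]) (auto simp: ennreal_mult)
  also have "\<dots> \<le> (\<integral>\<^sup>+x. ennreal (2 * (indicator \<Omega> x *\<^sub>R (a x)\<^sup>2)) + ennreal (2 * m) * q x \<partial>lborel)"
    by (intro nn_integral_mono pw)
  also have "\<dots> = (\<integral>\<^sup>+x. ennreal (2 * (indicator \<Omega> x *\<^sub>R (a x)\<^sup>2)) \<partial>lborel) + ennreal (2 * m) * (\<integral>\<^sup>+x. q x \<partial>lborel)"
    by (subst nn_integral_add) (auto simp: nn_integral_cmult)
  also have "(\<integral>\<^sup>+x. ennreal (2 * (indicator \<Omega> x *\<^sub>R (a x)\<^sup>2)) \<partial>lborel) =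
      ennreal (2 * (\<integral>x. indicator \<Omega> x *\<^sub>R (a x)\<^sup>2 \<partial>lborel))"
    using intA by (subst nn_integral_eq_integral) auto
  also have "ennreal (2 * (\<integral>x. indicator \<Omega> x *\<^sub>R (a x)\<^sup>2 \<partial>lborel)) + ennreal (2 * m) * (\<integral>\<^sup>+x. q x \<partial>lborel) \<le>
      ennreal (2 * (\<integral>x. indicator \<Omega> x *\<^sub>R (a x)\<^sup>2 \<partial>lborel)) + ennreal (2 * m) * ennreal (e\<^sup>2 * sqn (wg u) * m)"
    using q by (intro add_left_mono mult_left_mono) auto
  also have "\<dots> = ennreal (2 * (\<integral>x. indicator \<Omega> x *\<^sub>R (a x)\<^sup>2 \<partial>lborel) + 2 * m * (e\<^sup>2 * sqn (wg u) * m))"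
    using m0 sqn_nonneg[of "wg u"] by (simp add: ennreal_plus ennreal_mult integral_nonneg_AE)
  finally have le: "ennreal (m\<^sup>2 * sqn (val u)) \<le>
      ennreal (2 * (\<integral>x. indicator \<Omega> x *\<^sub>R (a x)\<^sup>2 \<partial>lborel) + 2 * m * (e\<^sup>2 * sqn (wg u) * m))" .
  have "0 \<le> 2 * (\<integral>x. indicator \<Omega> x *\<^sub>R (a x)\<^sup>2 \<partial>lborel) + 2 * m * (e\<^sup>2 * sqn (wg u) * m)"
    using m0 sqn_nonneg[of "wg u"] nnA by simp
  from le[unfolded ennreal_le_iff[OF this]]
  show "m\<^sup>2 * sqn (val u) \<le> 2 * (\<integral>x. indicator \<Omega> x *\<^sub>R (a x)\<^sup>2 \<partial>lborel) + 2 * m\<^sup>2 * e\<^sup>2 * sqn (wg u)"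
    by (simp add: power2_eq_square mult_ac)
qed

text \<open>Integrals of \<open>z k\<close> over a fixed ball are bounded functionals and tend to
  zero at each centre; being uniformly bounded, they tend to zero in \<open>L2\<close> of the
  bounded domain. Replacing \<open>z k\<close> by its ball averages costs order
  \<open>e^2 * K\<close>, uniformly in \<open>k\<close>.\<close>

lemma Rellich:
  assumes z: "\<And>k. H10 \<Omega> (z k)" and weak: "\<And>v. H10 \<Omega> v \<Longrightarrow> (\<lambda>k. H1_inner \<Omega> (z k) v) \<longlonglongrightarrow> 0"
    and K: "\<And>k. sqn (wg (z k)) \<le> K"
  shows "(\<lambda>k. sqn (val (z k))) \<longlonglongrightarrow> 0"
proof -
  have K0: "K \<ge> 0" using sqn_nonneg K order_trans by blast
  obtain C where C: "C \<ge> 0" "\<And>u. H10 \<Omega> u \<Longrightarrow> sqn (val u) \<le> C * sqn (wg u)" using Poincare by blast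
  have vb: "sqn (val (z k)) \<le> C * K" for k
    using C(2)[OF z, of k] mult_left_mono[OF K[of k] C(1)] by linarith
  note L = H10_L2[OF z]
  have key: "\<forall>\<^sub>F k in sequentially. sqn (val (z k)) < d + 2 * e\<^sup>2 * K" if "e > 0" "d > 0" for d e
  proof -
    define m where "m = measure lborel (ball (0::'a) e)"
    let ?I = "indicator (ball (0::'a) e) :: 'a \<Rightarrow> real"
    define a where "a k x = (\<integral>y. ?I y *\<^sub>R val (z k) (y + x) \<partial>lborel)" for k x
    note est = ball_average_estimate[OF z that(1), folded m_def a_def]
    note LI = ball_indicator_L2(3)[where e=e and 'a='a] and sI = ball_indicator_L2(4)[where e=e and 'a='a, folded m_def]
    have m: "m > 0" unfolding m_def using content_ball_pos[OF that(1)] by simp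
    have lim: "(\<lambda>k. a k x) \<longlonglongrightarrow> 0" for x
    \<comment> \<open>The Gram matrix of the sequence itself: the weak hypothesis is tested with
      \<open>v = z j\<close> only, so the ball integral never has to be represented by an element of
      \<open>H10\<close>.\<close>
    proof (rule asymptotically_orthogonal_tendsto[where g="\<lambda>i j. H1_inner \<Omega> (z i) (z j)"])
      show "H1_inner \<Omega> (z i) (z j) = H1_inner \<Omega> (z j) (z i)" for i j
        by (simp add: H1_inner_eq[OF z z] ip_commute)
      show "H1_inner \<Omega> (z i) (z i) \<le> C * K + K" for i
        using vb[of i] K[of i] by (simp add: H1_inner_eq[OF z z] flip: sqn_eq_ip)
      show "(\<lambda>i. H1_inner \<Omega> (z i) (z j)) \<longlonglongrightarrow> 0" for j by (rule weak[OF z])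
      show "m \<ge> 0" using m by simp
      fix S :: "nat set" assume "finite S"
      let ?s = "\<lambda>y. \<Sum>i\<in>S. val (z i) y"
      have Ls: "L2 ?s" by (intro L2_sum L)
      have "(\<Sum>i\<in>S. a i x) = (\<Sum>i\<in>S. ip (\<lambda>y. val (z i) (y + x)) ?I)"
        by (simp add: a_def ip_def mult.commute)
      also have "\<dots> = ip (\<lambda>y. ?s (y + x)) ?I"
        using ip_sum_left[of S "\<lambda>i y. val (z i) (y + x)", OF L2_shift[OF L(1)] LI] by simp
      finally have "(\<Sum>i\<in>S. a i x)\<^sup>2 \<le> sqn (\<lambda>y. ?s (y + x)) * m"
        using ip_Cauchy_Schwarz[OF L2_shift[OF Ls] LI, of x] by (simp add: sI)
      also have "sqn (\<lambda>y. ?s (y + x)) = sqn ?s" by (rule sqn_shift[OF Ls])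
      also have "sqn ?s \<le> sqn ?s + sqn (\<lambda>y. \<Sum>i\<in>S. wg (z i) y)" using sqn_nonneg by simp
      also have "\<dots> = (\<Sum>i\<in>S. \<Sum>j\<in>S. H1_inner \<Omega> (z i) (z j))"
        by (simp add: sqn_sum L H1_inner_eq[OF z z] sum.distrib)
      finally show "(\<Sum>i\<in>S. a i x)\<^sup>2 \<le> m * (\<Sum>i\<in>S. \<Sum>j\<in>S. H1_inner \<Omega> (z i) (z j))"
        using m by (simp add: mult.commute)
    qed
    have [measurable]: "a k \<in> borel_measurable borel" for k by (rule est(1))
    have [measurable]: "\<Omega> \<in> sets borel" using open_dom by simp
    have "(\<lambda>k. \<integral>x. indicator \<Omega> x *\<^sub>R (a k x)\<^sup>2 \<partial>lborel) \<longlonglongrightarrow> (\<integral>x. 0 \<partial>(lborel::'a measure))"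
    proof (rule integral_dominated_convergence[where w="\<lambda>x. (m * (C * K)) * indicator \<Omega> x"])
      show "integrable lborel (\<lambda>x. (m * (C * K)) * indicator \<Omega> x :: real)"
        using emeasure_bounded_finite[OF bounded_dom]
        by (intro integrable_mult_right integrable_real_indicator) auto
      show "AE x in lborel. (\<lambda>k. indicator \<Omega> x *\<^sub>R (a k x)\<^sup>2) \<longlonglongrightarrow> 0"
      proof (rule AE_I2)
        fix x
        have "(\<lambda>k. indicator \<Omega> x *\<^sub>R (a k x)\<^sup>2) \<longlonglongrightarrow> indicator \<Omega> x *\<^sub>R 0\<^sup>2"
          by (intro tendsto_intros lim)
        then show "(\<lambda>k. indicator \<Omega> x *\<^sub>R (a k x)\<^sup>2) \<longlonglongrightarrow> 0" by simp
      qed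
      show "AE x in lborel. norm (indicator \<Omega> x *\<^sub>R (a k x)\<^sup>2) \<le> (m * (C * K)) * indicator \<Omega> x" for k
      proof (rule AE_I2)
        fix x
        have "(a k x)\<^sup>2 \<le> m * (C * K)"
          using est(2)[of k x] mult_left_mono[OF vb[of k], of m] m by linarith
        then show "norm (indicator \<Omega> x *\<^sub>R (a k x)\<^sup>2) \<le> (m * (C * K)) * indicator \<Omega> x"
          by (simp add: indicator_def)
      qed
    qed auto
    then have "(\<lambda>k. 2 / m\<^sup>2 * (\<integral>x. indicator \<Omega> x *\<^sub>R (a k x)\<^sup>2 \<partial>lborel)) \<longlonglongrightarrow> 2 / m\<^sup>2 * 0"
      by (intro tendsto_intros) simp
    from order_tendstoD(2)[OF this, of d] that(2)
    have "\<forall>\<^sub>F k in sequentially. 2 / m\<^sup>2 * (\<integral>x. indicator \<Omega> x *\<^sub>R (a k x)\<^sup>2 \<partial>lborel) < d" by simp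
    then show ?thesis
    proof (rule eventually_mono)
      fix k assume d: "2 / m\<^sup>2 * (\<integral>x. indicator \<Omega> x *\<^sub>R (a k x)\<^sup>2 \<partial>lborel) < d"
      have "m\<^sup>2 > 0" using m by simp
      then have "sqn (val (z k)) \<le> 2 / m\<^sup>2 * (\<integral>x. indicator \<Omega> x *\<^sub>R (a k x)\<^sup>2 \<partial>lborel) + 2 * e\<^sup>2 * sqn (wg (z k))"
        using est(3)[of k] by (simp add: field_simps)
      also have "2 * e\<^sup>2 * sqn (wg (z k)) \<le> 2 * e\<^sup>2 * K" using K by (intro mult_left_mono) auto
      finally show "sqn (val (z k)) < d + 2 * e\<^sup>2 * K" using d by simp
    qed
  qed
  show ?thesis
  proof (rule order_tendstoI)
    fix y :: real assume "y < 0"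
    then have "y < sqn (val (z k))" for k using sqn_nonneg[of "val (z k)"] by linarith
    then show "\<forall>\<^sub>F k in sequentially. y < sqn (val (z k))" by simp
  next
    fix y :: real assume y: "0 < y"
    \<comment> \<open>Makes the mollification error \<open>2 * e^2 * K\<close> at most
      \<open>y / 2\<close>; \<open>K + 1\<close> keeps the denominator positive.\<close>
    define e where "e = sqrt (y / (4 * (K + 1)))"
    have e: "e > 0" "e\<^sup>2 = y / (4 * (K + 1))" using y K0 by (auto simp: e_def)
    have "y / 2 + 2 * e\<^sup>2 * K \<le> y" unfolding e(2) using K0 y by (simp add: field_simps)
    with key[OF e(1), of "y / 2"] y show "\<forall>\<^sub>F k in sequentially. sqn (val (z k)) < y"
      by (auto elim!: eventually_mono)
  qed
qed

text \<open>Replace the gradient of \<open>v\<close> by a test gradient, with an error uniform in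
  \<open>k\<close> thanks to \<open>K\<close>; on the test gradient \<open>Green\<close> moves the
  derivative away and leaves the values of \<open>z k\<close>, which tend to zero.\<close>

lemma weak_gradient_tendsto_0:
  assumes z: "\<And>k. H10 \<Omega> (z k)" and lim: "(\<lambda>k. sqn (val (z k))) \<longlonglongrightarrow> 0"
    and K: "\<And>k. sqn (wg (z k)) \<le> K" and v: "H10 \<Omega> v"
  shows "(\<lambda>k. ip (wg (z k)) (wg v)) \<longlonglongrightarrow> 0"
proof (rule tendstoI)
  fix e :: real assume e: "e > 0"
  note L = H10_L2[OF z] and Lv = H10_L2[OF v]
  obtain \<psi> where \<psi>: "\<And>n. test_fn \<Omega> (\<psi> n)" "(\<lambda>n. sqn (\<lambda>x. grad (\<psi> n) x - wg v x)) \<longlonglongrightarrow> 0"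
    using H10_pair_wgrad[OF v] unfolding H10_pair_iff by blast
  from tendsto_mult[OF tendsto_const[of "sqrt K"] tendsto_real_sqrt[OF \<psi>(2)]]
  have "(\<lambda>n. sqrt K * sqrt (sqn (\<lambda>x. grad (\<psi> n) x - wg v x))) \<longlonglongrightarrow> 0" by simp
  from order_tendstoD(2)[OF this, of "e / 2"] e
  obtain n where n: "sqrt K * sqrt (sqn (\<lambda>x. grad (\<psi> n) x - wg v x)) < e / 2"
    by (auto simp: eventually_sequentially)
  note Lp = test_fn_L2_grad[OF \<psi>(1), of n]
  obtain h where h: "L2 h" "\<And>u g. H10_pair \<Omega> u g \<Longrightarrow> ip (ext0 \<Omega> g) (grad (\<psi> n)) = ip (val u) h"
    using Green[OF \<psi>(1)] by blast
  have "(\<lambda>k. ip (val (z k)) h) \<longlonglongrightarrow> 0" by (rule ip_null_tendsto[OF L(1) h(1) lim])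
  then have "(\<lambda>k. ip (wg (z k)) (grad (\<psi> n))) \<longlonglongrightarrow> 0"
    using h(2)[OF H10_pair_wgrad[OF z]] by simp
  from tendstoD[OF this, of "e / 2"] e
  have "\<forall>\<^sub>F k in sequentially. \<bar>ip (wg (z k)) (grad (\<psi> n))\<bar> < e / 2" by simp
  then show "\<forall>\<^sub>F k in sequentially. dist (ip (wg (z k)) (wg v)) 0 < e"
  proof (rule eventually_mono)
    fix k assume k: "\<bar>ip (wg (z k)) (grad (\<psi> n))\<bar> < e / 2"
    have "\<bar>ip (wg (z k)) (\<lambda>x. grad (\<psi> n) x - wg v x)\<bar> \<le>
        sqrt (sqn (wg (z k))) * sqrt (sqn (\<lambda>x. grad (\<psi> n) x - wg v x))"
      by (intro ip_abs_le L L2_diff Lp Lv)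
    also have "\<dots> \<le> sqrt K * sqrt (sqn (\<lambda>x. grad (\<psi> n) x - wg v x))"
      using K by (intro mult_right_mono) (auto simp: sqn_nonneg)
    finally have "\<bar>ip (wg (z k)) (grad (\<psi> n)) - ip (wg (z k)) (wg v)\<bar> < e / 2"
      using n by (simp add: ip_diff_right L Lp Lv)
    then show "dist (ip (wg (z k)) (wg v)) 0 < e" using k unfolding dist_real_def by linarith
  qed
qed

lemma sqn_wg_diff_le:
  assumes "H10 \<Omega> u" "H10 \<Omega> v"
  shows "sqn (wg (\<lambda>x. 1 * u x + (-1) * v x)) \<le> 2 * sqn (wg u) + 2 * sqn (wg v)"
proof -
  note d = H10_lincomb[OF assms, of 1 "-1"]
  have "sqn (wg (\<lambda>x. 1 * u x + (-1) * v x)) = sqn (\<lambda>x. wg u x - wg v x)"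
    using d(2) H10_L2(2)[OF d(1)] H10_L2(2)[OF assms(1)] H10_L2(2)[OF assms(2)]
    by (intro sqn_cong_AE) (auto dest!: L2_measurable)
  then show ?thesis using sqn_diff_le[OF H10_L2(2)[OF assms(1)] H10_L2(2)[OF assms(2)]] by simp
qed

lemma weak_conv_imp_L2_conv:
  assumes w: "H10_weak_conv \<Omega> us u" and K: "\<And>k. sqn (wg (us k)) \<le> K"
  shows "(\<lambda>k. sqn (\<lambda>x. val (us k) x - val u x)) \<longlonglongrightarrow> 0"
proof -
  let ?z = "\<lambda>k x. 1 * us k x + (-1) * u x"
  have H: "H10 \<Omega> (us k)" "H10 \<Omega> u" for k using w by (auto simp: H10_weak_conv_def)
  have "(\<lambda>k. sqn (val (?z k))) \<longlonglongrightarrow> 0"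
  proof (rule Rellich)
    show "H10 \<Omega> (?z k)" for k by (intro H10_lincomb H)
    show "(\<lambda>k. H1_inner \<Omega> (?z k) v) \<longlonglongrightarrow> 0" if v: "H10 \<Omega> v" for v
      using w v unfolding H1_inner_diff[OF H v] H10_weak_conv_def by (auto simp: LIM_zero_iff)
    show "sqn (wg (?z k)) \<le> 2 * K + 2 * sqn (wg u)" for k
      using sqn_wg_diff_le[OF H, of k] K[of k] by linarith
  qed
  moreover have "val (?z k) = (\<lambda>x. val (us k) x - val u x)" for k by (auto simp: ext0_def)
  ultimately show ?thesis by simp
qed

text \<open>Together with \<open>weak_conv_imp_L2_conv\<close>: among sequences with bounded
  gradients, weak convergence is convergence of the values in \<open>L2\<close>, a property that is
  stable under Lipschitz maps.\<close>

lemma weak_convI: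
  assumes H: "\<And>k. H10 \<Omega> (us k)" "H10 \<Omega> u" and K: "\<And>k. sqn (wg (us k)) \<le> K"
    and lim: "(\<lambda>k. sqn (\<lambda>x. val (us k) x - val u x)) \<longlonglongrightarrow> 0"
  shows "H10_weak_conv \<Omega> us u"
  unfolding H10_weak_conv_def
proof (intro conjI allI impI H)
  fix v assume v: "H10 \<Omega> v"
  let ?z = "\<lambda>k x. 1 * us k x + (-1) * u x"
  have z: "H10 \<Omega> (?z k)" for k by (intro H10_lincomb H)
  have "val (?z k) = (\<lambda>x. val (us k) x - val u x)" for k by (auto simp: ext0_def)
  with lim have lim': "(\<lambda>k. sqn (val (?z k))) \<longlonglongrightarrow> 0" by simp
  have "sqn (wg (?z k)) \<le> 2 * K + 2 * sqn (wg u)" for k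
    using sqn_wg_diff_le[OF H, of k] K[of k] by linarith
  from weak_gradient_tendsto_0[OF z lim' this v] ip_null_tendsto[OF H10_L2(1)[OF z] H10_L2(1)[OF v] lim']
  have "(\<lambda>k. H1_inner \<Omega> (?z k) v) \<longlonglongrightarrow> 0 + 0"
    unfolding H1_inner_eq[OF z v] by (intro tendsto_add)
  then show "(\<lambda>k. H1_inner \<Omega> (us k) v) \<longlonglongrightarrow> H1_inner \<Omega> u v"
    unfolding H1_inner_diff[OF H v] by (simp add: LIM_zero_iff)
qed

end

subsection \<open>Quadratic forms satisfying the parallelogram law\<close>

text \<open>Cauchy's functional equation. Writing \<open>n * c\<close> as an integer plus a
  remainder in \<open>[0, 1]\<close> bounds \<open>n * |h c - c * h 1|\<close> independently of
  \<open>n\<close>.\<close>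

lemma additive_locally_bounded_linear:
  fixes h :: "real \<Rightarrow> real"
  assumes add: "\<And>s t. h (s + t) = h s + h t" and bound: "\<And>s. \<bar>s\<bar> \<le> 1 \<Longrightarrow> \<bar>h s\<bar> \<le> K"
  shows "h c = c * h 1"
proof -
  have h0: "h 0 = 0" using add[of 0 0] by simp
  have neg: "h (- s) = - h s" for s using add[of s "- s"] h0 by simp
  have nat: "h (real n * s) = real n * h s" for n s
    by (induction n) (auto simp: h0 distrib_right add)
  have int: "h (of_int i * s) = of_int i * h s" for i s
  proof (cases i rule: int_cases2)
    case (nonneg n)
    then show ?thesis using nat by simp
  next
    case (nonpos n)
    then show ?thesis using nat[of n s] neg[of "real n * s"] by simp
  qed
  have le: "real n * \<bar>h c - c * h 1\<bar> \<le> K + \<bar>h 1\<bar>" for n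
  proof -
    define m where "m = \<lfloor>real n * c\<rfloor>"
    define r where "r = real n * c - of_int m"
    have r: "0 \<le> r" "r \<le> 1" unfolding r_def m_def by linarith+
    have "real n * h c = h (r + of_int m * 1)" using nat[of n c] by (simp add: r_def)
    also have "\<dots> = h r + of_int m * h 1" using add int by metis
    finally have "real n * (h c - c * h 1) = h r - r * h 1" by (simp add: r_def algebra_simps)
    then have "real n * \<bar>h c - c * h 1\<bar> = \<bar>h r - r * h 1\<bar>" by (metis abs_mult abs_of_nat)
    also have "\<dots> \<le> \<bar>h r\<bar> + \<bar>r * h 1\<bar>" by (rule abs_triangle_ineq4)
    also have "\<dots> \<le> K + \<bar>h 1\<bar>"
      using bound[of r] r by (intro add_mono) (auto simp: abs_mult intro: mult_left_le_one_le)
    finally show ?thesis .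
  qed
  have "\<bar>h c - c * h 1\<bar> = 0"
  proof (rule ccontr)
    assume "\<bar>h c - c * h 1\<bar> \<noteq> 0"
    then have pos: "\<bar>h c - c * h 1\<bar> > 0" by simp
    obtain n :: nat where "real n > (K + \<bar>h 1\<bar>) / \<bar>h c - c * h 1\<bar>" using reals_Archimedean2 by blast
    then show False using le[of n] pos by (simp add: field_simps)
  qed
  then show ?thesis by simp
qed

locale quadratic_form =
  fixes V :: "('x \<Rightarrow> real) \<Rightarrow> bool" and Q :: "('x \<Rightarrow> real) \<Rightarrow> real"
  assumes V_add: "V u \<Longrightarrow> V v \<Longrightarrow> V (\<lambda>x. u x + v x)"
    and V_cmult: "V u \<Longrightarrow> V (\<lambda>x. c * u x)"
    and V_zero: "V (\<lambda>x. 0)"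
    and Q_nonneg: "V u \<Longrightarrow> 0 \<le> Q u"
    and Q_cmult: "V u \<Longrightarrow> Q (\<lambda>x. c * u x) = c\<^sup>2 * Q u"
    and parallelogram: "V u \<Longrightarrow> V v \<Longrightarrow> Q (\<lambda>x. u x + v x) + Q (\<lambda>x. u x - v x) = 2 * Q u + 2 * Q v"
begin

lemma V_diff: "V u \<Longrightarrow> V v \<Longrightarrow> V (\<lambda>x. u x - v x)"
  using V_add[of u "\<lambda>x. (-1) * v x"] V_cmult[of v "-1"] by simp

lemma V_sum: "(\<And>i. i \<in> I \<Longrightarrow> V (f i)) \<Longrightarrow> V (\<lambda>x. \<Sum>i\<in>I. f i x)"
  by (induction I rule: infinite_finite_induct) (auto intro: V_zero V_add)

lemma Q_uminus: "V u \<Longrightarrow> Q (\<lambda>x. - u x) = Q u"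
  using Q_cmult[of u "-1"] by simp

lemma Q_diff_commute: "V u \<Longrightarrow> V v \<Longrightarrow> Q (\<lambda>x. u x - v x) = Q (\<lambda>x. v x - u x)"
  using Q_uminus[OF V_diff[of u v]] by simp

definition B :: "('x \<Rightarrow> real) \<Rightarrow> ('x \<Rightarrow> real) \<Rightarrow> real" where
  "B u v = (Q (\<lambda>x. u x + v x) - Q (\<lambda>x. u x - v x)) / 4"

lemma B_commute: "V u \<Longrightarrow> V v \<Longrightarrow> B u v = B v u"
  using Q_diff_commute[of u v] by (simp add: B_def add.commute)

lemma Q_add: "V u \<Longrightarrow> V v \<Longrightarrow> Q (\<lambda>x. u x + v x) = Q u + 2 * B u v + Q v"
  using parallelogram[of u v] by (simp add: B_def field_simps)

lemma Q_diff: "V u \<Longrightarrow> V v \<Longrightarrow> Q (\<lambda>x. u x - v x) = Q u - 2 * B u v + Q v"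
  using parallelogram[of u v] by (simp add: B_def field_simps)

lemma B_self: assumes "V u" shows "B u u = Q u"
proof -
  have "Q (\<lambda>x. u x + u x) = 4 * Q u" using Q_cmult[OF assms, of 2] by simp
  moreover have "Q (\<lambda>x. u x - u x) = 0" using Q_cmult[OF assms, of 0] by simp
  ultimately show ?thesis by (simp add: B_def)
qed

text \<open>The Jordan-von Neumann argument: three instances of the parallelogram law, two added and
  one subtracted. On the right all terms but the first two are even in \<open>v\<close>, so they
  cancel in the polar form \<open>B\<close>, which leaves additivity.\<close>

lemma Q_add3:
  assumes "V u" "V w" "V v"
  shows "Q (\<lambda>x. u x + w x + v x) =
    Q (\<lambda>x. u x + v x) + Q (\<lambda>x. w x + v x) + Q u + Q w - Q (\<lambda>x. u x - w x) - Q v"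
proof -
  have "Q (\<lambda>x. (u x + v x) + w x) + Q (\<lambda>x. (u x + v x) - w x) = 2 * Q (\<lambda>x. u x + v x) + 2 * Q w"
    by (intro parallelogram V_add assms)
  moreover have "Q (\<lambda>x. (w x + v x) + u x) + Q (\<lambda>x. (w x + v x) - u x) = 2 * Q (\<lambda>x. w x + v x) + 2 * Q u"
    by (intro parallelogram V_add assms)
  moreover have "Q (\<lambda>x. (u x - w x) + v x) + Q (\<lambda>x. (u x - w x) - v x) = 2 * Q (\<lambda>x. u x - w x) + 2 * Q v"
    by (intro parallelogram V_diff assms)
  moreover have "Q (\<lambda>x. (w x + v x) - u x) = Q (\<lambda>x. (u x - w x) - v x)"
    using Q_uminus[OF V_diff[OF V_diff[OF assms(1,2)] assms(3)]] by (simp add: algebra_simps)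
  moreover have "(\<lambda>x. (u x + v x) + w x) = (\<lambda>x. u x + w x + v x)" "(\<lambda>x. (w x + v x) + u x) = (\<lambda>x. u x + w x + v x)"
    "(\<lambda>x. (u x + v x) - w x) = (\<lambda>x. (u x - w x) + v x)" by (auto simp: algebra_simps)
  ultimately show ?thesis by simp
qed

lemma B_add_left:
  assumes "V u" "V w" "V v" shows "B (\<lambda>x. u x + w x) v = B u v + B w v"
proof -
  have Vn: "V (\<lambda>x. - v x)" using V_cmult[OF assms(3), of "-1"] by simp
  show ?thesis
    using Q_add3[OF assms] Q_add3[OF assms(1,2) Vn] Q_uminus[OF assms(3)] by (simp add: B_def field_simps)
qed

lemma B_abs_le: "V u \<Longrightarrow> V v \<Longrightarrow> \<bar>B u v\<bar> \<le> (Q u + Q v) / 2"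
  using Q_nonneg[OF V_add[of u v]] Q_nonneg[OF V_diff[of u v]] Q_add[of u v] Q_diff[of u v] by force

text \<open>Additivity by itself gives rational factors only; \<open>B_abs_le\<close> supplies the
  local bound that extends it to real ones.\<close>

lemma B_cmult_left:
  assumes "V u" "V v" shows "B (\<lambda>x. c * u x) v = c * B u v"
proof -
  have "B (\<lambda>x. c * u x) v = c * B (\<lambda>x. 1 * u x) v"
  proof (rule additive_locally_bounded_linear)
    show "B (\<lambda>x. (s + t) * u x) v = B (\<lambda>x. s * u x) v + B (\<lambda>x. t * u x) v" for s t
      using B_add_left[OF V_cmult[OF assms(1)] V_cmult[OF assms(1)] assms(2), of s t] by (simp add: distrib_right)
    show "\<bar>B (\<lambda>x. s * u x) v\<bar> \<le> (Q u + Q v) / 2" if "\<bar>s\<bar> \<le> 1" for s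
    proof -
      have "s\<^sup>2 \<le> 1" using that by (simp add: abs_square_le_1)
      then have "s\<^sup>2 * Q u \<le> Q u" using mult_right_mono[of "s\<^sup>2" 1 "Q u"] Q_nonneg[OF assms(1)] by simp
      then show ?thesis
        using B_abs_le[OF V_cmult[OF assms(1)] assms(2), of s] by (simp add: Q_cmult assms)
    qed
  qed
  then show ?thesis by simp
qed

lemma B_sum_left:
  assumes "\<And>i. i \<in> I \<Longrightarrow> V (f i)" "V v"
  shows "B (\<lambda>x. \<Sum>i\<in>I. c i * f i x) v = (\<Sum>i\<in>I. c i * B (f i) v)"
  using assms(1)
proof (induction I rule: infinite_finite_induct)
  case (insert i I)
  then show ?case
    by (simp add: B_add_left[OF V_cmult V_sum assms(2)] V_cmult B_cmult_left assms(2))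
qed (use B_cmult_left[OF V_zero assms(2), of 0] in auto)

lemma Q_sum:
  assumes "\<And>i. i \<in> I \<Longrightarrow> V (f i)"
  shows "Q (\<lambda>x. \<Sum>i\<in>I. c i * f i x) = (\<Sum>i\<in>I. \<Sum>j\<in>I. c i * c j * B (f i) (f j))"
proof -
  let ?s = "\<lambda>x. \<Sum>i\<in>I. c i * f i x"
  have Vs: "V ?s" using assms by (intro V_sum V_cmult)
  have "Q ?s = (\<Sum>i\<in>I. c i * B (f i) ?s)"
    using B_sum_left[of I f ?s c, OF assms Vs] B_self[OF Vs] by simp
  also have "\<dots> = (\<Sum>i\<in>I. \<Sum>j\<in>I. c i * c j * B (f i) (f j))"
  proof (intro sum.cong refl)
    fix i assume i: "i \<in> I"
    have "B (f i) ?s = (\<Sum>j\<in>I. c j * B (f i) (f j))"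
      using B_sum_left[of I f "f i" c, OF assms assms[OF i]] B_commute[OF assms[OF i] Vs]
        B_commute[OF assms[OF i] assms] by simp
    then show "c i * B (f i) ?s = (\<Sum>j\<in>I. c i * c j * B (f i) (f j))"
      by (simp add: sum_distrib_left mult.assoc)
  qed
  finally show ?thesis .
qed

lemma B_Cauchy_Schwarz:
  assumes "V u" "V v" shows "(B u v)\<^sup>2 \<le> Q u * Q v"
proof -
  have t: "0 \<le> Q u - 2 * t * B u v + t\<^sup>2 * Q v" for t
    using Q_nonneg[OF V_diff[OF assms(1) V_cmult[OF assms(2)]], of t]
      Q_diff[OF assms(1) V_cmult[OF assms(2)], of t] B_commute[OF assms(1) V_cmult[OF assms(2)], of t]
      B_commute[OF assms] by (simp add: B_cmult_left Q_cmult assms)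
  show ?thesis
  proof (cases "Q v = 0")
    case True
    have "B u v = 0"
    proof (rule ccontr)
      assume "B u v \<noteq> 0"
      with t[of "(Q u + 1) / (2 * B u v)"] True Q_nonneg[OF assms(1)] show False by simp
    qed
    then show ?thesis by (simp add: True)
  next
    case False
    then have "Q v > 0" using Q_nonneg[OF assms(2)] by simp
    with t[of "B u v / Q v"] show ?thesis by (simp add: field_simps power2_eq_square)
  qed
qed

lemma Q_tendsto:
  assumes "\<And>n. V (f n)" "V u" "(\<lambda>n. Q (\<lambda>x. f n x - u x)) \<longlonglongrightarrow> 0"
  shows "(\<lambda>n. Q (f n)) \<longlonglongrightarrow> Q u"
proof -
  let ?d = "\<lambda>n x. f n x - u x"
  have Vd: "V (?d n)" for n by (intro V_diff assms)
  have eq: "Q (f n) = Q u + 2 * B u (?d n) + Q (?d n)" for n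
    using Q_add[OF assms(2) Vd, of n] by simp
  have "(\<lambda>n. B u (?d n)) \<longlonglongrightarrow> 0"
  proof (rule Lim_null_comparison[OF eventuallyI])
    show "norm (B u (?d n)) \<le> sqrt (Q u) * sqrt (Q (?d n))" for n
      using real_sqrt_le_mono[OF B_Cauchy_Schwarz[OF assms(2) Vd]] by (simp add: real_sqrt_mult)
    show "(\<lambda>n. sqrt (Q u) * sqrt (Q (?d n))) \<longlonglongrightarrow> 0"
      using tendsto_mult[OF tendsto_const tendsto_real_sqrt[OF assms(3)]] by simp
  qed
  then show ?thesis unfolding eq using assms(3) by (auto intro!: tendsto_eq_intros)
qed

text \<open>Choosing the signs one at a time, the one not decreasing the form.\<close>

lemma exists_signs:
  assumes "finite I" "\<And>i. i \<in> I \<Longrightarrow> V (f i)"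
  shows "\<exists>s. (\<forall>i. s i = 1 \<or> s i = (-1::real)) \<and> (\<Sum>i\<in>I. Q (f i)) \<le> Q (\<lambda>x. \<Sum>i\<in>I. s i * f i x)"
  using assms
proof (induction I)
  case empty
  show ?case by (intro exI[of _ "\<lambda>_. 1"]) (simp add: Q_nonneg V_zero)
next
  case (insert k I)
  then obtain s where s: "\<And>i. s i = 1 \<or> s i = (-1::real)"
    "(\<Sum>i\<in>I. Q (f i)) \<le> Q (\<lambda>x. \<Sum>i\<in>I. s i * f i x)" by auto
  let ?v = "\<lambda>x. \<Sum>i\<in>I. s i * f i x"
  have V: "V ?v" "V (f k)" using insert.prems by (auto intro!: V_sum V_cmult)
  define t where "t = (if B ?v (f k) \<ge> 0 then 1 else -1 :: real)"
  have t: "t = 1 \<or> t = -1" "t * B ?v (f k) \<ge> 0" by (auto simp: t_def)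
  have "Q (\<lambda>x. ?v x + t * f k x) = Q ?v + 2 * t * B ?v (f k) + Q (f k)"
    using t(1) by (elim disjE) (simp_all add: Q_add[OF V] Q_diff[OF V])
  with t(2) s(2) have ge: "Q (f k) + (\<Sum>i\<in>I. Q (f i)) \<le> Q (\<lambda>x. ?v x + t * f k x)" by linarith
  have "(\<lambda>x. ?v x + t * f k x) = (\<lambda>x. \<Sum>i\<in>insert k I. (s(k := t)) i * f i x)"
  proof
    fix x
    have "(\<Sum>i\<in>I. (s(k := t)) i * f i x) = ?v x"
      using insert.hyps(2) by (intro sum.cong) auto
    then show "?v x + t * f k x = (\<Sum>i\<in>insert k I. (s(k := t)) i * f i x)"
      using insert.hyps by simp
  qed
  with ge insert.hyps show ?case
    using s(1) t(1) by (intro exI[of _ "s(k := t)"]) auto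
qed

end

subsection \<open>The Gamma-limit\<close>

lemma ennreal_quad_identity:
  fixes p q A :: real assumes "A \<ge> 0"
  shows "ennreal ((p + q)\<^sup>2 * A) + ennreal ((p - q)\<^sup>2 * A) = 2 * ennreal (p\<^sup>2 * A) + 2 * ennreal (q\<^sup>2 * A)"
proof -
  have "(p + q)\<^sup>2 * A + (p - q)\<^sup>2 * A = 2 * (p\<^sup>2 * A) + 2 * (q\<^sup>2 * A)"
    by (simp add: power2_eq_square algebra_simps)
  then have "ennreal ((p + q)\<^sup>2 * A) + ennreal ((p - q)\<^sup>2 * A) = ennreal (2 * (p\<^sup>2 * A) + 2 * (q\<^sup>2 * A))"
    using assms by (metis ennreal_plus mult_nonneg_nonneg zero_le_power2)
  also have "\<dots> = ennreal 2 * ennreal (p\<^sup>2 * A) + ennreal 2 * ennreal (q\<^sup>2 * A)"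
    using assms by (simp add: ennreal_plus ennreal_mult)
  finally show ?thesis by simp
qed

locale gamma_limit = bounded_domain \<Omega> for \<Omega> :: "'a::euclidean_space set" +
  fixes M :: real and a :: "nat \<Rightarrow> 'a \<times> 'a \<Rightarrow> real" and F :: "('a \<Rightarrow> real) \<Rightarrow> ennreal"
  assumes M: "M > 0"
    and a_int: "\<And>k. set_integrable lborel (\<Omega> \<times> \<Omega>) (a k)"
    and a_nonneg: "\<And>k z. z \<in> \<Omega> \<times> \<Omega> \<Longrightarrow> a k z \<ge> 0"
    and a_le: "\<And>k. (LINT z:\<Omega> \<times> \<Omega>|lborel. a k z) \<le> M"
    and Gamma: "Gamma_conv_weak_H10 \<Omega> (\<lambda>k. Fk_fun \<Omega> (a k)) F"
begin

text \<open>The kernel set to zero off \<open>\<Omega> \<times> \<Omega>\<close>, so that sign and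
  integrability hold on the whole product space.\<close>

definition A :: "nat \<Rightarrow> 'a \<times> 'a \<Rightarrow> real" where
  "A k z = indicator (\<Omega> \<times> \<Omega>) z *\<^sub>R a k z"

definition jump :: "nat \<Rightarrow> ('a \<Rightarrow> real) \<Rightarrow> ennreal" where
  "jump k u = (\<integral>\<^sup>+z. ennreal ((u (fst z) - u (snd z))\<^sup>2 * A k z) \<partial>lborel)"

definition Fa :: "nat \<Rightarrow> ('a \<Rightarrow> real) \<Rightarrow> ennreal" where
  "Fa k = Fk_fun \<Omega> (a k)"

lemma A_integrable: "integrable lborel (A k)"
  using a_int[of k] unfolding set_integrable_def A_def[abs_def] .

lemma A_measurable [measurable]: "A k \<in> borel_measurable borel"
  using A_integrable[of k] by auto

lemma A_nonneg: "A k z \<ge> 0"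
  using a_nonneg[of z k] by (auto simp: A_def indicator_def)

lemma nn_integral_A: "(\<integral>\<^sup>+z. ennreal (A k z) \<partial>lborel) \<le> ennreal M"
proof -
  have "(\<integral>\<^sup>+z. ennreal (A k z) \<partial>lborel) = ennreal (\<integral>z. A k z \<partial>lborel)"
    by (rule nn_integral_eq_integral) (auto simp: A_integrable A_nonneg)
  then show ?thesis using a_le[of k] by (simp add: set_lebesgue_integral_def A_def ennreal_leI)
qed

lemma fst_snd_measurable [measurable]:
  "fst \<in> borel_measurable (borel :: ('a \<times> 'a) measure)" "snd \<in> borel_measurable (borel :: ('a \<times> 'a) measure)"
  by (auto intro!: borel_measurable_continuous_onI continuous_intros)

lemma nn_integral_wgrad:
  assumes "H10 \<Omega> u"
  shows "(\<integral>\<^sup>+x\<in>\<Omega>. ennreal ((norm (wgrad \<Omega> u x))\<^sup>2) \<partial>lborel) = ennreal (sqn (wg u))"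
proof -
  have "(\<integral>\<^sup>+x\<in>\<Omega>. ennreal ((norm (wgrad \<Omega> u x))\<^sup>2) \<partial>lborel) = (\<integral>\<^sup>+x. ennreal ((norm (wg u x))\<^sup>2) \<partial>lborel)"
    by (intro nn_integral_cong) (auto simp: ext0_def)
  then show ?thesis using nn_integral_sqn[OF H10_L2(2)[OF assms]] by simp
qed

lemma Fa_eq: "H10 \<Omega> u \<Longrightarrow> Fa k u = jump k u + ennreal (sqn (wg u))"
proof -
  assume u: "H10 \<Omega> u"
  have "(\<integral>\<^sup>+z\<in>\<Omega>\<times>\<Omega>. ennreal ((u (fst z) - u (snd z))\<^sup>2 * a k z) \<partial>lborel) = jump k u"
    unfolding jump_def by (intro nn_integral_cong) (auto simp: A_def indicator_def)
  then show ?thesis unfolding Fa_def Fk_fun_def nn_integral_wgrad[OF u] by simp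
qed

lemma jump_parallelogram:
  assumes [measurable]: "u \<in> borel_measurable borel" "v \<in> borel_measurable borel"
  shows "jump k (\<lambda>x. u x + v x) + jump k (\<lambda>x. u x - v x) = 2 * jump k u + 2 * jump k v"
proof -
  let ?p = "\<lambda>z. u (fst z) - u (snd z)" and ?q = "\<lambda>z. v (fst z) - v (snd z)"
  have "jump k (\<lambda>x. u x + v x) + jump k (\<lambda>x. u x - v x) =
     (\<integral>\<^sup>+z. ennreal ((?p z + ?q z)\<^sup>2 * A k z) + ennreal ((?p z - ?q z)\<^sup>2 * A k z) \<partial>lborel)"
    unfolding jump_def by (subst nn_integral_add[symmetric]) (auto simp: algebra_simps)
  also have "\<dots> = (\<integral>\<^sup>+z. 2 * ennreal ((?p z)\<^sup>2 * A k z) + 2 * ennreal ((?q z)\<^sup>2 * A k z) \<partial>lborel)"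
    using ennreal_quad_identity[OF A_nonneg] by (intro nn_integral_cong) auto
  also have "\<dots> = 2 * jump k u + 2 * jump k v"
    unfolding jump_def by (simp add: nn_integral_add nn_integral_cmult)
  finally show ?thesis .
qed

lemma jump_cmult:
  assumes [measurable]: "u \<in> borel_measurable borel"
  shows "jump k (\<lambda>x. c * u x) = ennreal (c\<^sup>2) * jump k u"
proof -
  have "ennreal ((c * u (fst z) - c * u (snd z))\<^sup>2 * A k z) = ennreal (c\<^sup>2) * ennreal ((u (fst z) - u (snd z))\<^sup>2 * A k z)" for z
  proof -
    have "(c * u (fst z) - c * u (snd z))\<^sup>2 * A k z = c\<^sup>2 * ((u (fst z) - u (snd z))\<^sup>2 * A k z)"
      by (simp add: power2_eq_square algebra_simps)
    then show ?thesis using A_nonneg[of k z] ennreal_mult[of "c\<^sup>2" "(u (fst z) - u (snd z))\<^sup>2 * A k z"]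
      by (metis mult_nonneg_nonneg zero_le_power2)
  qed
  then show ?thesis unfolding jump_def by (simp add: nn_integral_cmult)
qed

lemma jump_le:
  assumes "\<And>x y. \<bar>v x - v y\<bar> \<le> \<bar>u x - u y\<bar>"
  shows "jump k v \<le> jump k u"
  unfolding jump_def
  by (intro nn_integral_mono ennreal_leI mult_right_mono A_nonneg) (use assms abs_le_square_iff in auto)

lemma jump_le_osc:
  assumes "\<And>x y. \<bar>u x - u y\<bar> \<le> c"
  shows "jump k u \<le> ennreal (c\<^sup>2 * M)"
proof -
  have sq: "(u x - u y)\<^sup>2 \<le> c\<^sup>2" for x y
    using power_mono[OF assms[of x y] abs_ge_zero, of 2] by simp
  have "jump k u \<le> (\<integral>\<^sup>+z. ennreal (c\<^sup>2) * ennreal (A k z) \<partial>lborel)"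
    unfolding jump_def
    by (intro nn_integral_mono) (auto simp: ennreal_mult[symmetric] A_nonneg intro!: ennreal_leI mult_right_mono sq)
  also have "\<dots> = ennreal (c\<^sup>2) * (\<integral>\<^sup>+z. ennreal (A k z) \<partial>lborel)" by (intro nn_integral_cmult) simp
  also have "\<dots> \<le> ennreal (c\<^sup>2) * ennreal M" by (intro mult_left_mono nn_integral_A) auto
  also have "\<dots> = ennreal (c\<^sup>2 * M)" using M by (simp add: ennreal_mult)
  finally show ?thesis .
qed

lemma H10_add: assumes "H10 \<Omega> u" "H10 \<Omega> v"
  shows "H10 \<Omega> (\<lambda>x. u x + v x)" "H10 \<Omega> (\<lambda>x. u x - v x)"
    "sqn (wg (\<lambda>x. u x + v x)) + sqn (wg (\<lambda>x. u x - v x)) = 2 * sqn (wg u) + 2 * sqn (wg v)"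
proof -
  note p = H10_lincomb[OF assms, of 1 1, simplified] and m = H10_lincomb[OF assms, of 1 "-1", simplified]
  show "H10 \<Omega> (\<lambda>x. u x + v x)" "H10 \<Omega> (\<lambda>x. u x - v x)" by (fact p(1) m(1))+
  note L = H10_L2(2)[OF assms(1)] H10_L2(2)[OF assms(2)] H10_L2(2)[OF p(1)] H10_L2(2)[OF m(1)]
  have "sqn (wg (\<lambda>x. u x + v x)) = sqn (\<lambda>x. wg u x + wg v x)"
    using p(2) L by (intro sqn_cong_AE) (auto dest!: L2_measurable)
  moreover have "sqn (wg (\<lambda>x. u x - v x)) = sqn (\<lambda>x. wg u x - wg v x)"
    using m(2) L by (intro sqn_cong_AE) (auto dest!: L2_measurable)
  ultimately show "sqn (wg (\<lambda>x. u x + v x)) + sqn (wg (\<lambda>x. u x - v x)) = 2 * sqn (wg u) + 2 * sqn (wg v)"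
    by (simp add: sqn_add sqn_diff L)
qed

lemma H10_cmult: assumes "H10 \<Omega> u"
  shows "H10 \<Omega> (\<lambda>x. c * u x)" "sqn (wg (\<lambda>x. c * u x)) = c\<^sup>2 * sqn (wg u)"
proof -
  note p = H10_lincomb[OF assms assms, of c 0, simplified]
  show "H10 \<Omega> (\<lambda>x. c * u x)" by (fact p(1))
  have "sqn (wg (\<lambda>x. c * u x)) = sqn (\<lambda>x. c *\<^sub>R wg u x)"
    using p(2) H10_L2(2)[OF assms] H10_L2(2)[OF p(1)] by (intro sqn_cong_AE) (auto dest!: L2_measurable)
  then show "sqn (wg (\<lambda>x. c * u x)) = c\<^sup>2 * sqn (wg u)" by (simp add: sqn_scaleR)
qed

lemma Fa_parallelogram:
  assumes "H10 \<Omega> u" "H10 \<Omega> v"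
  shows "Fa k (\<lambda>x. u x + v x) + Fa k (\<lambda>x. u x - v x) = 2 * Fa k u + 2 * Fa k v"
proof -
  note h = H10_add[OF assms]
  have "ennreal (sqn (wg (\<lambda>x. u x + v x))) + ennreal (sqn (wg (\<lambda>x. u x - v x))) =
     ennreal (2 * sqn (wg u) + 2 * sqn (wg v))"
    using h(3) by (simp add: sqn_nonneg flip: ennreal_plus)
  also have "\<dots> = ennreal 2 * ennreal (sqn (wg u)) + ennreal 2 * ennreal (sqn (wg v))"
    by (simp add: sqn_nonneg ennreal_mult)
  finally have "ennreal (sqn (wg (\<lambda>x. u x + v x))) + ennreal (sqn (wg (\<lambda>x. u x - v x))) =
     2 * ennreal (sqn (wg u)) + 2 * ennreal (sqn (wg v))" by simp
  with jump_parallelogram[OF assms[THEN H10_measurable], of k] show ?thesis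
    unfolding Fa_eq[OF h(1)] Fa_eq[OF h(2)] Fa_eq[OF assms(1)] Fa_eq[OF assms(2)]
    by (simp add: algebra_simps)
qed

lemma Fa_cmult:
  assumes "H10 \<Omega> u" shows "Fa k (\<lambda>x. c * u x) = ennreal (c\<^sup>2) * Fa k u"
  unfolding Fa_eq[OF H10_cmult(1)[OF assms]] Fa_eq[OF assms]
  by (simp add: jump_cmult[OF H10_measurable[OF assms]] H10_cmult(2)[OF assms] sqn_nonneg ennreal_mult distrib_left)

lemma weak_conv_lincomb:
  assumes "H10_weak_conv \<Omega> us u" "H10_weak_conv \<Omega> vs v"
  shows "H10_weak_conv \<Omega> (\<lambda>k x. c * us k x + d * vs k x) (\<lambda>x. c * u x + d * v x)"
proof -
  have H: "H10 \<Omega> (us k)" "H10 \<Omega> u" "H10 \<Omega> (vs k)" "H10 \<Omega> v" for k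
    using assms by (auto simp: H10_weak_conv_def)
  show ?thesis unfolding H10_weak_conv_def
  proof (intro conjI allI impI)
    fix w assume w: "H10 \<Omega> w"
    show "(\<lambda>n. H1_inner \<Omega> (\<lambda>x. c * us n x + d * vs n x) w) \<longlonglongrightarrow> H1_inner \<Omega> (\<lambda>x. c * u x + d * v x) w"
      unfolding H1_inner_lincomb[OF H(1,3) w] H1_inner_lincomb[OF H(2,4) w]
      using assms w by (intro tendsto_intros) (auto simp: H10_weak_conv_def)
  qed (intro H10_lincomb H)+
qed

lemma weak_conv_const: "H10 \<Omega> u \<Longrightarrow> H10_weak_conv \<Omega> (\<lambda>k. u) u"
  by (simp add: H10_weak_conv_def)

lemma F_le_liminf: "H10_weak_conv \<Omega> us u \<Longrightarrow> F u \<le> liminf (\<lambda>k. Fa k (us k))"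
  using Gamma unfolding Gamma_conv_weak_H10_def Fa_def by blast

text \<open>\<open>enn2real\<close> sends infinity to \<open>0\<close>, so \<open>Fr\<close>
  represents \<open>F\<close> only where \<open>F\<close> is finite, in particular on test
  functions.\<close>

definition Fr :: "('a \<Rightarrow> real) \<Rightarrow> real" where "Fr u = enn2real (F u)"

lemma F_finite_iff: "F u < \<infinity> \<longleftrightarrow> F u = ennreal (Fr u)"
  unfolding Fr_def by (cases "F u") auto

lemma Fr_nonneg: "Fr u \<ge> 0" by (simp add: Fr_def)

text \<open>The liminf inequality in a form that can be combined with others at a common index. The
  slack is added on the side of \<open>Fa\<close>, since subtraction in \<open>ennreal\<close>
  truncates.\<close>

lemma lower_bound:
  assumes "H10_weak_conv \<Omega> us u" "F u < \<infinity>" "e > 0"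
  shows "\<forall>\<^sub>F k in sequentially. ennreal (Fr u) \<le> Fa k (us k) + ennreal e"
proof (cases "Fr u < e")
  case True
  then have "ennreal (Fr u) \<le> ennreal e" by (intro ennreal_leI) simp
  then show ?thesis by (intro always_eventually allI) (meson add_increasing zero_le)
next
  case False
  have "ennreal (Fr u - e) < F u"
    using assms(3) False unfolding assms(2)[unfolded F_finite_iff] by (simp add: ennreal_less_iff)
  then have "ennreal (Fr u - e) < liminf (\<lambda>k. Fa k (us k))" using F_le_liminf[OF assms(1)] by (rule less_le_trans)
  then have "\<forall>\<^sub>F k in sequentially. ennreal (Fr u - e) < Fa k (us k)" by (rule less_LiminfD)
  then show ?thesis
  proof (rule eventually_mono)
    fix k assume "ennreal (Fr u - e) < Fa k (us k)"
    then have "ennreal (Fr u - e) + ennreal e \<le> Fa k (us k) + ennreal e" by (intro add_right_mono) simp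
    then show "ennreal (Fr u) \<le> Fa k (us k) + ennreal e"
      using False assms(3) by (simp flip: ennreal_plus)
  qed
qed

text \<open>Besides near-optimality it yields a gradient bound for all \<open>k\<close>, which
  Rellich's theorem asks for: the energy controls the gradients eventually, and the finitely many
  other terms are finite.\<close>

lemma recovery:
  assumes u: "H10 \<Omega> u" and fin: "F u < \<infinity>"
  obtains us K where "H10_weak_conv \<Omega> us u" "\<And>k. sqn (wg (us k)) \<le> K"
    "\<And>e. e > 0 \<Longrightarrow> \<forall>\<^sub>F k in sequentially. Fa k (us k) \<le> ennreal (Fr u + e)"
proof -
  obtain us where us: "H10_weak_conv \<Omega> us u" "limsup (\<lambda>k. Fa k (us k)) \<le> F u"
    using Gamma u unfolding Gamma_conv_weak_H10_def Fa_def by blast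
  have H: "H10 \<Omega> (us k)" for k using us by (auto simp: H10_weak_conv_def)
  have ev: "\<forall>\<^sub>F k in sequentially. Fa k (us k) \<le> ennreal (Fr u + e)" if "e > 0" for e
  proof -
    have "F u < ennreal (Fr u + e)"
      using that Fr_nonneg[of u] unfolding fin[unfolded F_finite_iff] by (subst ennreal_less_iff) auto
    with us(2) have "limsup (\<lambda>k. Fa k (us k)) < ennreal (Fr u + e)" by (rule le_less_trans)
    then have "\<forall>\<^sub>F k in sequentially. Fa k (us k) < ennreal (Fr u + e)" by (rule Limsup_lessD)
    then show ?thesis by (rule eventually_mono) simp
  qed
  have "\<forall>\<^sub>F k in sequentially. norm (sqn (wg (us k))) \<le> Fr u + 1"
    using ev[of 1, simplified]
  proof (rule eventually_mono)
    fix k assume "Fa k (us k) \<le> ennreal (Fr u + 1)"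
    then have "ennreal (sqn (wg (us k))) \<le> ennreal (Fr u + 1)"
      unfolding Fa_eq[OF H] by (metis add.commute add_increasing2 le_iff_add order_trans zero_le)
    then show "norm (sqn (wg (us k))) \<le> Fr u + 1"
      using Fr_nonneg[of u] by (subst (asm) ennreal_le_iff) (auto simp: sqn_nonneg)
  qed
  then have "Bseq (\<lambda>k. sqn (wg (us k)))" by (rule BfunI)
  then obtain K where "\<And>k. norm (sqn (wg (us k))) \<le> K" by (auto simp: Bseq_def)
  then show thesis using that[OF us(1) _ ev] by (metis abs_le_D1 real_norm_def)
qed

lemma sqn_wg_test: "test_fn \<Omega> u \<Longrightarrow> sqn (wg u) = sqn (grad u)"
  using H10_test[of u] H10_L2(2)[of u] test_fn_L2_grad[of \<Omega> u]
  by (intro sqn_cong_AE) (auto dest!: L2_measurable)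

lemma F_le_osc:
  assumes u: "test_fn \<Omega> u" and c: "\<And>x y. \<bar>u x - u y\<bar> \<le> c"
  shows "F u \<le> ennreal (c\<^sup>2 * M + sqn (grad u))"
proof -
  note H = H10_test(1)[OF u]
  have "F u \<le> liminf (\<lambda>k. Fa k u)" by (rule F_le_liminf[OF weak_conv_const[OF H]])
  also have "\<dots> \<le> liminf (\<lambda>k. ennreal (c\<^sup>2 * M + sqn (grad u)))"
  proof (rule Liminf_mono[OF always_eventually], rule allI)
    fix k
    have "Fa k u \<le> ennreal (c\<^sup>2 * M) + ennreal (sqn (grad u))"
      unfolding Fa_eq[OF H] sqn_wg_test[OF u] by (intro add_right_mono jump_le_osc c)
    then show "Fa k u \<le> ennreal (c\<^sup>2 * M + sqn (grad u))" using M by (simp add: sqn_nonneg)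
  qed
  also have "\<dots> = ennreal (c\<^sup>2 * M + sqn (grad u))" by (simp add: Liminf_const)
  finally show ?thesis .
qed

lemma test_fn_osc:
  assumes "test_fn \<Omega> u" obtains c where "\<And>x y. \<bar>u x - u y\<bar> \<le> c"
proof -
  obtain K where K: "compact K" "\<And>x. x \<notin> K \<Longrightarrow> u x = 0" using assms test_fnE by metis
  have "compact (u ` K)"
    using K assms by (intro compact_continuous_image smooth_continuous_on) (auto dest: test_fn_smooth)
  then obtain L where L: "\<And>x. x \<in> K \<Longrightarrow> norm (u x) \<le> L" "L > 0"
    by (metis bounded_pos compact_imp_bounded imageI)
  have "\<bar>u x\<bar> \<le> L" for x using L K by (cases "x \<in> K") auto
  then have "\<bar>u x - u y\<bar> \<le> L + L" for x y by (meson abs_triangle_ineq4 add_mono order_trans)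
  then show thesis by (rule that)
qed

lemma F_test_finite: "test_fn \<Omega> u \<Longrightarrow> F u < \<infinity>"
  by (metis F_le_osc test_fn_osc ennreal_less_top infinity_ennreal_def order_le_less_trans)

lemma F_test_eq: "test_fn \<Omega> u \<Longrightarrow> F u = ennreal (Fr u)"
  using F_test_finite F_finite_iff by blast

text \<open>Sums and differences of recovery sequences are admissible in the liminf inequalities at
  \<open>u + v\<close> and \<open>u - v\<close>, while each \<open>Fa k\<close> satisfies the law
  exactly. This gives one inequality only.\<close>

lemma Fr_parallelogram_le:
  assumes u: "test_fn \<Omega> u" and v: "test_fn \<Omega> v"
  shows "Fr (\<lambda>x. u x + v x) + Fr (\<lambda>x. u x - v x) \<le> 2 * Fr u + 2 * Fr v"
proof (rule field_le_epsilon)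
  fix e :: real assume e: "e > 0"
  obtain us K where us: "H10_weak_conv \<Omega> us u"
    "\<And>e. e > 0 \<Longrightarrow> \<forall>\<^sub>F k in sequentially. Fa k (us k) \<le> ennreal (Fr u + e)"
    using recovery[OF H10_test(1)[OF u] F_test_finite[OF u]] by metis
  obtain vs K where vs: "H10_weak_conv \<Omega> vs v"
    "\<And>e. e > 0 \<Longrightarrow> \<forall>\<^sub>F k in sequentially. Fa k (vs k) \<le> ennreal (Fr v + e)"
    using recovery[OF H10_test(1)[OF v] F_test_finite[OF v]] by metis
  have H: "H10 \<Omega> (us k)" "H10 \<Omega> (vs k)" for k using us vs by (auto simp: H10_weak_conv_def)
  \<comment> \<open>Six slacks: one from each lower bound, and two from each recovery sequence
    because of the factor \<open>2\<close>.\<close>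
  let ?d = "e / 6"
  have d: "?d > 0" using e by simp
  have p: "H10_weak_conv \<Omega> (\<lambda>k x. us k x + vs k x) (\<lambda>x. u x + v x)"
    using weak_conv_lincomb[OF us(1) vs(1), of 1 1] by simp
  have m: "H10_weak_conv \<Omega> (\<lambda>k x. us k x - vs k x) (\<lambda>x. u x - v x)"
    using weak_conv_lincomb[OF us(1) vs(1), of 1 "-1"] by simp
  have "\<forall>\<^sub>F k in sequentially. ennreal (Fr (\<lambda>x. u x + v x)) \<le> Fa k (\<lambda>x. us k x + vs k x) + ennreal ?d \<and>
      ennreal (Fr (\<lambda>x. u x - v x)) \<le> Fa k (\<lambda>x. us k x - vs k x) + ennreal ?d \<and>
      Fa k (us k) \<le> ennreal (Fr u + ?d) \<and> Fa k (vs k) \<le> ennreal (Fr v + ?d)"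
    using lower_bound[OF p F_test_finite[OF test_fn_add[OF u v]] d]
      lower_bound[OF m F_test_finite[OF test_fn_diff[OF u v]] d] us(2)[OF d] vs(2)[OF d]
    by eventually_elim blast
  then obtain k where k: "ennreal (Fr (\<lambda>x. u x + v x)) \<le> Fa k (\<lambda>x. us k x + vs k x) + ennreal ?d"
      "ennreal (Fr (\<lambda>x. u x - v x)) \<le> Fa k (\<lambda>x. us k x - vs k x) + ennreal ?d"
      "Fa k (us k) \<le> ennreal (Fr u + ?d)" "Fa k (vs k) \<le> ennreal (Fr v + ?d)"
    by (auto simp: eventually_sequentially)
  have "ennreal (Fr (\<lambda>x. u x + v x) + Fr (\<lambda>x. u x - v x)) =
      ennreal (Fr (\<lambda>x. u x + v x)) + ennreal (Fr (\<lambda>x. u x - v x))"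
    by (simp add: Fr_nonneg)
  also have "\<dots> \<le> (Fa k (\<lambda>x. us k x + vs k x) + ennreal ?d) + (Fa k (\<lambda>x. us k x - vs k x) + ennreal ?d)"
    by (intro add_mono k)
  also have "\<dots> = (2 * Fa k (us k) + 2 * Fa k (vs k)) + (ennreal ?d + ennreal ?d)"
    using Fa_parallelogram[OF H, of k k k] by (simp add: ac_simps)
  also have "\<dots> \<le> (2 * ennreal (Fr u + ?d) + 2 * ennreal (Fr v + ?d)) + (ennreal ?d + ennreal ?d)"
    by (intro add_mono mult_left_mono k) auto
  also have "\<dots> = ennreal 2 * ennreal (Fr u + ?d) + ennreal 2 * ennreal (Fr v + ?d) + (ennreal ?d + ennreal ?d)" by simp
  also have "\<dots> = ennreal (2 * (Fr u + ?d) + 2 * (Fr v + ?d) + (?d + ?d))"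
  proof -
    have "ennreal 2 * ennreal x + ennreal 2 * ennreal y + (ennreal z + ennreal z) = ennreal (2 * x + 2 * y + (z + z))"
      if "x \<ge> 0" "y \<ge> 0" "z \<ge> 0" for x y z
      using that by (simp only: ennreal_plus ennreal_mult add_nonneg_nonneg mult_nonneg_nonneg zero_le_numeral)
    from this[of "Fr u + ?d" "Fr v + ?d" ?d] show ?thesis
      using add_nonneg_nonneg[OF Fr_nonneg less_imp_le[OF d]] less_imp_le[OF d] by blast
  qed
  finally have "Fr (\<lambda>x. u x + v x) + Fr (\<lambda>x. u x - v x) \<le> 2 * (Fr u + ?d) + 2 * (Fr v + ?d) + (?d + ?d)"
    using Fr_nonneg[of u] Fr_nonneg[of v] e by (subst (asm) ennreal_le_iff) auto
  then show "Fr (\<lambda>x. u x + v x) + Fr (\<lambda>x. u x - v x) \<le> 2 * Fr u + 2 * Fr v + e" by simp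
qed

lemma Fr_cmult_le:
  assumes u: "test_fn \<Omega> u"
  shows "Fr (\<lambda>x. c * u x) \<le> c\<^sup>2 * Fr u"
proof (rule field_le_epsilon)
  fix e :: real assume e: "e > 0"
  obtain us K where us: "H10_weak_conv \<Omega> us u"
    "\<And>e. e > 0 \<Longrightarrow> \<forall>\<^sub>F k in sequentially. Fa k (us k) \<le> ennreal (Fr u + e)"
    using recovery[OF H10_test(1)[OF u] F_test_finite[OF u]] by metis
  have H: "H10 \<Omega> (us k)" for k using us by (auto simp: H10_weak_conv_def)
  \<comment> \<open>The recovery sequence contributes \<open>c^2 * ?d\<close> and the lower bound
    \<open>?d\<close>, in total \<open>e\<close>.\<close>
  let ?d = "e / (c\<^sup>2 + 1)"
  have c1: "c\<^sup>2 + 1 > 0" by (simp add: add_nonneg_pos)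
  have d: "?d > 0" using e c1 by simp
  have p: "H10_weak_conv \<Omega> (\<lambda>k x. c * us k x) (\<lambda>x. c * u x)"
    using weak_conv_lincomb[OF us(1) us(1), of c 0] by simp
  have "\<forall>\<^sub>F k in sequentially. ennreal (Fr (\<lambda>x. c * u x)) \<le> Fa k (\<lambda>x. c * us k x) + ennreal ?d \<and>
      Fa k (us k) \<le> ennreal (Fr u + ?d)"
    using lower_bound[OF p F_test_finite[OF test_fn_cmult[OF u]] d] us(2)[OF d]
    by eventually_elim blast
  then obtain k where k: "ennreal (Fr (\<lambda>x. c * u x)) \<le> Fa k (\<lambda>x. c * us k x) + ennreal ?d"
      "Fa k (us k) \<le> ennreal (Fr u + ?d)"
    by (auto simp: eventually_sequentially)
  note k(1)
  also have "Fa k (\<lambda>x. c * us k x) + ennreal ?d = ennreal (c\<^sup>2) * Fa k (us k) + ennreal ?d"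
    by (simp add: Fa_cmult[OF H])
  also have "\<dots> \<le> ennreal (c\<^sup>2) * ennreal (Fr u + ?d) + ennreal ?d"
    by (intro add_right_mono mult_left_mono k) auto
  also have "\<dots> = ennreal (c\<^sup>2 * (Fr u + ?d) + ?d)"
    using Fr_nonneg[of u] d by (simp add: ennreal_mult ennreal_plus add_nonneg_nonneg)
  finally have "Fr (\<lambda>x. c * u x) \<le> c\<^sup>2 * (Fr u + ?d) + ?d"
    using Fr_nonneg[of u] d by (subst (asm) ennreal_le_iff) auto
  also have "\<dots> = c\<^sup>2 * Fr u + (c\<^sup>2 + 1) * ?d" by (simp only: distrib_left distrib_right mult_1 add.assoc)
  also have "(c\<^sup>2 + 1) * ?d = e" using c1 by simp
  finally show "Fr (\<lambda>x. c * u x) \<le> c\<^sup>2 * Fr u + e" .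
qed

text \<open>The reverse inequality is the proved one for the factor \<open>1 / c\<close> applied to
  \<open>c * u\<close>.\<close>

lemma Fr_cmult:
  assumes u: "test_fn \<Omega> u" shows "Fr (\<lambda>x. c * u x) = c\<^sup>2 * Fr u"
proof (cases "c = 0")
  case True
  then show ?thesis using Fr_cmult_le[OF u, of 0] Fr_nonneg[of "\<lambda>x. 0"] by simp
next
  case False
  have "Fr (\<lambda>x. (1 / c) * (c * u x)) \<le> (1 / c)\<^sup>2 * Fr (\<lambda>x. c * u x)"
    by (rule Fr_cmult_le[OF test_fn_cmult[OF u]])
  with False have "c\<^sup>2 * Fr u \<le> Fr (\<lambda>x. c * u x)" by (simp add: power_divide field_simps)
  then show ?thesis using Fr_cmult_le[OF u, of c] by simp
qed

text \<open>The reverse inequality is the proved one for \<open>u + v\<close> and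
  \<open>u - v\<close>, whose sum and difference are \<open>2 * u\<close> and
  \<open>2 * v\<close>.\<close>

lemma Fr_parallelogram:
  assumes u: "test_fn \<Omega> u" and v: "test_fn \<Omega> v"
  shows "Fr (\<lambda>x. u x + v x) + Fr (\<lambda>x. u x - v x) = 2 * Fr u + 2 * Fr v"
proof -
  have "Fr (\<lambda>x. (u x + v x) + (u x - v x)) + Fr (\<lambda>x. (u x + v x) - (u x - v x)) \<le>
      2 * Fr (\<lambda>x. u x + v x) + 2 * Fr (\<lambda>x. u x - v x)"
    by (intro Fr_parallelogram_le test_fn_add test_fn_diff u v)
  moreover have "(\<lambda>x. (u x + v x) + (u x - v x)) = (\<lambda>x. 2 * u x)" "(\<lambda>x. (u x + v x) - (u x - v x)) = (\<lambda>x. 2 * v x)"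
    by auto
  ultimately show ?thesis
    using Fr_parallelogram_le[OF u v] Fr_cmult[OF u, of 2] Fr_cmult[OF v, of 2] by simp
qed

lemma Fr_contraction:
  assumes u: "test_fn \<Omega> u" and T: "smooth T" "T 0 = 0" "\<And>s. \<bar>pdiff 1 T s\<bar> \<le> 1"
  shows "Fr (\<lambda>x. T (u x)) \<le> Fr u"
proof (rule field_le_epsilon)
  fix e :: real assume e: "e > 0"
  obtain us K where us: "H10_weak_conv \<Omega> us u" "\<And>k. sqn (wg (us k)) \<le> K"
    "\<And>e. e > 0 \<Longrightarrow> \<forall>\<^sub>F k in sequentially. Fa k (us k) \<le> ennreal (Fr u + e)"
    using recovery[OF H10_test(1)[OF u] F_test_finite[OF u]] by metis
  have H: "H10 \<Omega> (us k)" for k using us by (auto simp: H10_weak_conv_def)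
  have lip: "\<bar>T s - T t\<bar> \<le> \<bar>s - t\<bar>" for s t using contraction_abs_le[OF T(1,3)] .
  have pair: "H10_pair \<Omega> (\<lambda>x. T (us k x)) (\<lambda>x. pdiff 1 T (us k x) *\<^sub>R wgrad \<Omega> (us k) x)" for k
    by (rule H10_pair_compose[OF H10_pair_wgrad[OF H] T])
  then have HT: "H10 \<Omega> (\<lambda>x. T (us k x))" for k unfolding H10_def by blast
  have tT: "test_fn \<Omega> (\<lambda>x. T (u x))" by (rule test_fn_compose[OF u T(1,2)])
  have DT: "sqn (wg (\<lambda>x. T (us k x))) \<le> sqn (wg (us k))" for k
    unfolding sqn_def
  proof (rule integral_mono_AE)
    show "integrable lborel (\<lambda>x. (norm (wg (\<lambda>x. T (us k x)) x))\<^sup>2)" "integrable lborel (\<lambda>x. (norm (wg (us k) x))\<^sup>2)"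
      by (intro L2_integrable H10_L2 HT H)+
    show "AE x in lborel. (norm (wg (\<lambda>x. T (us k x)) x))\<^sup>2 \<le> (norm (wg (us k) x))\<^sup>2"
      using wg_AE[OF pair]
    proof (rule eventually_mono)
      fix x assume "wg (\<lambda>x. T (us k x)) x = ext0 \<Omega> (\<lambda>x. pdiff 1 T (us k x) *\<^sub>R wgrad \<Omega> (us k) x) x"
      then show "(norm (wg (\<lambda>x. T (us k x)) x))\<^sup>2 \<le> (norm (wg (us k) x))\<^sup>2"
        using T(3) by (intro power_mono) (auto simp: ext0_def intro: mult_left_le_one_le)
    qed
  qed
  have FT: "Fa k (\<lambda>x. T (us k x)) \<le> Fa k (us k)" for k
    unfolding Fa_eq[OF HT] Fa_eq[OF H]
    by (intro add_mono jump_le ennreal_leI DT) (rule lip)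
  have L2lim: "(\<lambda>k. sqn (\<lambda>x. val (us k) x - val u x)) \<longlonglongrightarrow> 0"
    by (rule weak_conv_imp_L2_conv[OF us(1,2)])
  \<comment> \<open>Bounded gradients turn weak convergence into \<open>L2\<close> convergence,
    which passes through the Lipschitz map \<open>T\<close>; the bound \<open>K\<close>, inherited
    by the compositions, leads back to weak convergence.\<close>
  have w: "H10_weak_conv \<Omega> (\<lambda>k x. T (us k x)) (\<lambda>x. T (u x))"
  proof (rule weak_convI[OF HT H10_test(1)[OF tT]])
    show "sqn (wg (\<lambda>x. T (us k x))) \<le> K" for k using DT[of k] us(2)[of k] by linarith
    show "(\<lambda>k. sqn (\<lambda>x. val (\<lambda>x. T (us k x)) x - val (\<lambda>x. T (u x)) x)) \<longlonglongrightarrow> 0"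
    proof (rule Lim_null_comparison[OF eventuallyI L2lim])
      fix k
      have "sqn (\<lambda>x. val (\<lambda>x. T (us k x)) x - val (\<lambda>x. T (u x)) x) \<le> sqn (\<lambda>x. val (us k) x - val u x)"
        unfolding sqn_def
      proof (rule integral_mono)
        show "integrable lborel (\<lambda>x. (norm (val (\<lambda>x. T (us k x)) x - val (\<lambda>x. T (u x)) x))\<^sup>2)"
          "integrable lborel (\<lambda>x. (norm (val (us k) x - val u x))\<^sup>2)"
          by (intro L2_integrable L2_diff H10_L2 HT H H10_test(1) tT u)+
        show "(norm (val (\<lambda>x. T (us k x)) x - val (\<lambda>x. T (u x)) x))\<^sup>2 \<le> (norm (val (us k) x - val u x))\<^sup>2" for x
          using lip[of "us k x" "u x"] by (intro power_mono) (auto simp: ext0_def)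
      qed
      then show "norm (sqn (\<lambda>x. val (\<lambda>x. T (us k x)) x - val (\<lambda>x. T (u x)) x)) \<le> sqn (\<lambda>x. val (us k) x - val u x)"
        by (simp add: sqn_nonneg)
    qed
  qed
  have d: "e / 2 > 0" using e by simp
  have "\<forall>\<^sub>F k in sequentially. ennreal (Fr (\<lambda>x. T (u x))) \<le> Fa k (\<lambda>x. T (us k x)) + ennreal (e / 2) \<and>
      Fa k (us k) \<le> ennreal (Fr u + e / 2)"
    using lower_bound[OF w F_test_finite[OF tT] d] us(3)[OF d] by eventually_elim blast
  then obtain k where k: "ennreal (Fr (\<lambda>x. T (u x))) \<le> Fa k (\<lambda>x. T (us k x)) + ennreal (e / 2)"
      "Fa k (us k) \<le> ennreal (Fr u + e / 2)" by (auto simp: eventually_sequentially)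
  note k(1)
  also have "Fa k (\<lambda>x. T (us k x)) + ennreal (e / 2) \<le> ennreal (Fr u + e / 2) + ennreal (e / 2)"
    using FT[of k] k(2) by (intro add_right_mono) (rule order_trans)
  also have "\<dots> = ennreal (Fr u + e)" using Fr_nonneg[of u] e by (simp flip: ennreal_plus)
  finally show "Fr (\<lambda>x. T (u x)) \<le> Fr u + e" using Fr_nonneg[of u] e by (subst (asm) ennreal_le_iff) auto
qed

text \<open>Weak convergence controls the sum of the value and gradient inner products; the values
  converge strongly, so the gradient products converge on their own.\<close>

lemma Dirichlet_le_Fr:
  assumes u: "test_fn \<Omega> u" shows "sqn (grad u) \<le> Fr u"
proof -
  obtain us K where us: "H10_weak_conv \<Omega> us u" "\<And>k. sqn (wg (us k)) \<le> K"
    "\<And>e. e > 0 \<Longrightarrow> \<forall>\<^sub>F k in sequentially. Fa k (us k) \<le> ennreal (Fr u + e)"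
    using recovery[OF H10_test(1)[OF u] F_test_finite[OF u]] by metis
  note Hu = H10_test(1)[OF u]
  have H: "H10 \<Omega> (us k)" for k using us by (auto simp: H10_weak_conv_def)
  note L = H10_L2[OF H] and Lu = H10_L2[OF Hu]
  have c: "(\<lambda>k. sqn (\<lambda>x. val u x - val u x)) \<longlonglongrightarrow> 0" by (simp add: sqn_def)
  have "(\<lambda>k. ip (val (us k)) (val u)) \<longlonglongrightarrow> ip (val u) (val u)"
    by (rule ip_tendsto[OF L(1) Lu(1) weak_conv_imp_L2_conv[OF us(1,2)] Lu(1) Lu(1) c])
  moreover have "(\<lambda>k. H1_inner \<Omega> (us k) u) \<longlonglongrightarrow> H1_inner \<Omega> u u"
    using us(1) Hu by (simp add: H10_weak_conv_def)
  ultimately have "(\<lambda>k. H1_inner \<Omega> (us k) u - ip (val (us k)) (val u)) \<longlonglongrightarrow> H1_inner \<Omega> u u - ip (val u) (val u)"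
    by (intro tendsto_diff)
  then have lim: "(\<lambda>k. ip (wg (us k)) (wg u)) \<longlonglongrightarrow> sqn (wg u)"
    by (simp add: H1_inner_eq[OF H Hu] H1_inner_eq[OF Hu Hu] sqn_eq_ip)
  \<comment> \<open>Twice the inner product is at most the sum of the two squared norms, and the
    squared gradient norm of \<open>us k\<close> is at most its energy.\<close>
  have "sqn (wg u) \<le> (Fr u + sqn (wg u)) / 2"
  proof (rule field_le_epsilon)
    fix e :: real assume e: "e > 0"
    have "\<forall>\<^sub>F k in sequentially. ip (wg (us k)) (wg u) \<le> (Fr u + sqn (wg u)) / 2 + e"
      using us(3)[OF e]
    proof (rule eventually_mono)
      fix k assume "Fa k (us k) \<le> ennreal (Fr u + e)"
      then have "ennreal (sqn (wg (us k))) \<le> ennreal (Fr u + e)"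
        unfolding Fa_eq[OF H] by (metis add.commute add_increasing2 le_iff_add order_trans zero_le)
      then have "sqn (wg (us k)) \<le> Fr u + e" using Fr_nonneg[of u] e by (subst (asm) ennreal_le_iff) auto
      moreover have "0 \<le> sqn (wg (us k)) - 2 * ip (wg (us k)) (wg u) + sqn (wg u)"
        using sqn_nonneg[of "\<lambda>x. wg (us k) x - wg u x"] by (simp add: sqn_diff L Lu)
      ultimately show "ip (wg (us k)) (wg u) \<le> (Fr u + sqn (wg u)) / 2 + e" using e by argo
    qed
    then show "sqn (wg u) \<le> (Fr u + sqn (wg u)) / 2 + e"
      by (rule tendsto_upperbound[OF lim _ trivial_limit_sequentially])
  qed
  then show ?thesis using sqn_wg_test[OF u] by simp
qed

definition G :: "('a \<Rightarrow> real) \<Rightarrow> real" where "G u = Fr u - sqn (grad u)"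

sublocale quadratic_form "test_fn \<Omega>" G
proof
  fix u v :: "'a \<Rightarrow> real" and c :: real assume u: "test_fn \<Omega> u"
  show "test_fn \<Omega> (\<lambda>x. c * u x)" by (rule test_fn_cmult[OF u])
  show "0 \<le> G u" using Dirichlet_le_Fr[OF u] by (simp add: G_def)
  have "grad (\<lambda>x. c * u x) = (\<lambda>x. c *\<^sub>R grad u x)" using grad_cmult[OF test_fn_smooth[OF u]] by blast
  then show "G (\<lambda>x. c * u x) = c\<^sup>2 * G u"
    by (simp add: G_def Fr_cmult[OF u] sqn_scaleR algebra_simps)
  assume v: "test_fn \<Omega> v"
  show "test_fn \<Omega> (\<lambda>x. u x + v x)" by (rule test_fn_add[OF u v])
  have "grad (\<lambda>x. u x + v x) = (\<lambda>x. grad u x + grad v x)" "grad (\<lambda>x. u x - v x) = (\<lambda>x. grad u x - grad v x)"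
    using grad_add[OF test_fn_smooth[OF u] test_fn_smooth[OF v]]
      grad_diff[OF test_fn_smooth[OF u] test_fn_smooth[OF v]] by blast+
  then show "G (\<lambda>x. u x + v x) + G (\<lambda>x. u x - v x) = 2 * G u + 2 * G v"
    using Fr_parallelogram[OF u v]
    by (simp add: G_def sqn_add sqn_diff test_fn_L2_grad[OF u] test_fn_L2_grad[OF v])
qed (rule test_fn_zero)

text \<open>This inequality gives the continuity of \<open>G\<close> for the supremum norm and, on a
  grid, the bounds on the diagonal entries and on the killing weights, uniformly in the
  mesh.\<close>

lemma G_le_osc:
  assumes u: "test_fn \<Omega> u" and c: "\<And>x y. \<bar>u x - u y\<bar> \<le> c"
  shows "G u \<le> c\<^sup>2 * M"
proof -
  have "ennreal (Fr u) \<le> ennreal (c\<^sup>2 * M + sqn (grad u))"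
    using F_le_osc[OF assms] F_test_eq[OF u] by simp
  then show ?thesis using M by (subst (asm) ennreal_le_iff) (auto simp: sqn_nonneg G_def)
qed

end

section \<open>Signs of the polar form from the Markov property\<close>

lemma soft_abs_bounds:
  assumes "e > 0"
  shows "\<bar>s\<bar> < soft_abs e s" "soft_abs e s \<le> \<bar>s\<bar> + e" "soft_abs e s > 0"
proof -
  have "sqrt (s\<^sup>2) < soft_abs e s"
    unfolding soft_abs_def using assms by (intro real_sqrt_less_mono) simp
  then show less: "\<bar>s\<bar> < soft_abs e s" by simp
  show "soft_abs e s > 0" using less abs_ge_zero[of s] by linarith
  have "s\<^sup>2 + e\<^sup>2 \<le> (\<bar>s\<bar> + e)\<^sup>2" using assms by (simp add: power2_sum)
  then show "soft_abs e s \<le> \<bar>s\<bar> + e"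
    unfolding soft_abs_def using assms by (intro real_le_lsqrt) auto
qed

lemma soft_abs_slope_le: "e > 0 \<Longrightarrow> \<bar>s / soft_abs e s\<bar> \<le> 1"
  using soft_abs_bounds[of e s] by (simp add: field_simps)

lemma soft_abs_slope_tendsto:
  assumes "s \<noteq> 0"
  shows "(\<lambda>n. s / soft_abs (1 / real (Suc n)) s) \<longlonglongrightarrow> sgn s"
proof -
  have "(\<lambda>n. soft_abs (1 / real (Suc n)) s) \<longlonglongrightarrow> sqrt (s\<^sup>2 + 0\<^sup>2)"
    unfolding soft_abs_def
    using LIMSEQ_inverse_real_of_nat by (intro tendsto_intros) (simp add: inverse_eq_divide)
  then have "(\<lambda>n. s / soft_abs (1 / real (Suc n)) s) \<longlonglongrightarrow> s / \<bar>s\<bar>"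
    using assms by (intro tendsto_intros) auto
  then show ?thesis using assms by (simp add: real_sgn_eq)
qed

context gamma_limit
begin

lemma Fr_eq: "Fr u = G u + sqn (grad u)" by (simp add: G_def)

text \<open>The oscillation of \<open>f n - u\<close> is at most \<open>2 * c n\<close>, so
  \<open>G\<close> of this difference tends to zero however the gradients behave.\<close>

lemma G_uniform_tendsto:
  assumes f: "\<And>n. test_fn \<Omega> (f n)" and u: "test_fn \<Omega> u"
    and le: "\<And>n x. \<bar>f n x - u x\<bar> \<le> c n" and c: "c \<longlonglongrightarrow> 0"
  shows "(\<lambda>n. G (f n)) \<longlonglongrightarrow> G u"
proof (rule Q_tendsto[OF f u])
  show "(\<lambda>n. G (\<lambda>x. f n x - u x)) \<longlonglongrightarrow> 0"
  proof (rule Lim_null_comparison[OF eventuallyI])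
    fix n
    have t: "test_fn \<Omega> (\<lambda>x. f n x - u x)" by (rule test_fn_diff[OF f u])
    have "\<bar>(f n x - u x) - (f n y - u y)\<bar> \<le> 2 * c n" for x y
      using le[of n x] le[of n y] by linarith
    from G_le_osc[OF t this] show "norm (G (\<lambda>x. f n x - u x)) \<le> (2 * c n)\<^sup>2 * M"
      using Q_nonneg[OF t] by simp
    have "(\<lambda>n. (2 * c n)\<^sup>2 * M) \<longlonglongrightarrow> (2 * 0)\<^sup>2 * M" by (intro tendsto_intros c)
    then show "(\<lambda>n. (2 * c n)\<^sup>2 * M) \<longlonglongrightarrow> 0" by simp
  qed
qed

text \<open>Lets a contraction with a kink act whenever the result \<open>v\<close> is again a test
  function: \<open>G\<close> passes to the limit by uniform convergence, the Dirichlet integral by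
  domination with the gradient of \<open>w\<close>.\<close>

lemma Fr_contraction_limit:
  assumes w: "test_fn \<Omega> w" and v: "test_fn \<Omega> v"
    and T: "\<And>n. smooth (T n)" "\<And>n. T n 0 = 0" "\<And>n s. \<bar>pdiff 1 (T n) s\<bar> \<le> 1"
    and le: "\<And>n x. \<bar>T n (w x) - v x\<bar> \<le> c n" and c: "c \<longlonglongrightarrow> 0"
    and gr: "\<And>x. (\<lambda>n. pdiff 1 (T n) (w x) *\<^sub>R grad w x) \<longlonglongrightarrow> grad v x"
  shows "Fr v \<le> Fr w"
proof -
  let ?f = "\<lambda>n x. T n (w x)"
  have t: "test_fn \<Omega> (?f n)" for n by (rule test_fn_compose[OF w T(1,2)])
  have lim1: "(\<lambda>n. G (?f n)) \<longlonglongrightarrow> G v" by (rule G_uniform_tendsto[OF t v le c])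
  have geq: "grad (?f n) x = pdiff 1 (T n) (w x) *\<^sub>R grad w x" for n x
    by (rule grad_compose[OF T(1) test_fn_smooth[OF w]])
  have [measurable]: "grad v \<in> borel_measurable borel" "grad (?f n) \<in> borel_measurable borel" for n
    using test_fn_L2_grad[OF v] test_fn_L2_grad[OF t] by (auto dest: L2_measurable)
  have lim2: "(\<lambda>n. sqn (grad (?f n))) \<longlonglongrightarrow> sqn (grad v)"
    unfolding sqn_def
  proof (rule integral_dominated_convergence[where w="\<lambda>x. (norm (grad w x))\<^sup>2"])
    show "integrable lborel (\<lambda>x. (norm (grad w x))\<^sup>2)" by (intro L2_integrable test_fn_L2_grad[OF w])
    show "AE x in lborel. (\<lambda>n. (norm (grad (?f n) x))\<^sup>2) \<longlonglongrightarrow> (norm (grad v x))\<^sup>2"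
      unfolding geq by (intro AE_I2 tendsto_intros gr)
    show "AE x in lborel. norm ((norm (grad (?f n) x))\<^sup>2) \<le> (norm (grad w x))\<^sup>2" for n
    proof (rule AE_I2)
      fix x
      have "norm (grad (?f n) x) \<le> norm (grad w x)"
        unfolding geq using T(3)[of n "w x"] by (auto intro: mult_left_le_one_le)
      then show "norm ((norm (grad (?f n) x))\<^sup>2) \<le> (norm (grad w x))\<^sup>2" by (simp add: power_mono)
    qed
  qed auto
  have "(\<lambda>n. Fr (?f n)) \<longlonglongrightarrow> Fr v"
    unfolding Fr_eq by (intro tendsto_add lim1 lim2)
  then show ?thesis
    by (rule LIMSEQ_le_const2) (use Fr_contraction[OF w T(1) T(2) T(3)] in auto)
qed

lemma inverse_Suc_tendsto: "(\<lambda>n. 1 / real (Suc n)) \<longlonglongrightarrow> 0"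
  using LIMSEQ_inverse_real_of_nat by (simp add: inverse_eq_divide)

lemma sqn_grad_add_orthogonal:
  assumes "test_fn \<Omega> u" "test_fn \<Omega> v" "\<And>x. grad u x \<bullet> grad v x = 0"
  shows "sqn (grad (\<lambda>x. u x + v x)) = sqn (grad u) + sqn (grad v)"
    "sqn (grad (\<lambda>x. u x - v x)) = sqn (grad u) + sqn (grad v)"
proof -
  have "grad (\<lambda>x. u x + v x) = (\<lambda>x. grad u x + grad v x)" "grad (\<lambda>x. u x - v x) = (\<lambda>x. grad u x - grad v x)"
    using grad_add[OF test_fn_smooth[OF assms(1)] test_fn_smooth[OF assms(2)]]
      grad_diff[OF test_fn_smooth[OF assms(1)] test_fn_smooth[OF assms(2)]] by blast+
  moreover have "ip (grad u) (grad v) = 0" by (simp add: ip_def assms(3))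
  ultimately show "sqn (grad (\<lambda>x. u x + v x)) = sqn (grad u) + sqn (grad v)"
    "sqn (grad (\<lambda>x. u x - v x)) = sqn (grad u) + sqn (grad v)"
    by (simp_all add: sqn_add sqn_diff test_fn_L2_grad[OF assms(1)] test_fn_L2_grad[OF assms(2)])
qed

text \<open>\<open>u + v\<close> is \<open>|u - v|\<close>, so it has no more energy than
  \<open>u - v\<close>. The gradients are orthogonal everywhere, so the Dirichlet parts agree and
  the energies differ by \<open>4 * B u v\<close>.\<close>

lemma B_disjoint_nonpos:
  assumes u: "test_fn \<Omega> u" "\<And>x. u x \<ge> 0" and v: "test_fn \<Omega> v" "\<And>x. v x \<ge> 0"
    and disj: "\<And>x. u x = 0 \<or> v x = 0"
  shows "B u v \<le> 0"
proof -
  have gu: "grad u x = 0" if "u x = 0" for x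
    using grad_zero_at_min[OF test_fn_smooth[OF u(1)], of x] u(2) that by simp
  have gv: "grad v x = 0" if "v x = 0" for x
    using grad_zero_at_min[OF test_fn_smooth[OF v(1)], of x] v(2) that by simp
  \<comment> \<open>Shifted by its value at \<open>0\<close>, so that \<open>T n 0 = 0\<close> and
    compositions keep a compact support.\<close>
  define T where "T n s = soft_abs (1 / real (Suc n)) s - 1 / real (Suc n)" for n s
  have e: "1 / real (Suc n) > 0" for n by simp
  have der: "pdiff 1 (T n) s = s / soft_abs (1 / real (Suc n)) s" for n s
    unfolding T_def[abs_def]
    by (rule fun_cong[OF pdiff_real_eqI]) (auto intro!: derivative_eq_intros soft_abs_DERIV)
  have "Fr (\<lambda>x. u x + v x) \<le> Fr (\<lambda>x. u x - v x)"
  proof (rule Fr_contraction_limit[where T=T, OF test_fn_diff[OF u(1) v(1)] test_fn_add[OF u(1) v(1)] _ _ _ _ inverse_Suc_tendsto])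
    show "smooth (T n)" for n unfolding T_def[abs_def] using smooth_soft_abs[OF e] by auto
    show "T n 0 = 0" for n by (simp add: T_def soft_abs_def)
    show "\<bar>pdiff 1 (T n) s\<bar> \<le> 1" for n s unfolding der by (rule soft_abs_slope_le[OF e])
    show "\<bar>T n (u x - v x) - (u x + v x)\<bar> \<le> 1 / real (Suc n)" for n x
    proof -
      have "\<bar>u x - v x\<bar> = u x + v x" using disj[of x] u(2)[of x] v(2)[of x] by auto
      then show ?thesis using soft_abs_bounds[OF e[of n], where s="u x - v x"] unfolding T_def by linarith
    qed
    fix x
    have ga: "grad (\<lambda>x. u x + v x) x = grad u x + grad v x" "grad (\<lambda>x. u x - v x) x = grad u x - grad v x"
      by (simp_all add: grad_add grad_diff test_fn_smooth[OF u(1)] test_fn_smooth[OF v(1)])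
    show "(\<lambda>n. pdiff 1 (T n) (u x - v x) *\<^sub>R grad (\<lambda>x. u x - v x) x) \<longlonglongrightarrow> grad (\<lambda>x. u x + v x) x"
    proof (cases "u x - v x = 0")
      case True
      with disj[of x] have "u x = 0" "v x = 0" by auto
      then show ?thesis unfolding ga using gu gv by simp
    next
      case False
      have "(\<lambda>n. pdiff 1 (T n) (u x - v x) *\<^sub>R (grad u x - grad v x)) \<longlonglongrightarrow> sgn (u x - v x) *\<^sub>R (grad u x - grad v x)"
        unfolding der by (intro tendsto_scaleR soft_abs_slope_tendsto[OF False] tendsto_const)
      moreover have "sgn (u x - v x) *\<^sub>R (grad u x - grad v x) = grad u x + grad v x"
        using disj[of x] gu[of x] gv[of x] u(2)[of x] v(2)[of x] False by (auto simp: sgn_if)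
      ultimately show ?thesis unfolding ga by simp
    qed
  qed
  moreover have "grad u x \<bullet> grad v x = 0" for x using disj[of x] gu gv by auto
  ultimately show ?thesis
    unfolding Fr_eq B_def using sqn_grad_add_orthogonal[OF u(1) v(1)] by simp
qed

text \<open>For \<open>t > 0\<close>, \<open>v\<close> is \<open>min (v + t * u) 1\<close>, so its
  energy is at most that of \<open>v + t * u\<close>. Orthogonal gradients leave
  \<open>0 \<le> 2 * t * B v u + t^2 * Fr u\<close>, and small \<open>t\<close> gives the
  sign.\<close>

lemma B_plateau_nonneg:
  assumes u: "test_fn \<Omega> u" "\<And>x. u x \<ge> 0" and v: "test_fn \<Omega> v" "\<And>x. v x \<le> 1"
    and plateau: "\<And>x. u x \<noteq> 0 \<Longrightarrow> v x = 1"
  shows "B v u \<ge> 0"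
proof -
  have gu: "grad u x = 0" if "u x = 0" for x
    using grad_zero_at_min[OF test_fn_smooth[OF u(1)], of x] u(2) that by simp
  have gv: "grad v x = 0" if "v x = 1" for x
    using grad_zero_at_max[OF test_fn_smooth[OF v(1)], of x] v(2) that by simp
  \<comment> \<open>Smooth version of \<open>min s 1 = (s + 1 - |s - 1|) / 2\<close>; taking
    \<open>soft_abs\<close> at \<open>1\<close> in place of the constant \<open>1\<close> gives
    \<open>T n 0 = 0\<close>.\<close>
  define T where "T n s = (1/2) * (s + soft_abs (1 / real (Suc n)) 1 - soft_abs (1 / real (Suc n)) (s - 1))" for n s
  have e: "1 / real (Suc n) > 0" for n by simp
  have der: "pdiff 1 (T n) s = (1/2) * (1 - (s - 1) / soft_abs (1 / real (Suc n)) (s - 1))" for n s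
    unfolding T_def[abs_def]
    by (rule fun_cong[OF pdiff_real_eqI]) (auto intro!: derivative_eq_intros DERIV_chain2[OF soft_abs_DERIV])
  have slope: "\<bar>(s - 1) / soft_abs (1 / real (Suc n)) (s - 1)\<bar> \<le> 1" for n s by (rule soft_abs_slope_le[OF e])
  have le: "Fr v \<le> Fr (\<lambda>x. v x + t * u x)" if t: "t > 0" for t
  proof (rule Fr_contraction_limit[where T=T, OF test_fn_add[OF v(1) test_fn_cmult[OF u(1)]] v(1) _ _ _ _ inverse_Suc_tendsto])
    show "smooth (T n)" for n unfolding T_def[abs_def]
      by (intro smooth_mult smooth_minus smooth_add smooth_const smooth_ident
          smooth_compose[OF smooth_soft_abs[OF e], of "\<lambda>s. s - 1"])
    show "T n 0 = 0" for n by (simp add: T_def soft_abs_def)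
    show "\<bar>pdiff 1 (T n) s\<bar> \<le> 1" for n s 
    proof -
      have "\<bar>(1/2) * (1 - r)\<bar> \<le> 1" if "\<bar>r\<bar> \<le> 1" for r :: real using that by (auto simp: abs_le_iff)
      from this[OF slope] show ?thesis unfolding der .
    qed
    show "\<bar>T n (v x + t * u x) - v x\<bar> \<le> 1 / real (Suc n)" for n x
    proof -
      let ?w = "v x + t * u x"
      have "v x = (?w + 1 - \<bar>?w - 1\<bar>) / 2"
      proof (cases "u x = 0")
        case True then show ?thesis using v(2)[of x] by simp
      next
        case False
        then have "v x = 1" "t * u x \<ge> 0" using plateau u(2)[of x] t by auto
        then show ?thesis by simp
      qed
      moreover have "T n ?w - (?w + 1 - \<bar>?w - 1\<bar>) / 2 =
         ((soft_abs (1 / real (Suc n)) 1 - 1) - (soft_abs (1 / real (Suc n)) (?w - 1) - \<bar>?w - 1\<bar>)) / 2"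
        unfolding T_def by (simp add: field_simps)
      ultimately have eq: "T n ?w - v x =
         ((soft_abs (1 / real (Suc n)) 1 - 1) - (soft_abs (1 / real (Suc n)) (?w - 1) - \<bar>?w - 1\<bar>)) / 2" by metis
      have "\<bar>((p - 1) - (q - b)) / 2\<bar> \<le> r" if "\<bar>1\<bar> < p" "p \<le> \<bar>1\<bar> + r" "b < q" "q \<le> b + r" for p q b r :: real
        using that by (simp add: abs_le_iff)
      then show ?thesis unfolding eq
        using soft_abs_bounds[OF e[of n], where s="?w - 1"] soft_abs_bounds[OF e[of n], where s=1] by blast
    qed
    fix x
    have ga: "grad (\<lambda>x. v x + t * u x) x = grad v x + t *\<^sub>R grad u x"
      by (simp add: grad_add grad_cmult test_fn_smooth[OF u(1)] test_fn_smooth[OF v(1)] test_fn_smooth[OF test_fn_cmult[OF u(1)]])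
    show "(\<lambda>n. pdiff 1 (T n) (v x + t * u x) *\<^sub>R grad (\<lambda>x. v x + t * u x) x) \<longlonglongrightarrow> grad v x"
    proof (cases "v x + t * u x = 1")
      case True
      have "u x = 0" using plateau[of x] True t by (cases "u x = 0") auto
      then have "v x = 1" using True by simp
      then show ?thesis unfolding ga using gu[OF \<open>u x = 0\<close>] gv by simp
    next
      case False
      then have nz: "v x + t * u x - 1 \<noteq> 0" by simp
      have "(\<lambda>n. pdiff 1 (T n) (v x + t * u x) *\<^sub>R (grad v x + t *\<^sub>R grad u x)) \<longlonglongrightarrow>
          ((1/2) * (1 - sgn (v x + t * u x - 1))) *\<^sub>R (grad v x + t *\<^sub>R grad u x)"
        unfolding der by (intro tendsto_intros soft_abs_slope_tendsto[OF nz])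
      moreover have "((1/2) * (1 - sgn (v x + t * u x - 1))) *\<^sub>R (grad v x + t *\<^sub>R grad u x) = grad v x"
      proof (cases "u x = 0")
        case True
        then have "v x < 1" using v(2)[of x] False by auto
        then show ?thesis using gu[OF True] True by simp
      next
        case False
        then have "v x = 1" "t * u x > 0" using plateau u(2)[of x] t by (auto simp: less_le)
        then show ?thesis using gv[of x] by simp
      qed
      ultimately show ?thesis unfolding ga by simp
    qed
  qed
  have key: "0 \<le> 2 * B v u + t * Fr u" if t: "t > 0" for t
  proof -
    have tu: "test_fn \<Omega> (\<lambda>x. t * u x)" by (rule test_fn_cmult[OF u(1)])
    have gt: "grad (\<lambda>x. t * u x) = (\<lambda>x. t *\<^sub>R grad u x)" using grad_cmult[OF test_fn_smooth[OF u(1)]] by blast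
    have orth: "grad v x \<bullet> grad (\<lambda>x. t * u x) x = 0" for x
      unfolding gt using gu[of x] gv[of x] plateau[of x] by (cases "u x = 0") auto
    have "Fr (\<lambda>x. v x + t * u x) = (G v + 2 * B v (\<lambda>x. t * u x) + G (\<lambda>x. t * u x)) + (sqn (grad v) + sqn (grad (\<lambda>x. t * u x)))"
      unfolding Fr_eq using Q_add[OF v(1) tu] sqn_grad_add_orthogonal(1)[OF v(1) tu orth] by simp
    also have "B v (\<lambda>x. t * u x) = t * B v u"
      using B_cmult_left[OF u(1) v(1), of t] B_commute[OF v(1) tu] B_commute[OF v(1) u(1)] by simp
    also have "G (\<lambda>x. t * u x) = t\<^sup>2 * G u" by (rule Q_cmult[OF u(1)])
    also have "sqn (grad (\<lambda>x. t * u x)) = t\<^sup>2 * sqn (grad u)" unfolding gt by (rule sqn_scaleR)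
    finally have "0 \<le> t * (2 * B v u + t * Fr u)"
      using le[OF t] unfolding Fr_eq by (simp add: algebra_simps power2_eq_square)
    then show ?thesis using t by (simp add: zero_le_mult_iff)
  qed
  show ?thesis
  proof (rule ccontr)
    assume "\<not> B v u \<ge> 0"
    then have neg: "B v u < 0" by simp
    \<comment> \<open>For this \<open>t\<close> the right side of \<open>key\<close> is at most
      \<open>B v u\<close>, which is negative.\<close>
    have "- B v u / (Fr u + 1) > 0" using neg Fr_nonneg[of u] by (simp add: field_simps)
    from key[OF this] have "0 \<le> 2 * B v u + (- B v u) * (Fr u / (Fr u + 1))" by simp
    also have "(- B v u) * (Fr u / (Fr u + 1)) \<le> (- B v u) * 1"
      using neg Fr_nonneg[of u] by (intro mult_left_mono) (auto simp: field_simps)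
    finally show False using neg by simp
  qed
qed

end

subsection \<open>A partition of unity on a grid\<close>

locale smooth_step =
  fixes h :: "real \<Rightarrow> real"
  assumes smooth_h: "smooth h" and mono_h: "mono h"
    and h_0: "\<And>s. s \<le> 0 \<Longrightarrow> h s = 0" and h_1: "\<And>s. s \<ge> 1 \<Longrightarrow> h s = 1"
begin

text \<open>Differences of consecutive translates telescope, so the integer translates of
  \<open>hat\<close> sum to one. It vanishes outside \<open>[-1, 1]\<close> and equals
  \<open>1\<close> at \<open>0\<close>.\<close>

definition hat :: "real \<Rightarrow> real" where "hat s = h (s + 1) - h s"

lemma hat_nonneg: "hat s \<ge> 0"
  using monoD[OF mono_h, of s "s + 1"] by (simp add: hat_def)

lemma hat_nonzero: "hat s \<noteq> 0 \<Longrightarrow> \<bar>s\<bar> < 1"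
  using h_0[of s] h_0[of "s + 1"] h_1[of s] h_1[of "s + 1"] by (force simp: hat_def)

lemma smooth_hat: "smooth hat"
  unfolding hat_def[abs_def]
  by (intro smooth_minus smooth_h smooth_compose[OF smooth_h, of "\<lambda>s. s + 1"] smooth_add smooth_ident smooth_const)

lemma sum_hat_telescope: "(\<Sum>j\<in>{-int m..int m}. hat (s - of_int j)) = h (s + real m + 1) - h (s - real m)"
proof (induction m)
  case 0
  show ?case by (simp add: hat_def)
next
  case (Suc m)
  have "{-int (Suc m)..int (Suc m)} = insert (-int (Suc m)) (insert (int (Suc m)) {-int m..int m})" by auto
  then show ?case using Suc by (simp add: hat_def algebra_simps)
qed

lemma sum_hat:
  assumes "\<bar>s\<bar> \<le> real m" shows "(\<Sum>j\<in>{-int m..int m}. hat (s - of_int j)) = 1"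
  unfolding sum_hat_telescope using assms h_0[of "s - real m"] h_1[of "s + real m + 1"] by auto

text \<open>Tensor product of hats around the grid point \<open>centre N z\<close>. Only the values
  of \<open>z\<close> on \<open>Basis\<close> matter, hence the index sets \<open>PiE Basis\<close>
  later.\<close>

definition cell :: "real \<Rightarrow> ('a::euclidean_space \<Rightarrow> int) \<Rightarrow> 'a \<Rightarrow> real" where
  "cell N z x = (\<Prod>b\<in>Basis. hat (N * (x \<bullet> b) - of_int (z b)))"

definition centre :: "real \<Rightarrow> ('a::euclidean_space \<Rightarrow> int) \<Rightarrow> 'a" where
  "centre N z = (\<Sum>b\<in>Basis. (of_int (z b) / N) *\<^sub>R b)"

lemma cell_nonneg: "cell N z x \<ge> 0"
  unfolding cell_def by (intro prod_nonneg hat_nonneg)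

lemma smooth_cell: "smooth (cell N z)"
  unfolding cell_def[abs_def]
  by (intro smooth_prod smooth_compose[OF smooth_hat] smooth_minus smooth_mult smooth_const smooth_inner_left)

lemma cell_nonzero: "cell N z x \<noteq> 0 \<Longrightarrow> b \<in> Basis \<Longrightarrow> \<bar>N * (x \<bullet> b) - of_int (z b)\<bar> < 1"
  unfolding cell_def by (auto intro: hat_nonzero)

lemma centre_inner: "b \<in> Basis \<Longrightarrow> centre N z \<bullet> b = of_int (z b) / N"
  unfolding centre_def by (simp add: inner_sum_left inner_Basis if_distrib cong: if_cong)

lemma sum_cell:
  fixes x :: "'a::euclidean_space"
  assumes "\<And>b. b \<in> Basis \<Longrightarrow> \<bar>N * (x \<bullet> b)\<bar> \<le> real m"
  shows "(\<Sum>z\<in>PiE Basis (\<lambda>_. {-int m..int m}). cell N z x) = 1"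
proof -
  have "(\<Sum>z\<in>PiE Basis (\<lambda>_. {-int m..int m}). cell N z x) =
      (\<Prod>b\<in>(Basis::'a set). \<Sum>j\<in>{-int m..int m}. hat (N * (x \<bullet> b) - of_int j))"
    unfolding cell_def by (subst prod_sum_PiE) auto
  also have "\<dots> = 1" using assms by (intro prod.neutral ballI sum_hat) auto
  finally show ?thesis .
qed

lemma dist_le_grid:
  fixes x y :: "'a::euclidean_space"
  assumes "N > 0" "\<And>b. b \<in> Basis \<Longrightarrow> \<bar>N * (x \<bullet> b) - N * (y \<bullet> b)\<bar> \<le> 1"
  shows "norm (x - y) \<le> real DIM('a) / N"
proof -
  have "norm (x - y) \<le> (\<Sum>b\<in>Basis. \<bar>(x - y) \<bullet> b\<bar>)" by (rule norm_le_l1)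
  also have "\<dots> \<le> (\<Sum>b\<in>(Basis::'a set). 1 / N)"
  proof (rule sum_mono)
    fix b :: 'a assume "b \<in> Basis"
    have "N * \<bar>(x - y) \<bullet> b\<bar> = \<bar>N * (x \<bullet> b) - N * (y \<bullet> b)\<bar>"
      using assms(1) by (simp add: inner_diff_left abs_mult flip: right_diff_distrib)
    then show "\<bar>(x - y) \<bullet> b\<bar> \<le> 1 / N"
      using assms(2)[OF \<open>b \<in> Basis\<close>] assms(1) by (simp add: field_simps)
  qed
  finally show ?thesis by simp
qed

lemma dist_centre:
  fixes x :: "'a::euclidean_space"
  assumes "N > 0" "\<And>b. b \<in> Basis \<Longrightarrow> \<bar>N * (x \<bullet> b) - of_int (z b)\<bar> \<le> 1"
  shows "norm (x - centre N z) \<le> real DIM('a) / N"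
  using assms by (intro dist_le_grid) (auto simp: centre_inner)

text \<open>Equal or adjacent grid points; cells that are not related in this way do not
  overlap.\<close>

definition near :: "('a::euclidean_space \<Rightarrow> int) \<Rightarrow> ('a \<Rightarrow> int) \<Rightarrow> bool" where
  "near z z' \<longleftrightarrow> (\<forall>b\<in>Basis. \<bar>z b - z' b\<bar> \<le> 1)"

lemma near_commute: "near z z' = near z' z"
  by (auto simp: near_def abs_minus_commute)

lemma cell_disjoint:
  assumes "\<not> near z z'" shows "cell N z x = 0 \<or> cell N z' x = 0"
proof (rule ccontr)
  assume c: "\<not> ?thesis"
  from assms obtain b where b: "b \<in> Basis" "\<bar>z b - z' b\<bar> > 1" by (auto simp: near_def not_le)
  then have "\<bar>z b - z' b\<bar> \<ge> 2" by linarith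
  then have "\<bar>real_of_int (z b) - real_of_int (z' b)\<bar> \<ge> 2" by linarith
  moreover have "\<bar>N * (x \<bullet> b) - of_int (z b)\<bar> < 1" "\<bar>N * (x \<bullet> b) - of_int (z' b)\<bar> < 1"
    using c b(1) cell_nonzero by auto
  ultimately show False by linarith
qed

lemma card_near:
  fixes z :: "'a::euclidean_space \<Rightarrow> int"
  assumes "S \<subseteq> PiE Basis T"
  shows "card {z' \<in> S. near z z'} \<le> 3 ^ DIM('a)"
proof -
  have sub: "{z' \<in> S. near z z'} \<subseteq> PiE Basis (\<lambda>b. {z b - 1..z b + 1})"
    using assms by (force simp: near_def PiE_iff)
  have "card (PiE (Basis::'a set) (\<lambda>b. {z b - 1..z b + 1})) = 3 ^ DIM('a)"
    by (simp add: card_PiE)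
  with card_mono[OF _ sub] show ?thesis by (simp add: finite_PiE)
qed

lemma near_dist_centre:
  fixes z z' :: "'a::euclidean_space \<Rightarrow> int"
  assumes "N > 0" "near z z'" shows "norm (centre N z - centre N z') \<le> real DIM('a) / N"
proof (rule dist_le_grid[OF assms(1)])
  fix b :: 'a assume "b \<in> Basis"
  then have "\<bar>z b - z' b\<bar> \<le> 1" "N * (centre N z \<bullet> b) = of_int (z b)" "N * (centre N z' \<bullet> b) = of_int (z' b)"
    using assms by (auto simp: near_def centre_inner)
  then show "\<bar>N * (centre N z \<bullet> b) - N * (centre N z' \<bullet> b)\<bar> \<le> 1" by (simp flip: of_int_diff of_int_abs)
qed

end

text \<open>The witness is \<open>e s / (e s + e (1 - s))\<close>, where \<open>e s\<close> is
  \<open>exp (- (1 / s))\<close> for \<open>s > 0\<close> and \<open>0\<close> otherwise.\<close>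

lemma ex_smooth_step: "\<exists>h. smooth_step h"
proof -
  let ?e = "exp_step 1"
  have pos: "?e s > 0" if "s > 0" for s using that by (simp add: exp_step_def)
  have nn: "?e s \<ge> 0" for s by (simp add: exp_step_def)
  have den: "?e s + ?e (1 - s) > 0" for s
    using pos[of s] pos[of "1 - s"] nn[of s] nn[of "1 - s"] by (cases "s > 0") (auto intro: add_pos_nonneg add_nonneg_pos)
  have mono_e: "?e s \<le> ?e t" if "s \<le> t" for s t
    using that by (auto simp: exp_step_def field_simps)
  define h where "h s = ?e s * inverse (?e s + ?e (1 - s))" for s
  have sm1: "smooth (\<lambda>s. ?e (1 - s))"
    by (rule smooth_compose[OF smooth_exp_step, of "\<lambda>s. 1 - s"]) auto
  have "smooth h" unfolding h_def[abs_def]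
    using den by (intro smooth_mult smooth_inverse smooth_add smooth_exp_step sm1) (metis less_irrefl)
  moreover have "mono h"
  proof
    fix s t :: real assume "s \<le> t"
    then have "?e s * ?e (1 - t) \<le> ?e t * ?e (1 - s)"
      using mono_e nn by (intro mult_mono) auto
    then show "h s \<le> h t" unfolding h_def using den[of s] den[of t]
      by (simp add: field_simps)
  qed
  moreover have "h s = 0" if "s \<le> 0" for s using that by (simp add: h_def exp_step_def)
  moreover have "h s = 1" if "s \<ge> 1" for s using that pos[of s] by (simp add: h_def exp_step_def)
  ultimately have "smooth_step h" by (rule smooth_step.intro)
  then show ?thesis by blast
qed

text \<open>From \<open>2 * c i * c j = (c i)^2 + (c j)^2 - (c i - c j)^2\<close>. It splits a
  quadratic form into killing, weighted by the row sums, and jumps, weighted by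
  \<open>- \<beta> i j / 2\<close>: a discrete Beurling-Deny formula.\<close>

lemma sum_sq_symmetric:
  fixes \<beta> :: "'i \<Rightarrow> 'i \<Rightarrow> real" and c :: "'i \<Rightarrow> real"
  assumes sym: "\<And>i j. i \<in> I \<Longrightarrow> j \<in> I \<Longrightarrow> \<beta> i j = \<beta> j i"
  shows "(\<Sum>i\<in>I. \<Sum>j\<in>I. c i * c j * \<beta> i j) =
    (\<Sum>i\<in>I. (c i)\<^sup>2 * (\<Sum>j\<in>I. \<beta> i j)) - (\<Sum>i\<in>I. \<Sum>j\<in>I. (c i - c j)\<^sup>2 * \<beta> i j) / 2"
proof -
  have sw: "(\<Sum>i\<in>I. \<Sum>j\<in>I. (c j)\<^sup>2 * \<beta> i j) = (\<Sum>i\<in>I. \<Sum>j\<in>I. (c i)\<^sup>2 * \<beta> i j)"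
    by (subst sum.swap) (auto intro!: sum.cong simp: sym)
  have "(\<Sum>i\<in>I. \<Sum>j\<in>I. (c i - c j)\<^sup>2 * \<beta> i j) =
      (\<Sum>i\<in>I. \<Sum>j\<in>I. (c i)\<^sup>2 * \<beta> i j) + (\<Sum>i\<in>I. \<Sum>j\<in>I. (c j)\<^sup>2 * \<beta> i j) - 2 * (\<Sum>i\<in>I. \<Sum>j\<in>I. c i * c j * \<beta> i j)"
    by (simp add: power2_diff algebra_simps sum.distrib sum_subtractf sum_distrib_left)
  moreover have "(\<Sum>i\<in>I. (c i)\<^sup>2 * (\<Sum>j\<in>I. \<beta> i j)) = (\<Sum>i\<in>I. \<Sum>j\<in>I. (c i)\<^sup>2 * \<beta> i j)"
    by (simp add: sum_distrib_left)
  ultimately show ?thesis using sw by linarith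
qed

section \<open>The energy on a grid\<close>

context gamma_limit
begin

text \<open>\<open>M\<close> bounds the killing weights; the rest bounds the jump weights and is
  half of \<open>3 ^ DIM('a) * (4 * M)\<close>, the bound for the entries of near pairs.\<close>

definition mass_bound :: real where "mass_bound = M + 2 * 3 ^ DIM('a) * M"

text \<open>At grid width \<open>1 / N\<close> the form is tested on a grid partition of unity. The off-diagonal entries are
  non-positive for cells with disjoint supports, the others are controlled by the diagonal, whose sum is
  bounded by a choice of signs. A jump to the point \<open>xs\<close> outside the domain encodes killing.\<close>

lemma grid_approximation:
  assumes xs: "xs \<notin> \<Omega>" and N: "N > 0"
  shows "\<exists>(A :: (('a \<Rightarrow> int) \<times> ('a \<Rightarrow> int) option) set) w p.
    finite A \<and> (\<forall>j\<in>A. w j \<ge> (0::real)) \<and> sum w A \<le> mass_bound \<and>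
    (\<forall>j\<in>A. fst (p j) \<in> insert xs \<Omega> \<and> snd (p j) \<in> insert xs \<Omega>) \<and>
    (\<forall>u L. test_fn \<Omega> u \<longrightarrow> L \<ge> 0 \<longrightarrow> (\<forall>x y. \<bar>u x - u y\<bar> \<le> L * norm (x - y)) \<longrightarrow>
       (\<forall>x y. u x \<noteq> 0 \<longrightarrow> norm (y - x) \<le> 3 * (real DIM('a) / N) \<longrightarrow> y \<in> \<Omega>) \<longrightarrow>
       (\<exists>v. test_fn \<Omega> v \<and> (\<forall>x. \<bar>v x - u x\<bar> \<le> L * (real DIM('a) / N)) \<and>
          \<bar>G v - (\<Sum>j\<in>A. w j * (u (fst (p j)) - u (snd (p j)))\<^sup>2)\<bar> \<le>
            2 * 3 ^ DIM('a) * M * (L * (real DIM('a) / N))\<^sup>2))"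
proof -
  obtain h where "smooth_step h" using ex_smooth_step by blast
  then interpret smooth_step h .
  let ?D = "real DIM('a) / N" and ?d = "3 ^ DIM('a) :: real"
  obtain R where R: "R > 0" "\<And>x. x \<in> \<Omega> \<Longrightarrow> norm x \<le> R" using bounded_dom bounded_pos by metis
  \<comment> \<open>Grid indices with coordinates between \<open>-m\<close> and \<open>m\<close>
    suffice for the cells to sum to one on the domain.\<close>
  obtain m :: nat where m: "N * R \<le> real m" using real_arch_simple by blast
  define Z where "Z = PiE (Basis::'a set) (\<lambda>_. {-int m..int m})"
  define \<phi> where "\<phi> = (cell N :: ('a \<Rightarrow> int) \<Rightarrow> 'a \<Rightarrow> real)"
  \<comment> \<open>Only the cells supported in the domain; their sum can fall below
    \<open>1\<close> near the boundary.\<close>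
  define I where "I = {z \<in> Z. test_fn \<Omega> (\<phi> z)}"
  have finZ: "finite Z" unfolding Z_def by (intro finite_PiE) auto
  have finI: "finite I" and IZ: "I \<subseteq> Z" using finZ by (auto simp: I_def)
  have V: "test_fn \<Omega> (\<phi> z)" if "z \<in> I" for z using that by (simp add: I_def)
  have nn: "\<phi> z x \<ge> 0" for z x by (simp add: \<phi>_def cell_nonneg)
  have sumZ: "(\<Sum>z\<in>Z. \<phi> z x) = 1" if "x \<in> \<Omega>" for x
    unfolding Z_def \<phi>_def
  proof (rule sum_cell)
    fix b :: 'a assume "b \<in> Basis"
    then have "\<bar>x \<bullet> b\<bar> \<le> R" using Basis_le_norm[of b x] R(2)[OF that] by linarith
    then have "N * \<bar>x \<bullet> b\<bar> \<le> N * R" using N by (intro mult_left_mono) auto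
    moreover have "\<bar>N * (x \<bullet> b)\<bar> = N * \<bar>x \<bullet> b\<bar>" using N by (simp add: abs_mult)
    ultimately show "\<bar>N * (x \<bullet> b)\<bar> \<le> real m" using m by linarith
  qed
  have sum_le1: "(\<Sum>z\<in>S. \<phi> z x) \<le> 1" if "S \<subseteq> I" for S x
  proof (cases "x \<in> \<Omega>")
    case True
    have "(\<Sum>z\<in>S. \<phi> z x) \<le> (\<Sum>z\<in>Z. \<phi> z x)" using that IZ nn by (intro sum_mono2 finZ) auto
    then show ?thesis using sumZ[OF True] by simp
  next
    case False
    then have "(\<Sum>z\<in>S. \<phi> z x) = 0"
      using that V test_fn_zero_outside by (intro sum.neutral) blast
    then show ?thesis by simp
  qed
  have sum_ge0: "(\<Sum>z\<in>S. \<phi> z x) \<ge> 0" for S x by (intro sum_nonneg nn)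
  have Vsum: "test_fn \<Omega> (\<lambda>x. \<Sum>z\<in>S. \<phi> z x)" if "S \<subseteq> I" for S
    using that V by (intro test_fn_sum) auto
  have G_sum: "G (\<lambda>x. \<Sum>z\<in>S. \<phi> z x) \<le> M" if "S \<subseteq> I" for S
  proof -
    have "\<bar>(\<Sum>z\<in>S. \<phi> z x) - (\<Sum>z\<in>S. \<phi> z y)\<bar> \<le> 1" for x y
      using sum_le1[OF that, of x] sum_le1[OF that, of y] sum_ge0[of x S] sum_ge0[of y S] by linarith
    from G_le_osc[OF Vsum[OF that] this] show ?thesis by simp
  qed
  define \<beta> where "\<beta> z z' = B (\<phi> z) (\<phi> z')" for z z'
  have sym: "\<beta> z z' = \<beta> z' z" if "z \<in> I" "z' \<in> I" for z z'
    unfolding \<beta>_def by (intro B_commute V that)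
  have diag0: "\<beta> z z \<ge> 0" if "z \<in> I" for z
    unfolding \<beta>_def using B_self[OF V[OF that]] Q_nonneg[OF V[OF that]] by simp
  \<comment> \<open>For suitable signs the diagonal sum is at most the energy of the signed sum of
    cells. Its oscillation is at most \<open>2\<close>, so that energy is at most
    \<open>2^2 * M\<close>, however fine the grid.\<close>
  have diag: "(\<Sum>z\<in>I. \<beta> z z) \<le> 4 * M"
  proof -
    obtain s where s: "\<And>i. s i = 1 \<or> s i = (-1::real)" "(\<Sum>z\<in>I. G (\<phi> z)) \<le> G (\<lambda>x. \<Sum>z\<in>I. s z * \<phi> z x)"
      using exists_signs[OF finI, of \<phi>] V by blast
    have t: "test_fn \<Omega> (\<lambda>x. \<Sum>z\<in>I. s z * \<phi> z x)" using V by (intro test_fn_sum test_fn_cmult)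
    have "\<bar>\<Sum>z\<in>I. s z * \<phi> z x\<bar> \<le> 1" for x
    proof -
      have "\<bar>s z * \<phi> z x\<bar> = \<phi> z x" for z using s(1)[of z] nn[of z x] by (auto simp: abs_mult)
      then have "\<bar>\<Sum>z\<in>I. s z * \<phi> z x\<bar> \<le> (\<Sum>z\<in>I. \<phi> z x)" using sum_abs[of "\<lambda>z. s z * \<phi> z x" I] by simp
      then show ?thesis using sum_le1[of I x] by simp
    qed
    then have "\<bar>(\<Sum>z\<in>I. s z * \<phi> z x) - (\<Sum>z\<in>I. s z * \<phi> z y)\<bar> \<le> 1 + 1" for x y
      by (meson abs_triangle_ineq4 add_mono order_trans)
    from G_le_osc[OF t this] s(2) show ?thesis by (simp add: \<beta>_def B_self V)
  qed
  define nb where "nb z = {z' \<in> I. near z z'}" for z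
  have nb: "finite (nb z)" "real (card (nb z)) \<le> ?d" "nb z \<subseteq> I" for z
  proof -
    show "finite (nb z)" "nb z \<subseteq> I" using finI by (auto simp: nb_def)
    have "card (nb z) \<le> 3 ^ DIM('a)" unfolding nb_def using IZ unfolding Z_def by (rule card_near)
    then show "real (card (nb z)) \<le> ?d" by (metis of_nat_le_iff of_nat_numeral of_nat_power)
  qed
  \<comment> \<open>Each entry is at most the mean of two diagonal entries, and each diagonal entry
    is met at most \<open>3 ^ DIM('a)\<close> times from either side.\<close>
  have near_sum: "(\<Sum>z\<in>I. \<Sum>z'\<in>nb z. \<bar>\<beta> z z'\<bar>) \<le> ?d * (4 * M)"
  proof -
    have "(\<Sum>z\<in>I. \<Sum>z'\<in>nb z. \<bar>\<beta> z z'\<bar>) \<le> (\<Sum>z\<in>I. \<Sum>z'\<in>nb z. \<beta> z z / 2 + \<beta> z' z' / 2)"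
    proof (intro sum_mono)
      fix z z' assume "z \<in> I" "z' \<in> nb z"
      then have "z \<in> I" "z' \<in> I" using nb(3) by auto
      then show "\<bar>\<beta> z z'\<bar> \<le> \<beta> z z / 2 + \<beta> z' z' / 2"
        unfolding \<beta>_def using B_abs_le[OF V V, of z z'] by (simp add: B_self V add_divide_distrib)
    qed
    also have "\<dots> = (\<Sum>z\<in>I. \<Sum>z'\<in>nb z. \<beta> z z / 2) + (\<Sum>z\<in>I. \<Sum>z'\<in>nb z. \<beta> z' z' / 2)"
      by (simp add: sum.distrib)
    also have "(\<Sum>z\<in>I. \<Sum>z'\<in>nb z. \<beta> z' z' / 2) = (\<Sum>z'\<in>I. \<Sum>z\<in>nb z'. \<beta> z' z' / 2)"
      unfolding nb_def using finI by (subst sum.swap_restrict) (auto simp: near_commute)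
    also have "(\<Sum>z\<in>I. \<Sum>z'\<in>nb z. \<beta> z z / 2) + (\<Sum>z\<in>I. \<Sum>z'\<in>nb z. \<beta> z z / 2) = (\<Sum>z\<in>I. real (card (nb z)) * \<beta> z z)"
      by (simp add: mult.commute flip: sum.distrib)
    also have "\<dots> \<le> (\<Sum>z\<in>I. ?d * \<beta> z z)" by (intro sum_mono mult_right_mono nb diag0)
    also have "\<dots> = ?d * (\<Sum>z\<in>I. \<beta> z z)" by (simp add: sum_distrib_left)
    also have "\<dots> \<le> ?d * (4 * M)" using diag by (intro mult_left_mono) auto
    finally show ?thesis .
  qed
  have far: "\<beta> z z' \<le> 0" if "z \<in> I" "z' \<in> I" "\<not> near z z'" for z z'
    unfolding \<beta>_def using cell_disjoint[OF that(3)] nn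
    by (intro B_disjoint_nonpos V that) (auto simp: \<phi>_def)
  define \<psi> where "\<psi> x = (\<Sum>z\<in>I. \<phi> z x)" for x
  have V\<psi>: "test_fn \<Omega> \<psi>" unfolding \<psi>_def[abs_def] by (rule Vsum) simp
  have \<kappa>eq: "B \<psi> (\<phi> z) = (\<Sum>z'\<in>I. \<beta> z z')" if "z \<in> I" for z
  proof -
    have "B \<psi> (\<phi> z) = (\<Sum>z'\<in>I. 1 * B (\<phi> z') (\<phi> z))"
      unfolding \<psi>_def[abs_def] using B_sum_left[of I \<phi> "\<phi> z" "\<lambda>_. 1"] V that by simp
    also have "\<dots> = (\<Sum>z'\<in>I. \<beta> z z')" using sym that by (intro sum.cong) (auto simp: \<beta>_def)
    finally show ?thesis .
  qed
  have split_near: "(\<Sum>z\<in>I. \<Sum>z'\<in>I. g z z') =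
      (\<Sum>z\<in>I. \<Sum>z'\<in>nb z. g z z') + (\<Sum>z\<in>I. \<Sum>z'\<in>I - nb z. g z z')" for g :: "_ \<Rightarrow> _ \<Rightarrow> real"
    unfolding sum.distrib[symmetric]
  proof (rule sum.cong[OF refl])
    fix z
    show "(\<Sum>z'\<in>I. g z z') = (\<Sum>z'\<in>nb z. g z z') + (\<Sum>z'\<in>I - nb z. g z z')"
      using sum.subset_diff[OF nb(3) finI, of "g z" z] by simp
  qed
  \<comment> \<open>The total of all entries is \<open>G \<psi>\<close>, which is non-negative, so
    the far entries are outweighed by the near ones.\<close>
  have far_sum: "(\<Sum>z\<in>I. \<Sum>z'\<in>I - nb z. - \<beta> z z') \<le> ?d * (4 * M)"
  proof -
    have "0 \<le> G \<psi>" by (rule Q_nonneg[OF V\<psi>])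
    also have "G \<psi> = (\<Sum>z\<in>I. \<Sum>z'\<in>I. \<beta> z z')"
      unfolding \<psi>_def[abs_def] using Q_sum[of I \<phi> "\<lambda>_. 1"] V by (simp add: \<beta>_def)
    also have "\<dots> = (\<Sum>z\<in>I. \<Sum>z'\<in>nb z. \<beta> z z') + (\<Sum>z\<in>I. \<Sum>z'\<in>I - nb z. \<beta> z z')"
      by (rule split_near)
    also have "(\<Sum>z\<in>I. \<Sum>z'\<in>nb z. \<beta> z z') \<le> (\<Sum>z\<in>I. \<Sum>z'\<in>nb z. \<bar>\<beta> z z'\<bar>)" by (intro sum_mono) simp
    also note near_sum
    finally show ?thesis by (simp add: sum_negf)
  qed
  \<comment> \<open>Cells on which the partition of unity is complete, so that \<open>\<psi>\<close>
    is a plateau for them. There the row sum \<open>B \<psi> (\<phi> z)\<close>, the killing rate,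
    is non-negative.\<close>
  define good where "good z \<longleftrightarrow> (\<forall>x. \<phi> z x \<noteq> 0 \<longrightarrow> \<psi> x = 1)" for z
  have \<kappa>0: "B \<psi> (\<phi> z) \<ge> 0" if "z \<in> I" "good z" for z
    by (rule B_plateau_nonneg[OF V[OF that(1)] nn V\<psi>])
      (use that(2) sum_le1[of I] in \<open>auto simp: good_def \<psi>_def\<close>)
  \<comment> \<open>These rates add up to the polar form of \<open>\<psi>\<close> and the sum of the
    good cells, which is at most the mean of two energies bounded by \<open>M\<close>.\<close>
  have \<kappa>sum: "(\<Sum>z\<in>{z\<in>I. good z}. B \<psi> (\<phi> z)) \<le> M"
  proof -
    let ?S = "{z\<in>I. good z}"
    let ?f = "\<lambda>x. \<Sum>z\<in>?S. \<phi> z x"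
    have tf: "test_fn \<Omega> ?f" by (rule Vsum) auto
    have "(\<Sum>z\<in>?S. B \<psi> (\<phi> z)) = (\<Sum>z\<in>?S. 1 * B (\<phi> z) \<psi>)"
      using B_commute[OF V\<psi>] V by (intro sum.cong) auto
    also have "\<dots> = B ?f \<psi>" using B_sum_left[of ?S \<phi> \<psi> "\<lambda>_. 1"] V V\<psi> by simp
    also have "\<dots> \<le> (G ?f + G \<psi>) / 2" using B_abs_le[OF tf V\<psi>] by linarith
    also have "\<dots> \<le> M" using G_sum[of ?S] G_sum[of I] unfolding \<psi>_def[abs_def] by auto
    finally show ?thesis .
  qed
  \<comment> \<open>\<open>None\<close> is the jump to \<open>xs\<close>, that is killing. Near
    pairs get weight \<open>0\<close> and become the error term. So do cells that are not good; the
    functions \<open>u\<close> considered below vanish at their centres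
    (\<open>goodz\<close>).\<close>
  define w where "w j = (case j of (z, None) \<Rightarrow> if good z then B \<psi> (\<phi> z) else 0
      | (z, Some z') \<Rightarrow> if near z z' then 0 else - \<beta> z z' / 2)" for j
  define p where "p j = (case j of (z, None) \<Rightarrow> (centre N z, xs) | (z, Some z') \<Rightarrow> (centre N z, centre N z'))"
    for j :: "('a \<Rightarrow> int) \<times> ('a \<Rightarrow> int) option"
  define A where "A = I \<times> insert None (Some ` I)"
  have centre_in: "centre N z \<in> \<Omega>" if "z \<in> I" for z
  proof (rule ccontr)
    assume "centre N z \<notin> \<Omega>"
    then have "\<phi> z (centre N z) = 0" using test_fn_zero_outside[OF V[OF that]] by blast
    \<comment> \<open>All factors are \<open>hat 0 = h 1 - h 0 = 1\<close>.\<close>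
    moreover have "\<phi> z (centre N z) = 1"
      unfolding \<phi>_def cell_def using N h_0[of 0] h_1[of 1] by (simp add: centre_inner hat_def)
    ultimately show False by simp
  qed
  have sumA: "(\<Sum>j\<in>A. g j) = (\<Sum>z\<in>I. g (z, None)) + (\<Sum>z\<in>I. \<Sum>z'\<in>I. g (z, Some z'))"
    for g :: "_ \<Rightarrow> real"
    unfolding A_def using finI
    by (simp add: sum.cartesian_product' sum.distrib sum.reindex inj_on_def)
  have wSome: "(\<Sum>z\<in>I. \<Sum>z'\<in>I. w (z, Some z') * k z z') = (\<Sum>z\<in>I. \<Sum>z'\<in>I - nb z. - \<beta> z z' * k z z') / 2"
    for k :: "_ \<Rightarrow> _ \<Rightarrow> real"
  proof -
    have "(\<Sum>z'\<in>I. w (z, Some z') * k z z') = (\<Sum>z'\<in>I - nb z. - \<beta> z z' * k z z' / 2)" if "z \<in> I" for z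
      using finI by (intro sum.mono_neutral_cong_right) (auto simp: w_def nb_def)
    then show ?thesis by (simp add: sum_divide_distrib)
  qed
  have wNone: "(\<Sum>z\<in>I. w (z, None) * k z) = (\<Sum>z\<in>{z\<in>I. good z}. B \<psi> (\<phi> z) * k z)" for k :: "_ \<Rightarrow> real"
    using finI by (intro sum.mono_neutral_cong_right) (auto simp: w_def)
  have c1: "finite A" using finI by (simp add: A_def)
  have c2: "w j \<ge> 0" if "j \<in> A" for j
    using that \<kappa>0 far by (auto simp: A_def w_def split: option.splits)
  have c3: "sum w A \<le> mass_bound"
  proof -
    have "sum w A = (\<Sum>z\<in>{z\<in>I. good z}. B \<psi> (\<phi> z)) + (\<Sum>z\<in>I. \<Sum>z'\<in>I - nb z. - \<beta> z z') / 2"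
      unfolding sumA using wNone[of "\<lambda>_. 1"] wSome[of "\<lambda>_ _. 1"] by simp
    also have "\<dots> \<le> M + ?d * (4 * M) / 2" by (intro add_mono divide_right_mono \<kappa>sum far_sum) simp
    finally show ?thesis by (simp add: mass_bound_def mult_ac)
  qed
  have c4: "fst (p j) \<in> insert xs \<Omega> \<and> snd (p j) \<in> insert xs \<Omega>" if "j \<in> A" for j
    using that centre_in by (auto simp: A_def p_def)
  have c5: "\<exists>v. test_fn \<Omega> v \<and> (\<forall>x. \<bar>v x - u x\<bar> \<le> L * ?D) \<and>
      \<bar>G v - (\<Sum>j\<in>A. w j * (u (fst (p j)) - u (snd (p j)))\<^sup>2)\<bar> \<le> 2 * ?d * M * (L * ?D)\<^sup>2"
    if u: "test_fn \<Omega> u" and L: "L \<ge> 0" "\<And>x y. \<bar>u x - u y\<bar> \<le> L * norm (x - y)"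
      and inside: "\<And>x y. u x \<noteq> 0 \<Longrightarrow> norm (y - x) \<le> 3 * ?D \<Longrightarrow> y \<in> \<Omega>" for u L
  proof -
    have D0: "?D \<ge> 0" using N by simp
    have dist: "norm (x - centre N z) \<le> ?D" if "\<phi> z x \<noteq> 0" for z x
      using that cell_nonzero[of N z x] by (intro dist_centre[OF N] less_imp_le) (auto simp: \<phi>_def)
    \<comment> \<open>Origin of the factor \<open>3\<close>: a distance \<open>2 * ?D\<close> from
      \<open>x\<close> to the centre plus the cell radius \<open>?D\<close>.\<close>
    have in_I: "z \<in> I" if "z \<in> Z" "u x \<noteq> 0" "norm (centre N z - x) \<le> 2 * ?D" for z x
    proof -
      have sub: "cball (centre N z) ?D \<subseteq> \<Omega>"
      proof
        fix y assume "y \<in> cball (centre N z) ?D"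
        then have "norm (y - x) \<le> 3 * ?D"
          using norm_triangle_ineq[of "y - centre N z" "centre N z - x"] that(3)
          by (simp add: dist_norm norm_minus_commute)
        then show "y \<in> \<Omega>" by (rule inside[OF that(2)])
      qed
      have "\<phi> z y = 0" if "y \<notin> cball (centre N z) ?D" for y
        using dist[of z y] that by (auto simp: dist_norm norm_minus_commute)
      then have "test_fn \<Omega> (\<phi> z)"
        using smooth_cell sub by (intro test_fnI[where K="cball (centre N z) ?D"]) (auto simp: \<phi>_def)
      then show ?thesis using that(1) by (simp add: I_def)
    qed
    \<comment> \<open>Interpolates \<open>u\<close> between the grid points, so that
      \<open>G v\<close> is a finite sum over pairs of cells.\<close>
    define v where "v x = (\<Sum>z\<in>I. u (centre N z) * \<phi> z x)" for x
    have tv: "test_fn \<Omega> v" unfolding v_def[abs_def] using V by (intro test_fn_sum test_fn_cmult)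
    have close: "\<bar>v x - u x\<bar> \<le> L * ?D" for x
    proof (cases "x \<in> \<Omega>")
      case False
      then show ?thesis
        using test_fn_zero_outside[OF u False] test_fn_zero_outside[OF tv False] mult_nonneg_nonneg[OF L(1) D0] by simp
    next
      case True
      have "u x = (\<Sum>z\<in>Z. u x * \<phi> z x)" using sumZ[OF True] by (simp flip: sum_distrib_left)
      also have "\<dots> = (\<Sum>z\<in>I. u x * \<phi> z x)"
      proof (rule sum.mono_neutral_right[OF finZ IZ], rule ballI)
        fix z assume z: "z \<in> Z - I"
        show "u x * \<phi> z x = 0"
        proof (rule ccontr)
          assume "u x * \<phi> z x \<noteq> 0"
          then have "u x \<noteq> 0" "norm (centre N z - x) \<le> 2 * ?D"
            using dist[of z x] D0 by (auto simp: norm_minus_commute)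
          then show False using in_I z by blast
        qed
      qed
      finally have "v x - u x = (\<Sum>z\<in>I. (u (centre N z) - u x) * \<phi> z x)"
        by (simp add: v_def left_diff_distrib sum_subtractf)
      then have "\<bar>v x - u x\<bar> \<le> (\<Sum>z\<in>I. \<bar>(u (centre N z) - u x) * \<phi> z x\<bar>)" by simp
      also have "\<dots> \<le> (\<Sum>z\<in>I. L * ?D * \<phi> z x)"
      proof (rule sum_mono)
        fix z
        show "\<bar>(u (centre N z) - u x) * \<phi> z x\<bar> \<le> L * ?D * \<phi> z x"
        proof (cases "\<phi> z x = 0")
          case False
          have "\<bar>u (centre N z) - u x\<bar> \<le> L * norm (centre N z - x)" by (rule L(2))
          also have "\<dots> \<le> L * ?D" using dist[OF False] L(1) by (intro mult_left_mono) (auto simp: norm_minus_commute)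
          finally show ?thesis using nn[of z x] by (simp only: abs_mult abs_of_nonneg mult_right_mono)
        qed simp
      qed
      also have "\<dots> = L * ?D * (\<Sum>z\<in>I. \<phi> z x)" by (simp add: sum_distrib_left)
      also have "\<dots> \<le> L * ?D * 1" using sum_le1[of I x] by (intro mult_left_mono mult_nonneg_nonneg L(1) D0) auto
      finally show ?thesis by simp
    qed
    let ?u = "\<lambda>z. u (centre N z)"
    \<comment> \<open>A cell that overlaps cell \<open>z\<close> has its centre within
      \<open>2 * ?D\<close> of a point where \<open>u\<close> does not vanish, so it belongs to
      \<open>I\<close>.\<close>
    have goodz: "good z" if "z \<in> I" "?u z \<noteq> 0" for z
      unfolding good_def
    proof (intro allI impI)
      fix x assume x: "\<phi> z x \<noteq> 0"
      have dx: "norm (x - centre N z) \<le> ?D" by (rule dist[OF x])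
      have xO: "x \<in> \<Omega>" using inside[OF that(2), of x] dx D0 by simp
      have "(\<Sum>z'\<in>Z. \<phi> z' x) = (\<Sum>z'\<in>I. \<phi> z' x)"
      proof (rule sum.mono_neutral_right[OF finZ IZ], rule ballI)
        fix z' assume z': "z' \<in> Z - I"
        show "\<phi> z' x = 0"
        proof (rule ccontr)
          assume "\<phi> z' x \<noteq> 0"
          from dist[OF this] have "norm (centre N z' - centre N z) \<le> 2 * ?D"
            using norm_triangle_ineq[of "centre N z' - x" "x - centre N z"] dx by (simp add: norm_minus_commute)
          then show False using in_I that(2) z' by blast
        qed
      qed
      then show "\<psi> x = 1" using sumZ[OF xO] by (simp add: \<psi>_def)
    qed
    have uxs: "u xs = 0" using test_fn_zero_outside[OF u xs] by simp
    have "(\<Sum>j\<in>A. w j * (u (fst (p j)) - u (snd (p j)))\<^sup>2) =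
       (\<Sum>z\<in>{z\<in>I. good z}. B \<psi> (\<phi> z) * (?u z)\<^sup>2) + (\<Sum>z\<in>I. \<Sum>z'\<in>I - nb z. - \<beta> z z' * (?u z - ?u z')\<^sup>2) / 2"
      unfolding sumA using wNone[of "\<lambda>z. (?u z)\<^sup>2"] wSome[of "\<lambda>z z'. (?u z - ?u z')\<^sup>2"] by (simp add: p_def uxs)
    also have "(\<Sum>z\<in>{z\<in>I. good z}. B \<psi> (\<phi> z) * (?u z)\<^sup>2) = (\<Sum>z\<in>I. (?u z)\<^sup>2 * (\<Sum>z'\<in>I. \<beta> z z'))"
      using finI goodz by (intro sum.mono_neutral_cong_left) (auto simp: \<kappa>eq)
    finally have S: "(\<Sum>j\<in>A. w j * (u (fst (p j)) - u (snd (p j)))\<^sup>2) =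
       (\<Sum>z\<in>I. (?u z)\<^sup>2 * (\<Sum>z'\<in>I. \<beta> z z')) - (\<Sum>z\<in>I. \<Sum>z'\<in>I - nb z. (?u z - ?u z')\<^sup>2 * \<beta> z z') / 2"
      by (simp add: sum_negf mult.commute)
    have "G v = (\<Sum>z\<in>I. \<Sum>z'\<in>I. ?u z * ?u z' * \<beta> z z')"
      unfolding v_def[abs_def] \<beta>_def using V by (intro Q_sum)
    also have "\<dots> = (\<Sum>z\<in>I. (?u z)\<^sup>2 * (\<Sum>z'\<in>I. \<beta> z z')) - (\<Sum>z\<in>I. \<Sum>z'\<in>I. (?u z - ?u z')\<^sup>2 * \<beta> z z') / 2"
      using sym by (intro sum_sq_symmetric)
    also have "(\<Sum>z\<in>I. \<Sum>z'\<in>I. (?u z - ?u z')\<^sup>2 * \<beta> z z') =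
        (\<Sum>z\<in>I. \<Sum>z'\<in>nb z. (?u z - ?u z')\<^sup>2 * \<beta> z z') + (\<Sum>z\<in>I. \<Sum>z'\<in>I - nb z. (?u z - ?u z')\<^sup>2 * \<beta> z z')"
      by (rule split_near)
    \<comment> \<open>Only near pairs remain; there \<open>u\<close> changes by at most
      \<open>L * ?D\<close>, and \<open>near_sum\<close> bounds their entries.\<close>
    finally have "G v - (\<Sum>j\<in>A. w j * (u (fst (p j)) - u (snd (p j)))\<^sup>2) =
        - (\<Sum>z\<in>I. \<Sum>z'\<in>nb z. (?u z - ?u z')\<^sup>2 * \<beta> z z') / 2"
      unfolding S by argo
    then have err: "\<bar>G v - (\<Sum>j\<in>A. w j * (u (fst (p j)) - u (snd (p j)))\<^sup>2)\<bar> =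
        \<bar>\<Sum>z\<in>I. \<Sum>z'\<in>nb z. (?u z - ?u z')\<^sup>2 * \<beta> z z'\<bar> / 2" by simp
    have "\<bar>\<Sum>z\<in>I. \<Sum>z'\<in>nb z. (?u z - ?u z')\<^sup>2 * \<beta> z z'\<bar> \<le> (\<Sum>z\<in>I. \<Sum>z'\<in>nb z. \<bar>(?u z - ?u z')\<^sup>2 * \<beta> z z'\<bar>)"
      by (rule order_trans[OF sum_abs sum_mono[OF sum_abs]])
    also have "\<dots> \<le> (\<Sum>z\<in>I. \<Sum>z'\<in>nb z. (L * ?D)\<^sup>2 * \<bar>\<beta> z z'\<bar>)"
    proof (intro sum_mono)
      fix z z' assume "z' \<in> nb z"
      then have "near z z'" by (simp add: nb_def)
      have "\<bar>?u z - ?u z'\<bar> \<le> L * norm (centre N z - centre N z')" by (rule L(2))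
      also have "\<dots> \<le> L * ?D" using near_dist_centre[OF N \<open>near z z'\<close>] L(1) by (intro mult_left_mono)
      finally have "(?u z - ?u z')\<^sup>2 \<le> (L * ?D)\<^sup>2" using power_mono[OF _ abs_ge_zero, of "?u z - ?u z'" "L * ?D" 2] by simp
      then show "\<bar>(?u z - ?u z')\<^sup>2 * \<beta> z z'\<bar> \<le> (L * ?D)\<^sup>2 * \<bar>\<beta> z z'\<bar>"
        by (simp only: abs_mult abs_power2) (intro mult_right_mono, auto)
    qed
    also have "\<dots> = (L * ?D)\<^sup>2 * (\<Sum>z\<in>I. \<Sum>z'\<in>nb z. \<bar>\<beta> z z'\<bar>)" by (simp add: sum_distrib_left)
    also have "\<dots> \<le> (L * ?D)\<^sup>2 * (?d * (4 * M))" by (intro mult_left_mono near_sum) auto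
    also have "\<dots> = 2 * (2 * ?d * M * (L * ?D)\<^sup>2)" by (simp only: mult_ac)
    finally have "\<bar>G v - (\<Sum>j\<in>A. w j * (u (fst (p j)) - u (snd (p j)))\<^sup>2)\<bar> \<le> 2 * ?d * M * (L * ?D)\<^sup>2"
      unfolding err by linarith
    with tv close show ?thesis by blast
  qed
  show ?thesis
    by (rule exI[of _ A], rule exI[of _ w], rule exI[of _ p]) (use c1 c2 c3 c4 c5 in simp)
qed

end

subsection \<open>Weak compactness of discrete measures\<close>

text \<open>Schoenberg's function: even, of period \<open>2\<close>, equal to \<open>0\<close> on
  \<open>[0, 1/3]\<close> and to \<open>1\<close> on \<open>[2/3, 1]\<close>. A truncated cosine
  does this since \<open>cos (pi / 3) = 1 / 2\<close>.\<close>

definition zigzag :: "real \<Rightarrow> real" where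
  "zigzag t = min 1 (max 0 (1 / 2 - cos (pi * t)))"

lemma zigzag_continuous: "continuous_on S zigzag"
  unfolding zigzag_def[abs_def] by (intro continuous_intros)

lemma zigzag_bounds: "0 \<le> zigzag t" "zigzag t \<le> 1"
  by (auto simp: zigzag_def)

lemma zigzag_periodic: "zigzag (2 * of_int m + s) = zigzag s"
proof -
  have "cos (pi * (2 * of_int m + s)) = cos (pi * s + 2 * pi * of_int m)"
    by (simp add: algebra_simps)
  also have "\<dots> = cos (pi * s)"
    by (metis cos_add cos_int_2pin mult.commute mult_1 mult_zero_right diff_zero sin_int_2pin)
  finally show ?thesis by (simp add: zigzag_def)
qed

lemma zigzag_digit:
  assumes "a = 0 \<or> a = 1" "2 * a / 3 \<le> s" "s \<le> 2 * a / 3 + 1 / 3"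
  shows "zigzag s = a"
  using assms(1)
proof
  assume a: "a = 0"
  then have "pi * s \<le> pi / 3" "0 \<le> pi * s" using assms by (auto simp: field_simps)
  then have "cos (pi * s) \<ge> cos (pi / 3)" by (intro cos_monotone_0_pi_le) auto
  then show ?thesis using a by (simp add: zigzag_def cos_60)
next
  assume a: "a = 1"
  then have b: "2 * pi / 3 \<le> pi * s" "pi * s \<le> pi" using assms by (auto simp: field_simps)
  have "cos (pi * s) \<le> cos (2 * pi / 3)" using b by (intro cos_monotone_0_pi_le) auto
  then show ?thesis using a by (simp add: zigzag_def cos_120)
qed

lemma binary_expansion:
  fixes c :: real
  assumes "0 \<le> c" "c < 1"
  obtains a :: "nat \<Rightarrow> real" where "\<And>k. a k = 0 \<or> a k = 1" "(\<lambda>k. a k / 2 ^ Suc k) sums c"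
proof
  let ?f = "\<lambda>k. \<lfloor>2 ^ k * c\<rfloor>"
  \<comment> \<open>Digits as differences of successive floors, so that the partial sums telescope
    to \<open>floor (2 ^ n * c) / 2 ^ n\<close>.\<close>
  let ?a = "\<lambda>k. real_of_int (?f (Suc k) - 2 * ?f k)"
  show "?a k = 0 \<or> ?a k = 1" for k
  proof -
    have "2 * ?f k \<le> ?f (Suc k)" "?f (Suc k) \<le> 2 * ?f k + 1" by (simp_all add: mult.assoc) linarith+
    then have "?f (Suc k) - 2 * ?f k = 0 \<or> ?f (Suc k) - 2 * ?f k = 1" by linarith
    then show ?thesis by auto
  qed
  have part: "(\<Sum>k<n. ?a k / 2 ^ Suc k) = real_of_int (?f n) / 2 ^ n" for n
  proof (induction n)
    case 0
    have "\<lfloor>c\<rfloor> = 0" using assms by linarith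
    then show ?case by simp
  next
    case (Suc n)
    then show ?case by (simp add: field_simps)
  qed
  have "(\<lambda>n. real_of_int (?f n) / 2 ^ n) \<longlonglongrightarrow> c"
  proof (rule tendsto_sandwich)
    show "\<forall>\<^sub>F n in sequentially. c - (1 / 2) ^ n \<le> real_of_int (?f n) / 2 ^ n"
    proof (intro always_eventually allI)
      fix n
      have "2 ^ n * c - 1 \<le> real_of_int (?f n)" by linarith
      then have "(2 ^ n * c - 1) / 2 ^ n \<le> real_of_int (?f n) / 2 ^ n" by (intro divide_right_mono) auto
      then show "c - (1 / 2) ^ n \<le> real_of_int (?f n) / 2 ^ n" by (simp add: diff_divide_distrib power_one_over)
    qed
    show "\<forall>\<^sub>F n in sequentially. real_of_int (?f n) / 2 ^ n \<le> c"
      by (intro always_eventually allI) (simp add: field_simps)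
    have "(\<lambda>n. c - (1 / 2) ^ n) \<longlonglongrightarrow> c - 0" by (intro tendsto_intros LIMSEQ_power_zero) simp
    then show "(\<lambda>n. c - (1 / 2) ^ n) \<longlonglongrightarrow> c" by simp
  qed simp
  then show "(\<lambda>k. ?a k / 2 ^ Suc k) sums c" unfolding sums_def part .
qed

text \<open>\<open>t\<close> has the ternary digits \<open>2 * A n\<close>. They are even, so
  \<open>3 ^ n * t\<close> is an even integer, invisible to \<open>zigzag\<close>, plus a remainder
  \<open>r n\<close> whose leading digit \<open>2 * A n\<close> places it where
  \<open>zigzag\<close> equals \<open>A n\<close>.\<close>

lemma ternary_code:
  fixes A :: "nat \<Rightarrow> real"
  assumes A: "\<And>n. A n = 0 \<or> A n = 1"
  obtains t where "0 \<le> t" "t \<le> 1" "\<And>n. zigzag (3 ^ n * t) = A n"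
proof -
  have A01: "0 \<le> A n" "A n \<le> 1" for n using A[of n] by auto
  have geo: "(\<lambda>i. 2 / 3 ^ Suc i :: real) sums 1"
    using sums_mult[OF geometric_sums[of "1/3::real"], of "2/3"] by (simp add: power_one_over field_simps)
  have summ: "summable (\<lambda>i. 2 * A (i + n) / 3 ^ Suc i)" for n
    by (rule summable_comparison_test'[OF sums_summable[OF geo], of 0]) (use A01 in \<open>auto simp: divide_right_mono\<close>)
  define r where "r n = (\<Sum>i. 2 * A (i + n) / 3 ^ Suc i)" for n
  have r: "0 \<le> r n" "r n \<le> 1" for n
  proof -
    show "0 \<le> r n" unfolding r_def by (intro suminf_nonneg summ) (use A01 in auto)
    have "r n \<le> (\<Sum>i. 2 / 3 ^ Suc i)" unfolding r_def
      by (intro suminf_le summ sums_summable[OF geo]) (use A01 in \<open>auto simp: divide_right_mono\<close>)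
    then show "r n \<le> 1" using sums_unique[OF geo] by simp
  qed
  have rec: "r n = 2 * A n / 3 + r (Suc n) / 3" for n
  proof -
    have "r n = 2 * A n / 3 + (\<Sum>i. 2 * A (Suc i + n) / 3 ^ Suc (Suc i))"
      unfolding r_def using suminf_split_head[OF summ[of n]] by simp
    also have "(\<Sum>i. 2 * A (Suc i + n) / 3 ^ Suc (Suc i)) = (\<Sum>i. (2 * A (i + Suc n) / 3 ^ Suc i) / 3)"
      by (simp add: field_simps)
    also have "\<dots> = r (Suc n) / 3" unfolding r_def by (rule suminf_divide[OF summ])
    finally show ?thesis .
  qed
  have ex: "\<exists>m. 3 ^ n * r 0 = 2 * real_of_int m + r n" for n
  proof (induction n)
    case 0
    show ?case by (intro exI[of _ 0]) simp
  next
    case (Suc n)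
    then obtain m where m: "3 ^ n * r 0 = 2 * real_of_int m + r n" by blast
    obtain k :: int where k: "A n = of_int k" using A[of n] by (metis of_int_0 of_int_1)
    have "3 ^ Suc n * r 0 = 3 * (3 ^ n * r 0)" by simp
    also have "\<dots> = 2 * real_of_int (3 * m + k) + r (Suc n)"
      unfolding m using rec[of n] k by simp
    finally show ?case by blast
  qed
  show thesis
  proof (rule that[OF r(1)[of 0] r(2)[of 0]])
    fix n
    obtain m where m: "3 ^ n * r 0 = 2 * real_of_int m + r n" using ex by blast
    have "zigzag (r n) = A n"
      using rec[of n] r[of "Suc n"] by (intro zigzag_digit[OF A]) auto
    then show "zigzag (3 ^ n * r 0) = A n" unfolding m zigzag_periodic .
  qed
qed

text \<open>Schoenberg's space-filling curve: the ternary digits of the parameter are distributed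
  over the binary digits of the coordinates.\<close>

lemma space_filling_curve:
  fixes R :: real
  obtains q :: "real \<Rightarrow> 'b::euclidean_space" where "continuous_on UNIV q" "bounded (range q)"
    "\<And>y. norm y \<le> R \<Longrightarrow> \<exists>t. 0 \<le> t \<and> t \<le> 1 \<and> q t = y"
proof -
  let ?d = "DIM('b)"
  obtain idx :: "'b \<Rightarrow> nat" where idx: "bij_betw idx Basis {0..<?d}"
    using ex_bij_betw_finite_nat[OF finite_Basis] by blast
  define s where "s b t = (\<Sum>k. zigzag (3 ^ (?d * k + idx b) * t) / 2 ^ Suc k)" for b t
  have geo: "(\<lambda>k. 1 / 2 ^ Suc k :: real) sums 1"
    using power_half_series by (simp add: power_one_over)
  have summ: "summable (\<lambda>k. zigzag (3 ^ (?d * k + idx b) * t) / 2 ^ Suc k)" for b t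
    by (rule summable_comparison_test'[OF sums_summable[OF geo], of 0])
      (use zigzag_bounds in \<open>auto simp: divide_right_mono\<close>)
  have s01: "0 \<le> s b t" "s b t \<le> 1" for b t
  proof -
    show "0 \<le> s b t" unfolding s_def by (intro suminf_nonneg summ) (use zigzag_bounds in auto)
    have "s b t \<le> (\<Sum>k. 1 / 2 ^ Suc k)" unfolding s_def
      by (intro suminf_le summ sums_summable[OF geo]) (use zigzag_bounds in \<open>auto simp: divide_right_mono\<close>)
    then show "s b t \<le> 1" using sums_unique[OF geo] by simp
  qed
  have s_cont: "continuous_on UNIV (s b)" for b
  proof (rule uniform_limit_theorem[where F=sequentially])
    show "uniform_limit UNIV (\<lambda>n t. \<Sum>k<n. zigzag (3 ^ (?d * k + idx b) * t) / 2 ^ Suc k) (s b) sequentially"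
      unfolding s_def[abs_def]
      by (rule Weierstrass_m_test[OF _ sums_summable[OF geo]]) (use zigzag_bounds in \<open>auto simp: divide_right_mono\<close>)
    have "continuous_on UNIV (\<lambda>t. zigzag (c * t))" for c
      by (rule continuous_on_compose2[OF zigzag_continuous[of UNIV]]) (auto intro!: continuous_intros)
    then show "\<forall>\<^sub>F n in sequentially. continuous_on UNIV (\<lambda>t. \<Sum>k<n. zigzag (3 ^ (?d * k + idx b) * t) / 2 ^ Suc k)"
      by (intro always_eventually allI continuous_on_sum continuous_on_divide continuous_intros) auto
  qed simp
  \<comment> \<open>Positive and strictly larger than \<open>R\<close>, so that the rescaled
    coordinates stay below \<open>1\<close>, as \<open>binary_expansion\<close> demands.\<close>
  define R' where "R' = \<bar>R\<bar> + 1"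
  define q where "q t = (\<Sum>b\<in>(Basis::'b set). ((2 * s b t - 1) * R') *\<^sub>R b)" for t
  have "continuous_on UNIV q" unfolding q_def[abs_def] by (intro continuous_intros s_cont)
  moreover have "bounded (range q)"
  proof (rule boundedI)
    fix y assume "y \<in> range q"
    then obtain t where y: "y = q t" by auto
    have "norm y \<le> (\<Sum>b\<in>(Basis::'b set). norm (((2 * s b t - 1) * R') *\<^sub>R b))" unfolding y q_def by (rule norm_sum)
    also have "\<dots> \<le> (\<Sum>b\<in>(Basis::'b set). R')"
    proof (rule sum_mono)
      fix b :: 'b assume "b \<in> Basis"
      have "\<bar>2 * s b t - 1\<bar> \<le> 1" using s01[of b t] by auto
      then have "\<bar>2 * s b t - 1\<bar> * R' \<le> 1 * R'" by (intro mult_right_mono) (auto simp: R'_def)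
      then show "norm (((2 * s b t - 1) * R') *\<^sub>R b) \<le> R'"
        using \<open>b \<in> Basis\<close> by (simp add: abs_mult R'_def)
    qed
    finally show "norm y \<le> (\<Sum>b\<in>(Basis::'b set). R')" .
  qed
  moreover have "\<exists>t. 0 \<le> t \<and> t \<le> 1 \<and> q t = y" if y: "norm y \<le> R" for y
  proof -
    define c where "c b = (y \<bullet> b / R' + 1) / 2" for b
    have R'0: "R' > 0" by (simp add: R'_def)
    have c: "0 \<le> c b" "c b < 1" if "b \<in> Basis" for b
    proof -
      have "\<bar>y \<bullet> b\<bar> < R'" using Basis_le_norm[OF that, of y] y by (simp add: R'_def)
      then have "- 1 \<le> y \<bullet> b / R'" "y \<bullet> b / R' < 1" using R'0 by (auto simp: field_simps)
      then show "0 \<le> c b" "c b < 1" by (auto simp: c_def)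
    qed
    have "\<exists>a. (\<forall>k. a k = 0 \<or> a k = (1::real)) \<and> (b \<in> Basis \<longrightarrow> (\<lambda>k. a k / 2 ^ Suc k) sums c b)" for b
    proof (cases "b \<in> Basis")
      case True
      obtain a :: "nat \<Rightarrow> real" where "\<And>k. a k = 0 \<or> a k = 1" "(\<lambda>k. a k / 2 ^ Suc k) sums c b"
        using binary_expansion[OF c(1)[OF True] c(2)[OF True]] by blast
      then show ?thesis by blast
    next
      case False
      then show ?thesis by (intro exI[of _ "\<lambda>_. 0"]) simp
    qed
    then obtain a where a: "\<And>b k. a b k = 0 \<or> a b k = (1::real)"
      "\<And>b. b \<in> Basis \<Longrightarrow> (\<lambda>k. a b k / 2 ^ Suc k) sums c b" by metis
    \<comment> \<open>Interleaving: position \<open>?d * k + idx b\<close> holds binary digit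
      \<open>k\<close> of coordinate \<open>b\<close>.\<close>
    define A where "A n = a (the_inv_into Basis idx (n mod ?d)) (n div ?d)" for n
    obtain t where t: "0 \<le> t" "t \<le> 1" "\<And>n. zigzag (3 ^ n * t) = A n"
      using ternary_code[of A] a(1) unfolding A_def by metis
    have sb: "s b t = c b" if b: "b \<in> Basis" for b
    proof -
      have lt: "idx b < ?d" using idx b by (auto simp: bij_betw_def)
      have "A (?d * k + idx b) = a b k" for k
      proof -
        have "(?d * k + idx b) mod ?d = idx b" "(?d * k + idx b) div ?d = k" using lt by auto
        moreover have "the_inv_into Basis idx (idx b) = b"
          using idx b by (auto simp: bij_betw_def the_inv_into_f_f)
        ultimately show ?thesis by (simp add: A_def)
      qed
      then have "s b t = (\<Sum>k. a b k / 2 ^ Suc k)" unfolding s_def t(3) by simp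
      then show ?thesis using sums_unique[OF a(2)[OF b]] by simp
    qed
    have "q t = (\<Sum>b\<in>Basis. (y \<bullet> b) *\<^sub>R b)"
    proof -
      have "(2 * s b t - 1) * R' = y \<bullet> b" if "b \<in> Basis" for b
        unfolding sb[OF that] c_def using R'0 by (simp add: field_simps)
      then show ?thesis unfolding q_def by simp
    qed
    then show ?thesis using t(1,2) by (auto simp: euclidean_representation)
  qed
  ultimately show thesis by (rule that)
qed

text \<open>The atoms are lifted to \<open>[0, 1]\<close> along a curve that covers the ball, a
  tight sequence on the real line has a weakly convergent subsequence, and its limit is pushed
  forward along the curve. Missing mass is put at \<open>p0\<close> to obtain probability measures,
  hence the restriction to \<open>f p0 = 0\<close>.\<close>

lemma discrete_measures_subsequence:
  fixes w :: "nat \<Rightarrow> 'i \<Rightarrow> real" and p :: "nat \<Rightarrow> 'i \<Rightarrow> 'b::euclidean_space"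
  assumes fin: "\<And>n. finite (A n)" and w0: "\<And>n j. j \<in> A n \<Longrightarrow> w n j \<ge> 0"
    and wC: "\<And>n. sum (w n) (A n) \<le> C" and C: "C > 0"
    and pR: "\<And>n j. j \<in> A n \<Longrightarrow> norm (p n j) \<le> R" and p0: "norm p0 \<le> R"
  obtains r :: "nat \<Rightarrow> nat" and m :: "'b measure" where "strict_mono r" "finite_measure m" "sets m = sets borel"
    "\<And>f :: 'b \<Rightarrow> real. continuous_on UNIV f \<Longrightarrow> f p0 = 0 \<Longrightarrow>
       integrable m f \<and>
       (\<lambda>n. \<Sum>j\<in>A (r n). w (r n) j * f (p (r n) j)) \<longlonglongrightarrow> (\<integral>x. f x \<partial>m)"
proof -
  obtain q :: "real \<Rightarrow> 'b" where q: "continuous_on UNIV q" "bounded (range q)"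
    "\<And>y. norm y \<le> R \<Longrightarrow> \<exists>t. 0 \<le> t \<and> t \<le> 1 \<and> q t = y"
    using space_filling_curve[of R] by blast
  define t where "t n j = (SOME t. 0 \<le> t \<and> t \<le> 1 \<and> q t = p n j)" for n j
  have t: "0 \<le> t n j \<and> t n j \<le> 1 \<and> q (t n j) = p n j" if "j \<in> A n" for n j
    unfolding t_def by (rule someI_ex[OF q(3)[OF pR[OF that]]])
  obtain t0 where t0: "0 \<le> t0" "t0 \<le> 1" "q t0 = p0" using q(3)[OF p0] by blast
  define J where "J n = insert None (Some ` A n)" for n
  \<comment> \<open>Division by \<open>C\<close> leaves total mass at most \<open>1\<close>;
    \<open>None\<close>, located at \<open>t0\<close>, carries the deficit.\<close>
  define W where "W n i = (case i of None \<Rightarrow> 1 - sum (w n) (A n) / C | Some j \<Rightarrow> w n j / C)" for n i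
  define \<tau> where "\<tau> n i = (case i of None \<Rightarrow> t0 | Some j \<Rightarrow> t n j)" for n i
  have finJ: "finite (J n)" for n using fin by (simp add: J_def)
  have sumJ: "(\<Sum>i\<in>J n. g i) = g None + (\<Sum>j\<in>A n. g (Some j))" for n and g :: "_ \<Rightarrow> real"
    unfolding J_def using fin[of n] by (simp add: sum.reindex)
  have W0: "W n i \<ge> 0" if "i \<in> J n" for n i
    using that w0 wC[of n] C by (auto simp: J_def W_def)
  have W1: "(\<Sum>i\<in>J n. W n i) = 1" for n
    unfolding sumJ by (simp add: W_def flip: sum_divide_distrib)
  have \<tau>01: "0 \<le> \<tau> n i \<and> \<tau> n i \<le> 1" if "i \<in> J n" for n i
    using that t0 t by (auto simp: J_def \<tau>_def)
  define P where "P n = point_measure (J n) (\<lambda>i. ennreal (W n i))" for n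
  have spP: "space (P n) = J n" for n by (simp add: P_def space_point_measure)
  interpret P: prob_space "P n" for n
  proof
    show "emeasure (P n) (space (P n)) = 1"
      unfolding spP using W0 W1 finJ by (simp add: P_def emeasure_point_measure_finite sum_ennreal)
  qed
  have [measurable]: "\<tau> n \<in> borel_measurable (P n)" for n by (simp add: P_def)
  define Mn where "Mn n = distr (P n) borel (\<tau> n)" for n
  have rd: "real_distribution (Mn n)" for n
    unfolding real_distribution_def real_distribution_axioms_def Mn_def
    by (auto intro!: P.prob_space_distr)
  have "tight Mn" unfolding tight_def
  proof (intro conjI allI impI rd)
    fix \<epsilon> :: real assume \<epsilon>: "\<epsilon> > 0"
    have "measure (Mn n) {-1<..1} = 1" for n
    proof -
      have "measure (Mn n) {-1<..1} = measure (P n) (\<tau> n -` {-1<..1} \<inter> space (P n))"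
        unfolding Mn_def by (rule measure_distr) auto
      also have "\<tau> n -` {-1<..1} \<inter> space (P n) = space (P n)"
        using \<tau>01 by (force simp: spP)
      finally show ?thesis by (simp add: P.prob_space)
    qed
    then show "\<exists>a b. a < b \<and> (\<forall>n. 1 - \<epsilon> < measure (Mn n) {a<..b})"
      using \<epsilon> by (intro exI[of _ "-1"] exI[of _ 1]) simp
  qed
  from tight_imp_convergent_subsubsequence[OF this, of id]
  obtain r M where r: "strict_mono r" and rM: "real_distribution M" and conv: "weak_conv_m (Mn \<circ> id \<circ> r) M"
    by (auto simp: strict_mono_id)
  interpret M: real_distribution M by (rule rM)
  have [measurable]: "q \<in> borel_measurable borel" using q(1) by (rule borel_measurable_continuous_onI)
  define m where "m = density (distr M borel q) (\<lambda>_. ennreal C)"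
  have "finite_measure m"
  proof
    interpret D: prob_space "distr M borel q" by (rule M.prob_space_distr) simp
    have "emeasure m (space m) = ennreal C * 1"
      unfolding m_def using D.emeasure_space_1
      by (simp add: emeasure_density nn_integral_cmult)
    then show "emeasure m (space m) \<noteq> \<infinity>" by simp
  qed
  moreover have "sets m = sets borel" by (simp add: m_def)
  moreover have "integrable m f \<and> (\<lambda>n. \<Sum>j\<in>A (r n). w (r n) j * f (p (r n) j)) \<longlonglongrightarrow> (\<integral>x. f x \<partial>m)"
    if f: "continuous_on UNIV f" "f p0 = 0" for f :: "'b \<Rightarrow> real"
  proof
    have [measurable]: "f \<in> borel_measurable borel" using f(1) by (rule borel_measurable_continuous_onI)
    \<comment> \<open>The range of \<open>q\<close> over the whole line is bounded, so
      \<open>f\<close> after \<open>q\<close> is a bounded function wherever \<open>M\<close> is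
      concentrated.\<close>
    have "compact (f ` closure (range q))"
      using q(2) f(1) by (intro compact_continuous_image) (auto intro: continuous_on_subset)
    then obtain K where K: "\<And>x. x \<in> closure (range q) \<Longrightarrow> norm (f x) \<le> K"
      by (metis bounded_iff compact_imp_bounded imageI)
    have fq: "norm (f (q s)) \<le> K" for s using K[of "q s"] closure_subset[of "range q"] by auto
    have cont: "isCont (\<lambda>s. f (q s)) s" for s
      using continuous_on_compose2[OF f(1) q(1)] by (simp add: continuous_on_eq_continuous_at)
    have intM: "integrable M (\<lambda>s. f (q s))"
      by (rule M.integrable_const_bound[of _ K]) (use fq in auto)
    have "integrable (distr M borel q) (\<lambda>x. C *\<^sub>R f x)"
      using intM by (subst integrable_distr_eq) auto
    then show "integrable m f"
      unfolding m_def using C by (subst integrable_density) auto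
    have im: "(\<integral>x. f x \<partial>m) = C * (\<integral>s. f (q s) \<partial>M)"
      unfolding m_def using C by (subst integral_density) (auto simp: integral_distr)
    have "(\<lambda>n. integral\<^sup>L ((Mn \<circ> id \<circ> r) n) (\<lambda>s. f (q s))) \<longlonglongrightarrow> (\<integral>s. f (q s) \<partial>M)"
      by (rule weak_conv_imp_integral_bdd_continuous_conv[OF _ rM conv cont fq]) (simp add: rd)
    then have "(\<lambda>n. C * (\<integral>s. f (q s) \<partial>Mn (r n))) \<longlonglongrightarrow> (\<integral>x. f x \<partial>m)"
      unfolding im by (intro tendsto_intros) (simp add: o_def)
    moreover have "C * (\<integral>s. f (q s) \<partial>Mn n) = (\<Sum>j\<in>A n. w n j * f (p n j))" for n
    proof -
      have "(\<integral>s. f (q s) \<partial>Mn n) = (\<integral>i. f (q (\<tau> n i)) \<partial>P n)"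
        unfolding Mn_def by (rule integral_distr) auto
      also have "\<dots> = (\<Sum>i\<in>J n. W n i * f (q (\<tau> n i)))"
        unfolding P_def using finJ W0 by (subst lebesgue_integral_point_measure_finite) auto
      also have "\<dots> = (\<Sum>j\<in>A n. w n j / C * f (p n j))"
        unfolding sumJ using t0(3) f(2) t by (auto simp: W_def \<tau>_def intro!: sum.cong)
      finally show ?thesis using C by (simp add: sum_distrib_left)
    qed
    ultimately show "(\<lambda>n. \<Sum>j\<in>A (r n). w (r n) j * f (p (r n) j)) \<longlonglongrightarrow> (\<integral>x. f x \<partial>m)" by simp
  qed
  ultimately show thesis using that[OF r] by blast
qed

section \<open>The measure representing the non-local part\<close>

context gamma_limit
begin

text \<open>A fixed \<open>u\<close> meets the grid condition once the mesh is small against the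
  distance of its support from the complement of the domain. From then on its interpolants are
  uniformly close to \<open>u\<close>, so their energies tend to \<open>G u\<close> and stay close
  to discrete sums that converge to an integral.\<close>

lemma limit_measure:
  obtains m :: "('a \<times> 'a) measure" where "finite_measure m" "sets m = sets borel"
    "\<And>u. test_fn \<Omega> u \<Longrightarrow> integrable m (\<lambda>z. (u (fst z) - u (snd z))\<^sup>2) \<and>
       G u = (\<integral>z. (u (fst z) - u (snd z))\<^sup>2 \<partial>m)"
proof -
  obtain xs where xs: "xs \<notin> \<Omega>" using bounded_dom not_bounded_UNIV by (metis UNIV_eq_I)
  have "bounded (insert xs \<Omega>)" using bounded_dom by simp
  then obtain R where R: "\<And>x. x \<in> insert xs \<Omega> \<Longrightarrow> norm x \<le> R" by (auto simp: bounded_iff)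
  define N where "N n = real (Suc n)" for n
  have N: "N n > 0" for n by (simp add: N_def)
  \<comment> \<open>The conclusion of \<open>grid_approximation\<close> as a predicate, so that
    index sets, weights and atoms can be chosen for all \<open>n\<close> at once.\<close>
  define good where "good n A w p \<longleftrightarrow>
    finite A \<and> (\<forall>j\<in>A. w j \<ge> (0::real)) \<and> sum w A \<le> mass_bound \<and>
    (\<forall>j\<in>A. fst (p j) \<in> insert xs \<Omega> \<and> snd (p j) \<in> insert xs \<Omega>) \<and>
    (\<forall>u L. test_fn \<Omega> u \<longrightarrow> L \<ge> 0 \<longrightarrow> (\<forall>x y. \<bar>u x - u y\<bar> \<le> L * norm (x - y)) \<longrightarrow>
       (\<forall>x y. u x \<noteq> 0 \<longrightarrow> norm (y - x) \<le> 3 * (real DIM('a) / N n) \<longrightarrow> y \<in> \<Omega>) \<longrightarrow>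
       (\<exists>v. test_fn \<Omega> v \<and> (\<forall>x. \<bar>v x - u x\<bar> \<le> L * (real DIM('a) / N n)) \<and>
          \<bar>G v - (\<Sum>j\<in>A. w j * (u (fst (p j)) - u (snd (p j)))\<^sup>2)\<bar> \<le>
            2 * 3 ^ DIM('a) * M * (L * (real DIM('a) / N n))\<^sup>2))"
    for n and A :: "(('a \<Rightarrow> int) \<times> ('a \<Rightarrow> int) option) set" and w and p :: "_ \<Rightarrow> 'a \<times> 'a"
  have "\<exists>A w p. good n A w p" for n
    unfolding good_def by (rule grid_approximation[OF xs N])
  then obtain A w p where g: "\<And>n. good n (A n) (w n) (p n)" by metis
  have C: "mass_bound > 0" using M by (simp add: mass_bound_def add_pos_pos)
  have fin: "finite (A n)" and w0: "\<And>j. j \<in> A n \<Longrightarrow> w n j \<ge> 0" and wC: "sum (w n) (A n) \<le> mass_bound"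
    and pin: "\<And>j. j \<in> A n \<Longrightarrow> fst (p n j) \<in> insert xs \<Omega> \<and> snd (p n j) \<in> insert xs \<Omega>" for n
    using g[of n] unfolding good_def by blast+
  have pR: "norm (p n j) \<le> R + R" if "j \<in> A n" for n j
    using norm_Pair_le[of "fst (p n j)" "snd (p n j)"] R pin[OF that] by (smt (verit) prod.collapse)
  \<comment> \<open>All integrands \<open>(u (fst z) - u (snd z))^2\<close> vanish at
    \<open>(xs, xs)\<close>, which makes it a place for the missing mass.\<close>
  have p0: "norm (xs, xs) \<le> R + R" using norm_Pair_le[of xs xs] R[of xs] by simp
  obtain r m where r: "strict_mono r" and m: "finite_measure m" "sets m = sets borel"
    and conv: "\<And>f :: 'a \<times> 'a \<Rightarrow> real. continuous_on UNIV f \<Longrightarrow> f (xs, xs) = 0 \<Longrightarrow>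
       integrable m f \<and> (\<lambda>n. \<Sum>j\<in>A (r n). w (r n) j * f (p (r n) j)) \<longlonglongrightarrow> (\<integral>x. f x \<partial>m)"
    using discrete_measures_subsequence[of A w mass_bound p "R + R" "(xs, xs)", OF fin w0 wC C pR p0] by blast
  show thesis
  proof (rule that[OF m])
    fix u assume u: "test_fn \<Omega> u"
    let ?f = "\<lambda>z. (u (fst z) - u (snd z))\<^sup>2"
    define S where "S n = (\<Sum>j\<in>A n. w n j * ?f (p n j))" for n
    have "continuous_on UNIV (\<lambda>z. u (fst z))" "continuous_on UNIV (\<lambda>z. u (snd z))"
      using smooth_continuous_on[OF test_fn_smooth[OF u], of UNIV]
      by (auto intro!: continuous_on_compose2[of UNIV u] continuous_intros)
    then have cont: "continuous_on UNIV ?f" by (intro continuous_intros)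
    obtain L where L: "L \<ge> 0" "\<And>x y. \<bar>u x - u y\<bar> \<le> L * norm (x - y)" using u test_fn_Lipschitz by metis
    obtain K where K: "compact K" "K \<subseteq> \<Omega>" "\<And>x. x \<notin> K \<Longrightarrow> u x = 0" using u test_fnE by metis
    obtain \<delta> where \<delta>: "\<delta> > 0" "\<And>x y. x \<in> K \<Longrightarrow> y \<notin> \<Omega> \<Longrightarrow> \<delta> \<le> dist x y"
    proof -
      have "K \<inter> - \<Omega> = {}" "closed (- \<Omega>)" using K(2) open_dom by auto
      then show thesis using separate_compact_closed[OF K(1), of "- \<Omega>"] that by auto
    qed
    define D where "D n = real DIM('a) / N n" for n
    have "(\<lambda>n. real DIM('a) * (1 / real (Suc n))) \<longlonglongrightarrow> real DIM('a) * 0"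
      by (intro tendsto_intros inverse_Suc_tendsto)
    then have D: "D \<longlonglongrightarrow> 0" by (simp add: D_def[abs_def] N_def)
    have D0: "D n \<ge> 0" for n by (simp add: D_def N_def)
    have "(\<lambda>n. 3 * D n) \<longlonglongrightarrow> 3 * 0" by (intro tendsto_intros D)
    from order_tendstoD(2)[OF this, of \<delta>] \<delta>(1) have ev: "\<forall>\<^sub>F n in sequentially. 3 * D n < \<delta>" by simp
    let ?P = "\<lambda>n v. test_fn \<Omega> v \<and> (\<forall>x. \<bar>v x - u x\<bar> \<le> L * D n) \<and>
        \<bar>G v - S n\<bar> \<le> 2 * 3 ^ DIM('a) * M * (L * D n)\<^sup>2"
    have ex: "\<forall>\<^sub>F n in sequentially. \<exists>v. ?P n v"
      using ev
    proof (rule eventually_mono)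
      fix n assume n: "3 * D n < \<delta>"
      have "y \<in> \<Omega>" if "u x \<noteq> 0" "norm (y - x) \<le> 3 * D n" for x y
        using \<delta>(2)[of x y] K(3)[of x] that n by (force simp: dist_norm norm_minus_commute)
      then show "\<exists>v. ?P n v"
        using g[of n] u L unfolding good_def D_def[symmetric] S_def by blast
    qed
    \<comment> \<open>The default \<open>u\<close>, taken where no approximant exists and so for
      finitely many \<open>n\<close> at most, makes \<open>v1\<close> and \<open>v2\<close> true for
      every \<open>n\<close>.\<close>
    define v where "v n = (if \<exists>v. ?P n v then SOME v. ?P n v else u)" for n
    have v: "?P n (v n)" if "\<exists>v. ?P n v" for n
      using someI_ex[OF that] that unfolding v_def by simp
    have v1: "test_fn \<Omega> (v n)" for n using v[of n] u by (cases "\<exists>v. ?P n v") (auto simp: v_def)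
    have v2: "\<bar>v n x - u x\<bar> \<le> L * D n" for n x
      using v[of n] L(1) D0[of n] by (cases "\<exists>v. ?P n v") (auto simp: v_def)
    have cD: "(\<lambda>n. L * D n) \<longlonglongrightarrow> 0" using tendsto_mult[OF tendsto_const D, of L] by simp
    have G1: "(\<lambda>n. G (v n)) \<longlonglongrightarrow> G u" by (rule G_uniform_tendsto[OF v1 u v2 cD])
    have "(\<lambda>n. G (v n) - S n) \<longlonglongrightarrow> 0"
    proof (rule Lim_null_comparison)
      show "\<forall>\<^sub>F n in sequentially. norm (G (v n) - S n) \<le> 2 * 3 ^ DIM('a) * M * (L * D n)\<^sup>2"
        using ex by (rule eventually_mono) (use v in auto)
      have "(\<lambda>n. 2 * 3 ^ DIM('a) * M * (L * D n)\<^sup>2) \<longlonglongrightarrow> 2 * 3 ^ DIM('a) * M * 0\<^sup>2"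
        by (intro tendsto_intros cD)
      then show "(\<lambda>n. 2 * 3 ^ DIM('a) * M * (L * D n)\<^sup>2) \<longlonglongrightarrow> 0" by simp
    qed
    from tendsto_diff[OF G1 this] have "S \<longlonglongrightarrow> G u" by simp
    from LIMSEQ_subseq_LIMSEQ[OF this r] have "(\<lambda>n. S (r n)) \<longlonglongrightarrow> G u" by (simp add: o_def)
    moreover have "integrable m ?f" "(\<lambda>n. S (r n)) \<longlonglongrightarrow> (\<integral>z. ?f z \<partial>m)"
      using conv[OF cont] unfolding S_def by auto
    ultimately show "integrable m ?f \<and> G u = (\<integral>z. ?f z \<partial>m)" using LIMSEQ_unique by blast
  qed
qed

end

subsection \<open>Symmetrization\<close>

text \<open>\<open>m\<close> plus its image under the swap, written as a single image measure by
  means of a two-point factor. The mass doubles, hence the factor \<open>1 / 2\<close> in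
  \<open>\<mu>0\<close> later.\<close>

definition symmetrize :: "('a::euclidean_space \<times> 'a) measure \<Rightarrow> ('a \<times> 'a) measure" where
  "symmetrize m = distr (m \<Otimes>\<^sub>M count_space (UNIV :: bool set)) borel (\<lambda>(z, b). if b then z else prod.swap z)"

lemma nn_integral_symmetrize:
  fixes f :: "'a::euclidean_space \<times> 'a \<Rightarrow> ennreal"
  assumes m: "sets m = sets borel" and f[measurable]: "f \<in> borel_measurable borel"
  shows "(\<integral>\<^sup>+z. f z \<partial>symmetrize m) = (\<integral>\<^sup>+z. f z + f (prod.swap z) \<partial>m)"
proof -
  note [measurable_cong] = m
  interpret C: sigma_finite_measure "count_space (UNIV :: bool set)"
    by (rule sigma_finite_measure_count_space_finite) simp
  have [measurable]: "(prod.swap :: 'a \<times> 'a \<Rightarrow> 'a \<times> 'a) \<in> borel_measurable borel"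
    by (auto intro!: borel_measurable_continuous_onI continuous_on_swap)
  have T[measurable]: "(\<lambda>(z, b). if b then z else prod.swap z) \<in> measurable (m \<Otimes>\<^sub>M count_space (UNIV :: bool set)) borel"
    unfolding split_beta' by measurable
  have "(\<integral>\<^sup>+z. f z \<partial>symmetrize m) =
      (\<integral>\<^sup>+y. f (case y of (z, b) \<Rightarrow> if b then z else prod.swap z) \<partial>(m \<Otimes>\<^sub>M count_space (UNIV :: bool set)))"
    unfolding symmetrize_def by (rule nn_integral_distr) auto
  also have "\<dots> = (\<integral>\<^sup>+z. (\<integral>\<^sup>+b. f (if b then z else prod.swap z) \<partial>count_space (UNIV :: bool set)) \<partial>m)"
    by (subst C.nn_integral_fst[symmetric]) auto
  also have "\<dots> = (\<integral>\<^sup>+z. f z + f (prod.swap z) \<partial>m)"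
    by (intro nn_integral_cong) (simp add: nn_integral_count_space_finite UNIV_bool add.commute)
  finally show ?thesis .
qed

section \<open>Splitting the limit measure into jumps and killing\<close>

theorem theorem2p2:
  fixes \<Omega> :: "'a::euclidean_space set"
    and M :: real
    and a :: "nat \<Rightarrow> 'a \<times> 'a \<Rightarrow> real"
    and F :: "('a \<Rightarrow> real) \<Rightarrow> ennreal"
  assumes "open \<Omega>" and "connected \<Omega>" and "bounded \<Omega>"
    and "M > 0"
    and "\<And>k. set_integrable lborel (\<Omega> \<times> \<Omega>) (a k)"
    and "\<And>k z. z \<in> \<Omega> \<times> \<Omega> \<Longrightarrow> a k z \<ge> 0"
    and "\<And>k. (LINT z:\<Omega> \<times> \<Omega>|lborel. a k z) \<le> M"
    and "Gamma_conv_weak_H10 \<Omega> (\<lambda>k. Fk_fun \<Omega> (a k)) F"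
  shows "\<exists>(\<mu> :: ('a \<times> 'a) measure) (\<nu> :: 'a measure).
           radon_on (\<Omega> \<times> \<Omega>) \<mu> \<and> radon_on \<Omega> \<nu> \<and>
           (\<forall>u. test_fn \<Omega> u \<longrightarrow>
              F u = (\<integral>\<^sup>+z. ennreal ((u (fst z) - u (snd z))\<^sup>2) \<partial>\<mu>) +
                    (\<integral>\<^sup>+x. ennreal ((u x)\<^sup>2) \<partial>\<nu>) +
                    (\<integral>\<^sup>+x\<in>\<Omega>. ennreal ((norm (grad u x))\<^sup>2) \<partial>lborel)) \<and>
           (\<forall>A B. A \<in> sets borel \<longrightarrow> B \<in> sets borel \<longrightarrow> A \<subseteq> \<Omega> \<longrightarrow> B \<subseteq> \<Omega> \<longrightarrow>
              emeasure \<mu> (A \<times> B) = emeasure \<mu> (B \<times> A)) \<and>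
           emeasure \<mu> ((\<Omega> \<times> \<Omega>) \<inter> {(x, x) | x. True}) = 0"
proof -
  interpret gamma_limit \<Omega> M a F
    using assms by unfold_locales auto
  obtain m :: "('a \<times> 'a) measure" where fin: "finite_measure m" and sm: "sets m = sets borel"
    and m: "\<And>u. test_fn \<Omega> u \<Longrightarrow> integrable m (\<lambda>z. (u (fst z) - u (snd z))\<^sup>2) \<and>
       G u = (\<integral>z. (u (fst z) - u (snd z))\<^sup>2 \<partial>m)"
    using limit_measure by blast
  interpret m: finite_measure m by (rule fin)
  note [measurable_cong] = sm
  have [measurable]: "\<Omega> \<in> sets borel" using \<open>open \<Omega>\<close> by simp
  define \<Delta> where "\<Delta> = {(x, x) | x :: 'a. True}"
  have "closed \<Delta>"
  proof -
    have "\<Delta> = {z. fst z = snd z}" by (auto simp: \<Delta>_def)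
    then show ?thesis by (simp add: closed_Collect_eq continuous_on_fst continuous_on_snd continuous_on_id)
  qed
  have "open (\<Omega> \<times> \<Omega>)" using \<open>open \<Omega>\<close> by (intro open_Times)
  define W where "W = \<Omega> \<times> \<Omega> - \<Delta>"
  have W[measurable]: "W \<in> sets borel" unfolding W_def
    using \<open>closed \<Delta>\<close> \<open>open (\<Omega> \<times> \<Omega>)\<close> by (intro sets.Diff borel_open borel_closed)
  \<comment> \<open>A weak limit may charge pairs with a boundary point, not only with
    \<open>xs\<close>. Test functions vanish there too, so every pair with exactly one point in the
    domain counts as killing at that point, which \<open>pr\<close> selects.\<close>
  define V where "V = {z. (fst z \<in> \<Omega>) \<noteq> (snd z \<in> \<Omega>)}"
  have V[measurable]: "V \<in> sets borel" unfolding V_def by measurable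
  define pr where "pr z = (if fst z \<in> \<Omega> then fst z else snd z)" for z :: "'a \<times> 'a"
  have [measurable]: "pr \<in> borel_measurable borel" unfolding pr_def by measurable
  define \<mu>0 where "\<mu>0 = density m (\<lambda>z. ennreal (1 / 2) * indicator W z)"
  define \<mu> where "\<mu> = symmetrize \<mu>0"
  define \<nu> where "\<nu> = distr (density m (indicator V)) borel pr"
  have s\<mu>0: "sets \<mu>0 = sets borel" by (simp add: \<mu>0_def sm)
  have int\<mu>: "(\<integral>\<^sup>+z. f z \<partial>\<mu>) = (\<integral>\<^sup>+z. ennreal (1 / 2) * indicator W z * (f z + f (prod.swap z)) \<partial>m)"
    if [measurable]: "f \<in> borel_measurable borel" for f
  proof -
    have [measurable]: "(prod.swap :: 'a \<times> 'a \<Rightarrow> 'a \<times> 'a) \<in> borel_measurable borel"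
      by (auto intro!: borel_measurable_continuous_onI continuous_on_swap)
    have "(\<integral>\<^sup>+z. f z \<partial>\<mu>) = (\<integral>\<^sup>+z. f z + f (prod.swap z) \<partial>\<mu>0)"
      unfolding \<mu>_def by (rule nn_integral_symmetrize[OF s\<mu>0 that])
    also have "\<dots> = (\<integral>\<^sup>+z. ennreal (1 / 2) * indicator W z * (f z + f (prod.swap z)) \<partial>m)"
      unfolding \<mu>0_def by (rule nn_integral_density) auto
    finally show ?thesis .
  qed
  have s\<mu>: "sets \<mu> = sets borel" by (simp add: \<mu>_def symmetrize_def)
  have em\<mu>: "emeasure \<mu> X = (\<integral>\<^sup>+z. ennreal (1 / 2) * indicator W z * (indicator X z + indicator X (prod.swap z)) \<partial>m)"
    if [measurable]: "X \<in> sets borel" for X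
    using int\<mu>[of "indicator X"] s\<mu> by simp
  have s\<nu>: "sets \<nu> = sets borel" by (simp add: \<nu>_def)
  have int\<nu>: "(\<integral>\<^sup>+x. f x \<partial>\<nu>) = (\<integral>\<^sup>+z. indicator V z * f (pr z) \<partial>m)"
    if [measurable]: "f \<in> borel_measurable borel" for f
    unfolding \<nu>_def by (subst nn_integral_distr) (auto simp: nn_integral_density)
  have em\<nu>: "emeasure \<nu> X = (\<integral>\<^sup>+z. indicator V z * indicator X (pr z) \<partial>m)"
    if [measurable]: "X \<in> sets borel" for X
    using int\<nu>[of "indicator X"] s\<nu> by simp
  have fs: "emeasure m (space m) < \<top>"
    using m.emeasure_finite[of "space m"] unfolding infinity_ennreal_def less_top .
  have fin\<mu>: "emeasure \<mu> X < \<infinity>" if "X \<in> sets borel" for X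
  proof -
    have "ennreal (1 / 2) \<le> ennreal 1" by (rule ennreal_leI) simp
    then have "emeasure \<mu> X \<le> (\<integral>\<^sup>+z. ennreal 1 * 1 * (1 + 1) \<partial>m)" unfolding em\<mu>[OF that]
      by (intro nn_integral_mono mult_mono add_mono) (auto simp del: ennreal_1 simp: indicator_def)
    also have "\<dots> < \<infinity>" using fs by (simp add: ennreal_mult_less_top)
    finally show ?thesis .
  qed
  have fin\<nu>: "emeasure \<nu> X < \<infinity>" if "X \<in> sets borel" for X
  proof -
    have "emeasure \<nu> X \<le> (\<integral>\<^sup>+z. 1 \<partial>m)" unfolding em\<nu>[OF that]
      by (intro nn_integral_mono) (auto simp: indicator_def)
    also have "\<dots> < \<infinity>" using fs by simp
    finally show ?thesis .
  qed
  have r\<mu>: "radon_on (\<Omega> \<times> \<Omega>) \<mu>"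
    unfolding radon_on_def
  proof (intro conjI allI impI s\<mu>)
    have "- (\<Omega> \<times> \<Omega>) \<in> sets borel" using \<open>open (\<Omega> \<times> \<Omega>)\<close> by (simp add: borel_comp)
    then show "emeasure \<mu> (- (\<Omega> \<times> \<Omega>)) = 0"
      unfolding em\<mu>[OF \<open>- (\<Omega> \<times> \<Omega>) \<in> sets borel\<close>]
      by (intro nn_integral_zero') (auto simp: indicator_def W_def)
    show "emeasure \<mu> K < \<infinity>" if "compact K \<and> K \<subseteq> \<Omega> \<times> \<Omega>" for K
      using that by (intro fin\<mu> borel_compact) auto
  qed
  have r\<nu>: "radon_on \<Omega> \<nu>"
    unfolding radon_on_def
  proof (intro conjI allI impI s\<nu>)
    have "- \<Omega> \<in> sets borel" by (simp add: borel_comp)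
    then show "emeasure \<nu> (- \<Omega>) = 0"
      unfolding em\<nu>[OF \<open>- \<Omega> \<in> sets borel\<close>]
      by (intro nn_integral_zero') (auto simp: indicator_def V_def pr_def)
    show "emeasure \<nu> K < \<infinity>" if "compact K \<and> K \<subseteq> \<Omega>" for K
      using that by (intro fin\<nu> borel_compact) auto
  qed
  have rep: "F u = (\<integral>\<^sup>+z. ennreal ((u (fst z) - u (snd z))\<^sup>2) \<partial>\<mu>) + (\<integral>\<^sup>+x. ennreal ((u x)\<^sup>2) \<partial>\<nu>) +
      (\<integral>\<^sup>+x\<in>\<Omega>. ennreal ((norm (grad u x))\<^sup>2) \<partial>lborel)" if u: "test_fn \<Omega> u" for u
  proof -
    let ?f = "\<lambda>z. (u (fst z) - u (snd z))\<^sup>2"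
    have [measurable]: "u \<in> borel_measurable borel" using u by (simp add: test_fn_smooth smooth_borel)
    have "ennreal (G u) = (\<integral>\<^sup>+z. ennreal (?f z) \<partial>m)"
      using m[OF u] nn_integral_eq_integral[of m ?f] by simp
    \<comment> \<open>The remaining pairs, on the diagonal or with both points outside the domain,
      contribute nothing, as \<open>u\<close> vanishes off the domain.\<close>
    also have "\<dots> = (\<integral>\<^sup>+z. indicator W z * ennreal (?f z) + indicator V z * ennreal ((u (pr z))\<^sup>2) \<partial>m)"
    proof (rule nn_integral_cong)
      fix z :: "'a \<times> 'a"
      have out: "u x = 0" if "x \<notin> \<Omega>" for x using test_fn_zero_outside[OF u that] by simp
      show "ennreal (?f z) = indicator W z * ennreal (?f z) + indicator V z * ennreal ((u (pr z))\<^sup>2)"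
        using out by (cases z) (auto simp: indicator_def W_def V_def \<Delta>_def pr_def)
    qed
    also have "\<dots> = (\<integral>\<^sup>+z. indicator W z * ennreal (?f z) \<partial>m) + (\<integral>\<^sup>+z. indicator V z * ennreal ((u (pr z))\<^sup>2) \<partial>m)"
      by (rule nn_integral_add) auto
    also have "(\<integral>\<^sup>+z. indicator V z * ennreal ((u (pr z))\<^sup>2) \<partial>m) = (\<integral>\<^sup>+x. ennreal ((u x)\<^sup>2) \<partial>\<nu>)"
      by (rule int\<nu>[symmetric]) simp
    also have "(\<integral>\<^sup>+z. indicator W z * ennreal (?f z) \<partial>m) = (\<integral>\<^sup>+z. ennreal (?f z) \<partial>\<mu>)"
    proof -
      have half: "ennreal (1 / 2) * c * (ennreal t + ennreal t) = c * ennreal t" if "t \<ge> 0" for c t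
      proof -
        have "ennreal (1 / 2 * (t + t)) = ennreal (1 / 2) * ennreal (t + t)"
          using that by (intro ennreal_mult) auto
        also have "ennreal (t + t) = ennreal t + ennreal t" using that by (intro ennreal_plus)
        finally have "ennreal (1 / 2) * (ennreal t + ennreal t) = ennreal (1 / 2 * (t + t))" by (rule sym)
        also have "1 / 2 * (t + t) = t" by simp
        finally have "ennreal (1 / 2) * (ennreal t + ennreal t) = ennreal t" .
        then show ?thesis by (metis mult.assoc mult.commute)
      qed
      have "ennreal (1 / 2) * indicator W z * (ennreal (?f z) + ennreal (?f (prod.swap z))) = indicator W z * ennreal (?f z)" for z
        using half[of "?f z" "indicator W z"] by (simp add: power2_commute[of "u (snd z)"])
      then show ?thesis by (subst int\<mu>) auto
    qed
    finally have Geq: "ennreal (G u) = (\<integral>\<^sup>+z. ennreal (?f z) \<partial>\<mu>) + (\<integral>\<^sup>+x. ennreal ((u x)\<^sup>2) \<partial>\<nu>)" .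
    have "(\<integral>\<^sup>+x\<in>\<Omega>. ennreal ((norm (grad u x))\<^sup>2) \<partial>lborel) = (\<integral>\<^sup>+x. ennreal ((norm (grad u x))\<^sup>2) \<partial>lborel)"
      using test_fn_zero_outside[OF u] by (intro nn_integral_cong) (auto simp: indicator_def)
    also have "\<dots> = ennreal (sqn (grad u))" by (rule nn_integral_sqn[OF test_fn_L2_grad[OF u]])
    finally have geq: "(\<integral>\<^sup>+x\<in>\<Omega>. ennreal ((norm (grad u x))\<^sup>2) \<partial>lborel) = ennreal (sqn (grad u))" .
    have "F u = ennreal (G u + sqn (grad u))" using F_test_eq[OF u] by (simp add: Fr_eq)
    also have "\<dots> = ennreal (G u) + ennreal (sqn (grad u))"
      by (rule ennreal_plus[OF Q_nonneg[OF u] sqn_nonneg])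
    finally show ?thesis unfolding Geq geq .
  qed
  have sy: "emeasure \<mu> (A \<times> B) = emeasure \<mu> (B \<times> A)" if "A \<in> sets borel" "B \<in> sets borel" for A B :: "'a set"
  proof -
    have AB: "A \<times> B \<in> sets borel" "B \<times> A \<in> sets borel"
      using that by (auto simp: borel_Times)
    show ?thesis unfolding em\<mu>[OF AB(1)] em\<mu>[OF AB(2)]
      by (intro nn_integral_cong) (auto simp: indicator_def)
  qed
  have di: "emeasure \<mu> ((\<Omega> \<times> \<Omega>) \<inter> {(x, x) | x. True}) = 0"
  proof -
    have D: "(\<Omega> \<times> \<Omega>) \<inter> \<Delta> \<in> sets borel"
      using \<open>closed \<Delta>\<close> \<open>open (\<Omega> \<times> \<Omega>)\<close> by (intro sets.Int borel_open borel_closed)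
    have "emeasure \<mu> ((\<Omega> \<times> \<Omega>) \<inter> \<Delta>) = 0" unfolding em\<mu>[OF D]
      by (intro nn_integral_zero') (auto simp: indicator_def W_def \<Delta>_def)
    then show ?thesis by (simp add: \<Delta>_def)
  qed
  show ?thesis using r\<mu> r\<nu> rep sy di by blast
qed

end
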